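(* Let $T$ be Tsirelson's space. Then the algebra $\mathcal A(T)$ of approximable operators on $T$ is not amenable.
   Context: For a Banach space $X$, $\mathcal A(X)$ is the operator norm closure in $\mathcal B(X)$ of the continuous finite-rank operators on $X$. A Banach algebra is amenable if every continuous derivation from it into the dual of any Banach bimodule over it is inner. Tsirelson's space $T$ is the original space of Tsirelson; it is reflexive, and its dual $T^*$ is described as follows (so $T$ is the dual of the space $T^*$). Let $(t_n)$ be the unit vector basis of $c_{00}$ (scalar sequences with finite support). For finite nonempty $E,F\subset\mathbb N$, $E<F$ means $\max E<\min F$, and $\{k\}\le E$ means $k\le\min E$. For $E\subset\mathbb N$ and $x=\sum_n\alpha_nt_n\in c_{00}$ put $Ex:=\sum_{n\in E}\alpha_nt_n$. Let $\|\cdot\|_0$ be the sup norm on $c_{00}$ and, for $m\ge0$, $$\|x\|_{m+1}:=\max\Big\{\|x\|_m,\ 2^{-1}\max\Big[\sum_{j=1}^k\|E_jx\|_m\Big]\Big\}\qquad(x\in c_{00}),$$ where the inner maximum is over all choices of finite subsets $E_1,\dots,E_k$ of $\mathbb N$ with $\{k\}\le E_1<E_2<\dots<E_k$ (over all $k$). Put $\|x\|:=\lim_{m\to\infty}\|x\|_m$; this is a norm on $c_{00}$, and $T^*$ is the completion of $c_{00}$ in it. *)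

theory Defs
  imports "HOL-Analysis.Analysis" "HOL-Algebra.Module"
begin

section \<open>The space \<open>c\<^sub>0\<^sub>0\<close> with Tsirelson's norm\<close>

text \<open>
  The coordinate with index \<open>i :: nat\<close> is the coefficient of \<open>t\<^bsub>i+1\<^esub>\<close>, as the index set of
  Tsirelson's basis is \<open>{1, 2, \<dots>}\<close>. Hence the \<open>Suc\<close> in \<open>admissible\<close> below. The suprema in
  \<open>tnorm\<close> are maxima, because a vector has only finitely many different \<open>proj E x\<close>.
\<close>

typedef (overloaded) 'k c00 = "{x :: nat \<Rightarrow> 'k::zero. finite {n. x n \<noteq> 0}}"
  morphisms coord Abs_c00
  by (rule exI[of _ "\<lambda>_. 0"]) simp

setup_lifting type_definition_c00

lemma coord_eqI: "(\<And>n. coord x n = coord y n) \<Longrightarrow> x = y"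
  by transfer auto

lemma finite_supp: "finite {n. coord x n \<noteq> 0}"
  by transfer auto

lift_definition proj :: "nat set \<Rightarrow> 'k::zero c00 \<Rightarrow> 'k c00"
  is "\<lambda>E x n. if n \<in> E then x n else 0"
  by (erule finite_subset[rotated]) auto

lift_definition scale00 :: "'k::mult_zero \<Rightarrow> 'k c00 \<Rightarrow> 'k c00"
  is "\<lambda>c x n. c * x n"
  by (erule finite_subset[rotated]) auto

instantiation c00 :: (real_vector) real_vector
begin

lift_definition zero_c00 :: "'a c00" is "\<lambda>_. 0" by simp

lift_definition plus_c00 :: "'a c00 \<Rightarrow> 'a c00 \<Rightarrow> 'a c00" is "\<lambda>x y n. x n + y n"
  subgoal for x y
    by (rule finite_subset[of _ "{n. x n \<noteq> 0} \<union> {n. y n \<noteq> 0}"]) auto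
  done

lift_definition minus_c00 :: "'a c00 \<Rightarrow> 'a c00 \<Rightarrow> 'a c00" is "\<lambda>x y n. x n - y n"
  subgoal for x y
    by (rule finite_subset[of _ "{n. x n \<noteq> 0} \<union> {n. y n \<noteq> 0}"]) auto
  done

lift_definition uminus_c00 :: "'a c00 \<Rightarrow> 'a c00" is "\<lambda>x n. - x n" by simp

lift_definition scaleR_c00 :: "real \<Rightarrow> 'a c00 \<Rightarrow> 'a c00" is "\<lambda>r x n. r *\<^sub>R x n"
  by (erule finite_subset[rotated]) auto

instance
  by standard (transfer; auto simp: algebra_simps)+

end

definition admissible :: "nat set list \<Rightarrow> bool" where
  "admissible Es \<longleftrightarrow> Es \<noteq> [] \<and> (\<forall>E \<in> set Es. finite E \<and> E \<noteq> {}) \<and>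
     sorted_wrt (\<lambda>E F. Max E < Min F) Es \<and> length Es \<le> Suc (Min (hd Es))"

primrec tnorm :: "nat \<Rightarrow> 'k::real_normed_vector c00 \<Rightarrow> real" where
  "tnorm 0 x = (SUP n. norm (coord x n))"
| "tnorm (Suc m) x =
     max (tnorm m x) (1/2 * (SUP Es \<in> Collect admissible. \<Sum>E\<leftarrow>Es. tnorm m (proj E x)))"

definition l1norm :: "'k::real_normed_vector c00 \<Rightarrow> real" where
  "l1norm x = (\<Sum>n | coord x n \<noteq> 0. norm (coord x n))"

lemma l1norm_eq:
  assumes "finite S" "{n. coord x n \<noteq> 0} \<subseteq> S"
  shows "l1norm x = (\<Sum>n\<in>S. norm (coord x n))"
  unfolding l1norm_def using assms by (intro sum.mono_neutral_left) auto

lemma coord_simps [simp]: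
  "coord 0 n = 0" "coord (x + y) n = coord x n + coord y n"
  "coord (r *\<^sub>R x) n = r *\<^sub>R coord x n"
  "coord (x - y) n = coord x n - coord y n" "coord (- x) n = - coord x n"
  by (transfer; simp)+

lemma coord_proj [simp]: "coord (proj E x) n = (if n \<in> E then coord x n else 0)"
  by transfer auto

lemma coord_scale00 [simp]: "coord (scale00 c x) n = c * coord x n"
  by transfer auto

lemma admissible_singleton: "admissible [{0}]"
  by (simp add: admissible_def)

lemma norm_coord_le_l1: "norm (coord x n) \<le> l1norm x"
  by (cases "coord x n = 0")
     (auto simp: l1norm_def finite_supp intro!: sum_nonneg member_le_sum)

lemma sum_l1norm_proj_le:
  assumes "\<forall>E\<in>set Es. finite E \<and> E \<noteq> {}" "sorted_wrt (\<lambda>E F. Max E < Min F) Es"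
  shows "(\<Sum>E\<leftarrow>Es. l1norm (proj E x)) = l1norm (proj (\<Union>(set Es)) x)"
  using assms
proof (induction Es)
  case Nil
  then show ?case by (simp add: l1norm_def)
next
  case (Cons E Es)
  have fin: "finite E" "finite (\<Union>(set Es))" using Cons.prems by auto
  have disj: "E \<inter> \<Union>(set Es) = {}"
  proof -
    { fix i F assume *: "i \<in> E" "F \<in> set Es" "i \<in> F"
      then have "i \<le> Max E" "Min F \<le> i" "Max E < Min F" using Cons.prems by auto
      then have False by linarith }
    then show ?thesis by auto
  qed
  have "l1norm (proj (E \<union> \<Union>(set Es)) x)
     = (\<Sum>n\<in>E \<union> \<Union>(set Es). norm (coord (proj (E \<union> \<Union>(set Es)) x) n))"
    using fin by (intro l1norm_eq) auto
  also have "\<dots> = (\<Sum>n\<in>E. norm (coord x n)) + (\<Sum>n\<in>\<Union>(set Es). norm (coord x n))"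
    using fin disj by (simp add: sum.union_disjoint)
  also have "(\<Sum>n\<in>E. norm (coord x n)) = l1norm (proj E x)"
    using fin by (subst l1norm_eq[of E]) auto
  also have "(\<Sum>n\<in>\<Union>(set Es). norm (coord x n)) = l1norm (proj (\<Union>(set Es)) x)"
    using fin by (subst l1norm_eq[of "\<Union>(set Es)"]) (auto intro!: sum.cong)
  finally show ?case using Cons by simp
qed

lemma l1norm_proj_le: "l1norm (proj E x) \<le> l1norm x"
proof -
  have "l1norm (proj E x) = (\<Sum>n | coord x n \<noteq> 0. norm (coord (proj E x) n))"
    by (rule l1norm_eq) (auto simp: finite_supp split: if_splits)
  also have "\<dots> \<le> l1norm x" unfolding l1norm_def by (intro sum_mono) auto
  finally show ?thesis .
qed

lemma tnorm_sum_le: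
  assumes le: "\<And>x :: 'k::real_normed_vector c00. tnorm m x \<le> l1norm x" and "admissible Es"
  shows "(\<Sum>E\<leftarrow>Es. tnorm m (proj E x)) \<le> l1norm (x :: 'k c00)"
proof -
  have "(\<Sum>E\<leftarrow>Es. tnorm m (proj E x)) \<le> (\<Sum>E\<leftarrow>Es. l1norm (proj E x))"
    by (intro sum_list_mono le)
  also have "\<dots> = l1norm (proj (\<Union>(set Es)) x)"
    using assms(2) by (intro sum_l1norm_proj_le) (auto simp: admissible_def)
  finally show ?thesis using l1norm_proj_le[of "\<Union>(set Es)" x] by linarith
qed

lemma l1norm_nonneg: "0 \<le> l1norm x"
  by (simp add: l1norm_def sum_nonneg)

lemma tnorm_le_l1: "tnorm m (x :: 'k::real_normed_vector c00) \<le> l1norm x"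
proof (induction m arbitrary: x)
  case 0
  show ?case by (auto intro!: cSUP_least norm_coord_le_l1)
next
  case (Suc m)
  have "(SUP Es \<in> Collect admissible. \<Sum>E\<leftarrow>Es. tnorm m (proj E x)) \<le> l1norm x"
    using Suc.IH admissible_singleton by (intro cSUP_least) (auto intro: tnorm_sum_le)
  then show ?case using Suc.IH[of x] l1norm_nonneg[of x] by simp
qed

lemma bdd_tnorm_sum:
  "bdd_above ((\<lambda>Es. \<Sum>E\<leftarrow>Es. tnorm m (proj E x)) ` Collect admissible)"
  by (rule bdd_aboveI2[of _ _ "l1norm x"]) (auto intro: tnorm_sum_le tnorm_le_l1)

lemma bdd_coord: "bdd_above (range (\<lambda>n. norm (coord x n)))"
  by (rule bdd_aboveI2[of _ _ "l1norm x"]) (rule norm_coord_le_l1)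

lemma tnorm_mono_Suc: "tnorm m x \<le> tnorm (Suc m) x"
  by simp

lemma tnorm_incseq: "incseq (\<lambda>m. tnorm m x)"
  by (rule incseq_SucI) (rule tnorm_mono_Suc)

lemma tnorm_convergent: "convergent (\<lambda>m. tnorm m x)"
proof -
  have "Bseq (\<lambda>m. tnorm m x)"
  proof (rule BseqI'[of _ "\<bar>tnorm 0 x\<bar> + l1norm x"])
    fix m
    have "tnorm 0 x \<le> tnorm m x" by (rule incseqD[OF tnorm_incseq]) simp
    then show "norm (tnorm m x) \<le> \<bar>tnorm 0 x\<bar> + l1norm x"
      using tnorm_le_l1[of m x] l1norm_nonneg[of x] by (simp add: abs_if split: if_splits)
  qed
  then show ?thesis using tnorm_incseq Bseq_monoseq_convergent incseq_imp_monoseq by blast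
qed

lemma coord_le_tnorm0: "norm (coord x n) \<le> tnorm 0 x"
  unfolding tnorm.simps(1) by (rule cSUP_upper[OF UNIV_I bdd_coord])

lemma tnorm_triangle: "tnorm m (x + y) \<le> tnorm m x + tnorm m y"
proof (induction m arbitrary: x y)
  case 0
  have "norm (coord (x + y) n) \<le> tnorm 0 x + tnorm 0 y" for n
    using norm_triangle_ineq[of "coord x n" "coord y n"] coord_le_tnorm0[of x n]
      coord_le_tnorm0[of y n] unfolding coord_simps by linarith
  then show ?case unfolding tnorm.simps(1)[of "x + y"] by (intro cSUP_least) auto
next
  case (Suc m)
  let ?S = "\<lambda>x. SUP Es \<in> Collect admissible. \<Sum>E\<leftarrow>Es. tnorm m (proj E x)"
  have "?S (x + y) \<le> ?S x + ?S y"
  proof (rule cSUP_least)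
    show "Collect admissible \<noteq> {}" using admissible_singleton by auto
    fix Es assume Es: "Es \<in> Collect admissible"
    have proj: "proj E (x + y) = proj E x + proj E y" for E
      by (rule coord_eqI) simp
    have "(\<Sum>E\<leftarrow>Es. tnorm m (proj E (x + y)))
        \<le> (\<Sum>E\<leftarrow>Es. tnorm m (proj E x) + tnorm m (proj E y))"
      by (intro sum_list_mono) (simp add: proj Suc.IH)
    also have "\<dots> = (\<Sum>E\<leftarrow>Es. tnorm m (proj E x)) + (\<Sum>E\<leftarrow>Es. tnorm m (proj E y))"
      by (simp add: sum_list_addf)
    also have "\<dots> \<le> ?S x + ?S y"
      using Es by (intro add_mono cSUP_upper bdd_tnorm_sum)
    finally show "(\<Sum>E\<leftarrow>Es. tnorm m (proj E (x + y))) \<le> ?S x + ?S y" .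
  qed
  then show ?case using Suc.IH[of x y] by (simp add: max_def)
qed

lemma tnorm_scale_le:
  assumes f: "\<And>n. norm (coord y n) = r * norm (coord x n)" and r: "r > 0"
  shows "tnorm m y \<le> r * tnorm m x"
  using f
proof (induction m arbitrary: x y)
  case 0
  have "norm (coord y n) \<le> r * tnorm 0 x" for n
    using coord_le_tnorm0[of x n] 0 r by simp
  then show ?case unfolding tnorm.simps(1)[of y] by (intro cSUP_least) auto
next
  case (Suc m)
  let ?S = "\<lambda>x. SUP Es \<in> Collect admissible. \<Sum>E\<leftarrow>Es. tnorm m (proj E x)"
  have "?S y \<le> r * ?S x"
  proof (rule cSUP_least)
    show "Collect admissible \<noteq> {}" using admissible_singleton by auto
    fix Es assume Es: "Es \<in> Collect admissible"
    have "(\<Sum>E\<leftarrow>Es. tnorm m (proj E y)) \<le> (\<Sum>E\<leftarrow>Es. r * tnorm m (proj E x))"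
      by (intro sum_list_mono Suc.IH) (simp add: Suc.prems)
    also have "\<dots> = r * (\<Sum>E\<leftarrow>Es. tnorm m (proj E x))"
      by (simp add: sum_list_const_mult)
    also have "\<dots> \<le> r * ?S x"
      using Es r by (intro mult_left_mono cSUP_upper bdd_tnorm_sum) auto
    finally show "(\<Sum>E\<leftarrow>Es. tnorm m (proj E y)) \<le> r * ?S x" .
  qed
  moreover have "tnorm m y \<le> r * tnorm m x" by (intro Suc.IH Suc.prems)
  moreover have "r * tnorm m x \<le> r * max (tnorm m x) (1/2 * ?S x)"
    "r * (1/2 * ?S x) \<le> r * max (tnorm m x) (1/2 * ?S x)"
    using r by (intro mult_left_mono; simp)+
  ultimately show ?case by simp
qed

lemma tnorm_scale:
  assumes f: "\<And>n. norm (coord y n) = r * norm (coord x n)" and r: "r \<ge> 0"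
  shows "tnorm m y = r * tnorm m x"
proof (cases "r = 0")
  case True
  then have "l1norm y = 0" using f by (simp add: l1norm_def)
  moreover have "0 \<le> tnorm 0 y"
    using coord_le_tnorm0[of y 0] norm_ge_zero order_trans by blast
  moreover have "tnorm 0 y \<le> tnorm m y" by (rule incseqD[OF tnorm_incseq]) simp
  ultimately show ?thesis using tnorm_le_l1[of m y] True by simp
next
  case False
  with r have r: "r > 0" by simp
  have "tnorm m x \<le> inverse r * tnorm m y"
    by (rule tnorm_scale_le) (use r f in \<open>auto simp: field_simps\<close>)
  then have "r * tnorm m x \<le> tnorm m y" using r by (simp add: field_simps)
  with tnorm_scale_le[OF f r, of m] show ?thesis by simp
qed

instantiation c00 :: (real_normed_vector) real_normed_vector
begin

definition norm_c00 :: "'a c00 \<Rightarrow> real" where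
  "norm_c00 x = lim (\<lambda>m. tnorm m x)"

definition "dist_c00 x y = norm (x - y :: 'a c00)"
definition "sgn_c00 x = x /\<^sub>R norm (x :: 'a c00)"
definition [code del]:
  "uniformity_c00 = (INF e\<in>{0 <..}. principal {(x :: 'a c00, y). dist x y < e})"
definition [code del]:
  "open_c00 (U :: 'a c00 set) \<longleftrightarrow> (\<forall>x\<in>U. \<forall>\<^sub>F (x', y) in uniformity. x' = x \<longrightarrow> y \<in> U)"

lemma tnorm_tendsto: "(\<lambda>m. tnorm m x) \<longlonglongrightarrow> norm (x :: 'a c00)"
  unfolding norm_c00_def using tnorm_convergent by (simp add: convergent_LIMSEQ_iff)

lemma tnorm_le_norm: "tnorm m x \<le> norm (x :: 'a c00)"
  by (rule incseq_le[OF tnorm_incseq tnorm_tendsto])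

instance
proof
  fix x y :: "'a c00" and r :: real
  show "dist x y = norm (x - y)" by (rule dist_c00_def)
  show "sgn x = x /\<^sub>R norm x" by (rule sgn_c00_def)
  show "uniformity = (INF e\<in>{0 <..}. principal {(x :: 'a c00, y). dist x y < e})"
    by (rule uniformity_c00_def)
  show "open U = (\<forall>x\<in>U. \<forall>\<^sub>F (x', y) in uniformity. x' = x \<longrightarrow> y \<in> U)" for U :: "'a c00 set"
    by (rule open_c00_def)
  show "norm x = 0 \<longleftrightarrow> x = 0"
  proof
    assume "norm x = 0"
    then have "norm (coord x n) \<le> 0" for n
      using coord_le_tnorm0[of x n] tnorm_le_norm[of 0 x] by linarith
    then show "x = 0" by (intro coord_eqI) simp
  next
    assume "x = 0"
    then have "tnorm m x = 0" for m using tnorm_scale[of x 0 x m] by simp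
    then have "(\<lambda>m. tnorm m x) \<longlonglongrightarrow> 0" by simp
    then show "norm x = 0" using tnorm_tendsto LIMSEQ_unique by blast
  qed
  show "norm (x + y) \<le> norm x + norm y"
    by (rule LIMSEQ_le[OF tnorm_tendsto tendsto_add[OF tnorm_tendsto tnorm_tendsto]])
       (auto intro: tnorm_triangle)
  have "tnorm m (r *\<^sub>R x) = \<bar>r\<bar> * tnorm m x" for m by (rule tnorm_scale) auto
  then have "(\<lambda>m. tnorm m (r *\<^sub>R x)) \<longlonglongrightarrow> \<bar>r\<bar> * norm x"
    by (simp add: tendsto_mult tnorm_tendsto)
  then show "norm (r *\<^sub>R x) = \<bar>r\<bar> * norm x" using tnorm_tendsto LIMSEQ_unique by blast
qed

end

lemma norm_scale00: "norm (scale00 c x) = norm c * norm x"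
  for c :: "'k::real_normed_field"
proof -
  have "tnorm m (scale00 c x) = norm c * tnorm m x" for m
    by (rule tnorm_scale) (auto simp: norm_mult)
  then have "(\<lambda>m. tnorm m (scale00 c x)) \<longlonglongrightarrow> norm c * norm x"
    by (simp add: tendsto_mult tnorm_tendsto)
  then show ?thesis using tnorm_tendsto LIMSEQ_unique by blast
qed

section \<open>Completion of a normed space\<close>

lemma Cauchy_add_seq:
  fixes X Y :: "nat \<Rightarrow> 'a::real_normed_vector"
  assumes "Cauchy X" "Cauchy Y"
  shows "Cauchy (\<lambda>n. X n + Y n)"
proof (rule CauchyI)
  fix e :: real assume "0 < e"
  then have e: "0 < e / 2" by simp
  obtain M where M: "\<And>m n. m \<ge> M \<Longrightarrow> n \<ge> M \<Longrightarrow> norm (X m - X n) < e / 2"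
    using CauchyD[OF assms(1) e] by blast
  obtain N where N: "\<And>m n. m \<ge> N \<Longrightarrow> n \<ge> N \<Longrightarrow> norm (Y m - Y n) < e / 2"
    using CauchyD[OF assms(2) e] by blast
  have "norm (X m + Y m - (X n + Y n)) < e" if "m \<ge> max M N" "n \<ge> max M N" for m n
  proof -
    have "norm ((X m - X n) + (Y m - Y n)) \<le> norm (X m - X n) + norm (Y m - Y n)"
      by (rule norm_triangle_ineq)
    then show ?thesis using M[of m n] N[of m n] that by (simp add: algebra_simps)
  qed
  then show "\<exists>M. \<forall>m\<ge>M. \<forall>n\<ge>M. norm (X m + Y m - (X n + Y n)) < e" by blast
qed

lemma Cauchy_scaleR_seq:
  "Cauchy X \<Longrightarrow> Cauchy (\<lambda>n. r *\<^sub>R (X n :: 'a::real_normed_vector))"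
  by (rule bounded_linear.Cauchy[OF bounded_linear_scaleR_right])

lemma Cauchy_minus_seq:
  "Cauchy X \<Longrightarrow> Cauchy (\<lambda>n. - (X n :: 'a::real_normed_vector))"
  using Cauchy_scaleR_seq[of X "-1"] by simp

lemma Cauchy_diff_seq:
  "Cauchy X \<Longrightarrow> Cauchy Y \<Longrightarrow> Cauchy (\<lambda>n. X n - (Y n :: 'a::real_normed_vector))"
  using Cauchy_add_seq[of X "\<lambda>n. - Y n"] Cauchy_minus_seq[of Y] by simp

lemma Cauchy_norm_tendsto:
  fixes X :: "nat \<Rightarrow> 'a::real_normed_vector"
  assumes "Cauchy X"
  shows "(\<lambda>n. norm (X n)) \<longlonglongrightarrow> lim (\<lambda>n. norm (X n))"
proof -
  have "Cauchy (\<lambda>n. norm (X n))"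
  proof (rule CauchyI)
    fix e :: real assume "0 < e"
    then obtain M where "\<forall>m\<ge>M. \<forall>n\<ge>M. norm (X m - X n) < e"
      using CauchyD[OF assms] by blast
    then show "\<exists>M. \<forall>m\<ge>M. \<forall>n\<ge>M. norm (norm (X m) - norm (X n)) < e"
      by (metis norm_triangle_ineq3 order_le_less_trans real_norm_def)
  qed
  then show ?thesis by (simp add: Cauchy_convergent convergent_LIMSEQ_iff[symmetric])
qed

definition same_limit :: "(nat \<Rightarrow> 'a::real_normed_vector) \<Rightarrow> (nat \<Rightarrow> 'a) \<Rightarrow> bool" where
  "same_limit X Y \<longleftrightarrow> Cauchy X \<and> Cauchy Y \<and> (\<lambda>n. X n - Y n) \<longlonglongrightarrow> 0"

lemma same_limit_refl: "same_limit X X \<longleftrightarrow> Cauchy X"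
  by (simp add: same_limit_def)

quotient_type (overloaded) 'a completion = "nat \<Rightarrow> 'a::real_normed_vector" / partial: same_limit
proof (rule part_equivpI)
  show "\<exists>X :: nat \<Rightarrow> 'a. same_limit X X"
    by (rule exI[of _ "\<lambda>_. 0"]) (simp add: same_limit_def convergent_Cauchy convergent_const)
  show "symp (same_limit :: (nat \<Rightarrow> 'a) \<Rightarrow> _)"
  proof (rule sympI)
    fix X Y :: "nat \<Rightarrow> 'a" assume *: "same_limit X Y"
    then have "(\<lambda>n. - (X n - Y n)) \<longlonglongrightarrow> - 0" unfolding same_limit_def by (intro tendsto_minus) auto
    with * show "same_limit Y X" by (simp add: same_limit_def)
  qed
  show "transp (same_limit :: (nat \<Rightarrow> 'a) \<Rightarrow> _)"
  proof (rule transpI)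
    fix X Y Z :: "nat \<Rightarrow> 'a" assume *: "same_limit X Y" "same_limit Y Z"
    then have "(\<lambda>n. (X n - Y n) + (Y n - Z n)) \<longlonglongrightarrow> 0 + 0"
      unfolding same_limit_def by (intro tendsto_add) auto
    with * show "same_limit X Z" by (simp add: same_limit_def)
  qed
qed

instantiation completion :: (real_normed_vector) real_normed_vector
begin

lift_definition zero_completion :: "'a completion" is "\<lambda>_. 0"
  by (simp add: same_limit_def convergent_Cauchy convergent_const)

lift_definition plus_completion :: "'a completion \<Rightarrow> 'a completion \<Rightarrow> 'a completion"
  is "\<lambda>X Y n. X n + Y n"
  subgoal for X X' Y Y'
    using tendsto_add[of "\<lambda>n. X n - X' n" 0 sequentially "\<lambda>n. Y n - Y' n" 0]
    by (simp add: same_limit_def Cauchy_add_seq add_diff_add)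
  done

lift_definition minus_completion :: "'a completion \<Rightarrow> 'a completion \<Rightarrow> 'a completion"
  is "\<lambda>X Y n. X n - Y n"
  subgoal for X X' Y Y'
    using tendsto_diff[of "\<lambda>n. X n - X' n" 0 sequentially "\<lambda>n. Y n - Y' n" 0]
    by (simp add: same_limit_def Cauchy_diff_seq algebra_simps)
  done

lift_definition uminus_completion :: "'a completion \<Rightarrow> 'a completion"
  is "\<lambda>X n. - X n"
  subgoal for X X'
    using tendsto_minus[of "\<lambda>n. X n - X' n" 0 sequentially]
      tendsto_minus_cancel_left[of "\<lambda>n. X' n - X n" 0 sequentially]
    by (simp add: same_limit_def Cauchy_minus_seq)
  done

lift_definition scaleR_completion :: "real \<Rightarrow> 'a completion \<Rightarrow> 'a completion"
  is "\<lambda>r X n. r *\<^sub>R X n"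
  subgoal for r X X'
    using tendsto_scaleR[OF tendsto_const[of r], of "\<lambda>n. X n - X' n" 0 sequentially]
    by (simp add: same_limit_def Cauchy_scaleR_seq scaleR_diff_right)
  done

lift_definition norm_completion :: "'a completion \<Rightarrow> real"
  is "\<lambda>X. lim (\<lambda>n. norm (X n))"
  subgoal for X Y
  proof -
    assume *: "same_limit X Y"
    have "(\<lambda>n. norm (X n) - norm (Y n)) \<longlonglongrightarrow> 0"
    proof (rule Lim_null_comparison)
      show "\<forall>\<^sub>F n in sequentially. norm (norm (X n) - norm (Y n)) \<le> norm (X n - Y n)"
        by (auto intro!: always_eventually norm_triangle_ineq3)
      show "(\<lambda>n. norm (X n - Y n)) \<longlonglongrightarrow> 0"
        using * by (auto simp: same_limit_def tendsto_norm_zero_iff)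
    qed
    moreover have "(\<lambda>n. norm (X n) - norm (Y n))
        \<longlonglongrightarrow> lim (\<lambda>n. norm (X n)) - lim (\<lambda>n. norm (Y n))"
      using * by (intro tendsto_diff Cauchy_norm_tendsto) (auto simp: same_limit_def)
    ultimately show ?thesis using LIMSEQ_unique by fastforce
  qed
  done

definition "dist_completion x y = norm (x - y :: 'a completion)"
definition "sgn_completion x = scaleR (inverse (norm x)) (x :: 'a completion)"
definition [code del]:
  "uniformity_completion = (INF e\<in>{0 <..}. principal {(x :: 'a completion, y). dist x y < e})"
definition [code del]:
  "open_completion (U :: 'a completion set)
     \<longleftrightarrow> (\<forall>x\<in>U. \<forall>\<^sub>F (x', y) in uniformity. x' = x \<longrightarrow> y \<in> U)"

instance
proof
  fix x y z :: "'a completion" and r s :: real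
  show "x + y + z = x + (y + z)"
    by transfer (auto simp: same_limit_def add.assoc intro!: Cauchy_add_seq)
  show "x + y = y + x"
    by transfer (auto simp: same_limit_def add.commute intro!: Cauchy_add_seq)
  show "0 + x = x" by transfer (auto simp: same_limit_def)
  show "- x + x = 0"
    by transfer (auto simp: same_limit_def convergent_Cauchy convergent_const)
  show "x - y = x + - y"
    by transfer (auto simp: same_limit_def intro!: Cauchy_diff_seq)
  show "r *\<^sub>R (x + y) = r *\<^sub>R x + r *\<^sub>R y"
    by transfer
       (auto simp: same_limit_def scaleR_add_right intro!: Cauchy_add_seq Cauchy_scaleR_seq)
  show "(r + s) *\<^sub>R x = r *\<^sub>R x + s *\<^sub>R x"
    by transfer
       (auto simp: same_limit_def scaleR_add_left intro!: Cauchy_add_seq Cauchy_scaleR_seq)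
  show "r *\<^sub>R s *\<^sub>R x = (r * s) *\<^sub>R x"
    by transfer (auto simp: same_limit_def intro!: Cauchy_scaleR_seq)
  show "1 *\<^sub>R x = x" by transfer (auto simp: same_limit_def)
  show "dist x y = norm (x - y)" by (rule dist_completion_def)
  show "sgn x = inverse (norm x) *\<^sub>R x" by (rule sgn_completion_def)
  show "uniformity = (INF e\<in>{0 <..}. principal {(x :: 'a completion, y). dist x y < e})"
    by (rule uniformity_completion_def)
  show "open U = (\<forall>x\<in>U. \<forall>\<^sub>F (x', y) in uniformity. x' = x \<longrightarrow> y \<in> U)" for U :: "'a completion set"
    by (rule open_completion_def)
  show "norm x = 0 \<longleftrightarrow> x = 0"
  proof transfer
    fix X :: "nat \<Rightarrow> 'a" assume "same_limit X X"
    then have X: "Cauchy X" by (simp add: same_limit_def)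
    have "lim (\<lambda>n. norm (X n)) = 0 \<longleftrightarrow> (\<lambda>n. norm (X n)) \<longlonglongrightarrow> 0"
      using Cauchy_norm_tendsto[OF X] limI by metis
    then show "lim (\<lambda>n. norm (X n)) = 0 \<longleftrightarrow> same_limit X (\<lambda>_. 0)"
      using X by (simp add: same_limit_def tendsto_norm_zero_iff convergent_Cauchy convergent_const)
  qed
  show "norm (x + y) \<le> norm x + norm y"
  proof transfer
    fix X Y :: "nat \<Rightarrow> 'a" assume "same_limit X X" "same_limit Y Y"
    then have "Cauchy X" "Cauchy Y" by (auto simp: same_limit_def)
    then show "lim (\<lambda>n. norm (X n + Y n)) \<le> lim (\<lambda>n. norm (X n)) + lim (\<lambda>n. norm (Y n))"
      by (intro LIMSEQ_le[OF Cauchy_norm_tendsto tendsto_add[OF Cauchy_norm_tendsto Cauchy_norm_tendsto]])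
         (auto intro: Cauchy_add_seq norm_triangle_ineq)
  qed
  show "norm (r *\<^sub>R x) = \<bar>r\<bar> * norm x"
  proof transfer
    fix X :: "nat \<Rightarrow> 'a" and r :: real assume "same_limit X X"
    then have "Cauchy X" by (auto simp: same_limit_def)
    then have "(\<lambda>n. norm (r *\<^sub>R X n)) \<longlonglongrightarrow> \<bar>r\<bar> * lim (\<lambda>n. norm (X n))"
      by (auto intro!: tendsto_mult Cauchy_norm_tendsto)
    then show "lim (\<lambda>n. norm (r *\<^sub>R X n)) = \<bar>r\<bar> * lim (\<lambda>n. norm (X n))" by (rule limI)
  qed
qed

end

lift_definition embed :: "'a::real_normed_vector \<Rightarrow> 'a completion" is "\<lambda>x n. x"
  by (simp add: same_limit_def convergent_Cauchy convergent_const)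

lemma norm_embed [simp]: "norm (embed x) = norm x"
  by transfer (simp add: limI)

lemma linear_embed: "linear embed"
  by (rule linearI; transfer)
     (auto simp: same_limit_def convergent_Cauchy convergent_const)

lemma embed_diff: "embed (x - y) = embed x - embed y"
  by (rule linear_diff[OF linear_embed])

lemma embed_approx:
  fixes X :: "nat \<Rightarrow> 'a::real_normed_vector"
  assumes X: "Cauchy X"
  shows "(\<lambda>n. embed (X n)) \<longlonglongrightarrow> abs_completion X"
proof (rule LIMSEQ_I)
  fix e :: real assume "0 < e"
  then obtain M where M: "\<And>m n. m \<ge> M \<Longrightarrow> n \<ge> M \<Longrightarrow> norm (X m - X n) < e / 2"
    using CauchyD[OF X, of "e/2"] by auto
  have "norm (embed (X n) - abs_completion X) < e" if "n \<ge> M" for n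
  proof -
    have c: "Cauchy (\<lambda>m. X n - X m)"
      using X by (intro Cauchy_diff_seq) (auto simp: convergent_Cauchy convergent_const)
    have "norm (embed (X n) - abs_completion X) = lim (\<lambda>m. norm (X n - X m))"
      using X c by (simp add: embed.abs_eq minus_completion.abs_eq norm_completion.abs_eq
          same_limit_def convergent_Cauchy convergent_const)
    also have "\<dots> \<le> e / 2"
      by (rule LIMSEQ_le_const2[OF Cauchy_norm_tendsto[OF c]]) (use M that less_imp_le in blast)
    finally show ?thesis using \<open>0 < e\<close> by simp
  qed
  then show "\<exists>M. \<forall>n\<ge>M. norm (embed (X n) - abs_completion X) < e" by blast
qed

lemma embed_dense:
  assumes "0 < e"
  shows "\<exists>x. norm (A - embed x) < e"
proof -
  obtain X where X: "Cauchy X" "A = abs_completion X"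
    by (metis Quotient_abs_rep Quotient_completion Quotient_rep_reflp same_limit_refl)
  obtain M where "\<forall>n\<ge>M. norm (embed (X n) - A) < e"
    using LIMSEQ_D[OF embed_approx[OF X(1)] assms] X(2) by blast
  then show ?thesis by (metis norm_minus_commute order_refl)
qed

instance completion :: (real_normed_vector) banach
proof
  fix A :: "nat \<Rightarrow> 'a completion" assume A: "Cauchy A"
  have "\<forall>n. \<exists>y. norm (A n - embed y) < inverse (real (Suc n))"
    by (auto intro!: embed_dense)
  then obtain y where y: "\<And>n. norm (A n - embed (y n)) < inverse (real (Suc n))"
    by metis
  have lim0: "(\<lambda>n. A n - embed (y n)) \<longlonglongrightarrow> 0"
    by (rule Lim_null_comparison[OF _ LIMSEQ_inverse_real_of_nat])
       (use y less_imp_le in \<open>auto intro!: always_eventually\<close>)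
  have "Cauchy (\<lambda>n. A n - (A n - embed (y n)))"
    by (rule Cauchy_diff_seq[OF A LIMSEQ_imp_Cauchy[OF lim0]])
  then have "Cauchy (\<lambda>n. embed (y n))" by simp
  then have "Cauchy y"
    unfolding Cauchy_iff embed_diff[symmetric] norm_embed .
  then have "(\<lambda>n. (A n - embed (y n)) + embed (y n)) \<longlonglongrightarrow> 0 + abs_completion y"
    by (intro tendsto_add lim0 embed_approx)
  then show "convergent A" by (auto simp: convergent_def)
qed

section \<open>Tsirelson's space\<close>

type_synonym 'k tsirelson_dual = "'k c00 completion"

lift_definition scale_dual ::
  "'k::real_normed_field \<Rightarrow> 'k tsirelson_dual \<Rightarrow> 'k tsirelson_dual"
  is "\<lambda>c X n. scale00 c (X n)"
proof -
  fix c :: 'k and X Y :: "nat \<Rightarrow> 'k c00"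
  assume XY: "same_limit X Y"
  have lin: "bounded_linear (scale00 c)"
    by (rule bounded_linear_intro[where K = "norm c"])
       (auto intro!: coord_eqI simp: norm_scale00 algebra_simps)
  have "(\<lambda>n. scale00 c (X n - Y n)) \<longlonglongrightarrow> 0"
    using bounded_linear.tendsto_zero[OF lin] XY by (auto simp: same_limit_def)
  then show "same_limit (\<lambda>n. scale00 c (X n)) (\<lambda>n. scale00 c (Y n))"
    using XY bounded_linear.Cauchy[OF lin]
    by (auto simp: same_limit_def linear_diff[OF bounded_linear.linear[OF lin]])
qed

typedef (overloaded) ('k::"{real_normed_field, banach}") tsirelson =
  "{f :: 'k tsirelson_dual \<Rightarrow>\<^sub>L 'k. \<forall>c x. f (scale_dual c x) = c * f x}"
  morphisms functional Abs_tsirelson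
  by (rule exI[of _ 0]) simp

setup_lifting type_definition_tsirelson

instantiation tsirelson :: ("{real_normed_field, banach}") real_normed_vector
begin

lift_definition zero_tsirelson :: "'a tsirelson" is 0 by simp
lift_definition plus_tsirelson :: "'a tsirelson \<Rightarrow> 'a tsirelson \<Rightarrow> 'a tsirelson" is "(+)"
  by (simp add: blinfun.add_left algebra_simps)
lift_definition minus_tsirelson :: "'a tsirelson \<Rightarrow> 'a tsirelson \<Rightarrow> 'a tsirelson" is "(-)"
  by (simp add: blinfun.diff_left algebra_simps)
lift_definition uminus_tsirelson :: "'a tsirelson \<Rightarrow> 'a tsirelson" is uminus
  by (simp add: blinfun.minus_left)
lift_definition scaleR_tsirelson :: "real \<Rightarrow> 'a tsirelson \<Rightarrow> 'a tsirelson" is scaleR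
  by (simp add: blinfun.scaleR_left)
lift_definition norm_tsirelson :: "'a tsirelson \<Rightarrow> real" is norm .

definition "dist_tsirelson x y = norm (x - y :: 'a tsirelson)"
definition "sgn_tsirelson x = scaleR (inverse (norm x)) (x :: 'a tsirelson)"
definition [code del]:
  "uniformity_tsirelson = (INF e\<in>{0 <..}. principal {(x :: 'a tsirelson, y). dist x y < e})"
definition [code del]:
  "open_tsirelson (U :: 'a tsirelson set)
     \<longleftrightarrow> (\<forall>x\<in>U. \<forall>\<^sub>F (x', y) in uniformity. x' = x \<longrightarrow> y \<in> U)"

instance
proof
  fix x y z :: "'a tsirelson" and r s :: real
  show "x + y + z = x + (y + z)" by transfer (rule add.assoc)
  show "x + y = y + x" by transfer (rule add.commute)
  show "0 + x = x" by transfer simp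
  show "- x + x = 0" by transfer simp
  show "x - y = x + - y" by transfer simp
  show "r *\<^sub>R (x + y) = r *\<^sub>R x + r *\<^sub>R y" by transfer (rule scaleR_add_right)
  show "(r + s) *\<^sub>R x = r *\<^sub>R x + s *\<^sub>R x" by transfer (rule scaleR_add_left)
  show "r *\<^sub>R s *\<^sub>R x = (r * s) *\<^sub>R x" by transfer simp
  show "1 *\<^sub>R x = x" by transfer simp
  show "dist x y = norm (x - y)" by (rule dist_tsirelson_def)
  show "sgn x = inverse (norm x) *\<^sub>R x" by (rule sgn_tsirelson_def)
  show "uniformity = (INF e\<in>{0 <..}. principal {(x :: 'a tsirelson, y). dist x y < e})"
    by (rule uniformity_tsirelson_def)
  show "open U = (\<forall>x\<in>U. \<forall>\<^sub>F (x', y) in uniformity. x' = x \<longrightarrow> y \<in> U)" for U :: "'a tsirelson set"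
    by (rule open_tsirelson_def)
  show "norm x = 0 \<longleftrightarrow> x = 0" by transfer simp
  show "norm (x + y) \<le> norm x + norm y" by transfer (rule norm_triangle_ineq)
  show "norm (r *\<^sub>R x) = \<bar>r\<bar> * norm x" by transfer simp
qed

end

instance tsirelson :: ("{real_normed_field, banach}") banach
proof
  fix F :: "nat \<Rightarrow> 'a tsirelson" assume "Cauchy F"
  then have "Cauchy (\<lambda>n. functional (F n))"
    unfolding Cauchy_iff by (simp add: minus_tsirelson.rep_eq norm_tsirelson.rep_eq)
  then obtain g where g: "(\<lambda>n. functional (F n)) \<longlonglongrightarrow> g"
    using Cauchy_convergent convergent_def by blast
  have "g (scale_dual c x) = c * g x" for c x
  proof -
    have "(\<lambda>n. functional (F n) (scale_dual c x)) \<longlonglongrightarrow> g (scale_dual c x)"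
      using g by (intro tendsto_intros)
    moreover have "functional (F n) (scale_dual c x) = c * functional (F n) x" for n
      using functional[of "F n"] by simp
    moreover have "(\<lambda>n. c * functional (F n) x) \<longlonglongrightarrow> c * g x"
      using g by (intro tendsto_intros)
    ultimately show ?thesis using LIMSEQ_unique by simp
  qed
  then have "functional (Abs_tsirelson g) = g" by (simp add: Abs_tsirelson_inverse)
  then have "F \<longlonglongrightarrow> Abs_tsirelson g"
    using g unfolding LIMSEQ_iff by (simp add: minus_tsirelson.rep_eq norm_tsirelson.rep_eq)
  then show "convergent F" by (auto simp: convergent_def)
qed

lift_definition scale_tsirelson ::
  "'k::{real_normed_field, banach} \<Rightarrow> 'k tsirelson \<Rightarrow> 'k tsirelson"
  is "\<lambda>c f. blinfun_mult_right c o\<^sub>L f"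
  by simp

section \<open>Amenable Banach algebras\<close>

text \<open>
  A normed space over \<open>'k\<close> is a record on a carrier set. In the underlying \<open>HOL-Algebra\<close> record
  type the field \<open>mult\<close> is the product if the structure is an algebra and irrelevant otherwise;
  \<open>one\<close> is always irrelevant (Banach algebras need not be unital).
\<close>

record ('k, 'v) normed_space = "('k, 'v) module" +
  nrm :: "'v \<Rightarrow> real"

definition scalars :: "'k::field ring" where
  "scalars = \<lparr>carrier = UNIV, mult = (*), one = 1, zero = 0, add = (+)\<rparr>"

definition banach_space :: "('k::real_normed_field, 'v, 'm) normed_space_scheme \<Rightarrow> bool" where
  "banach_space V \<longleftrightarrow> Module.module scalars V \<and>
     (\<forall>x\<in>carrier V. nrm V x = 0 \<longleftrightarrow> x = \<zero>\<^bsub>V\<^esub>) \<and>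
     (\<forall>x\<in>carrier V. \<forall>y\<in>carrier V. nrm V (x \<oplus>\<^bsub>V\<^esub> y) \<le> nrm V x + nrm V y) \<and>
     (\<forall>c. \<forall>x\<in>carrier V. nrm V (c \<odot>\<^bsub>V\<^esub> x) = norm c * nrm V x) \<and>
     (\<forall>X. range X \<subseteq> carrier V \<and>
        (\<forall>e>0. \<exists>M. \<forall>m\<ge>M. \<forall>n\<ge>M. nrm V (X m \<ominus>\<^bsub>V\<^esub> X n) < e) \<longrightarrow>
        (\<exists>x\<in>carrier V. (\<lambda>n. nrm V (X n \<ominus>\<^bsub>V\<^esub> x)) \<longlonglongrightarrow> 0))"

definition linear_map ::
  "('k::field, 'v, 'm) module_scheme \<Rightarrow> ('k, 'w, 'n) module_scheme \<Rightarrow> ('v \<Rightarrow> 'w) \<Rightarrow> bool" where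
  "linear_map V W f \<longleftrightarrow> f \<in> carrier V \<rightarrow> carrier W \<and>
     (\<forall>x\<in>carrier V. \<forall>y\<in>carrier V. f (x \<oplus>\<^bsub>V\<^esub> y) = f x \<oplus>\<^bsub>W\<^esub> f y) \<and>
     (\<forall>c. \<forall>x\<in>carrier V. f (c \<odot>\<^bsub>V\<^esub> x) = c \<odot>\<^bsub>W\<^esub> f x)"

definition bounded_map ::
  "('k, 'v, 'm) normed_space_scheme \<Rightarrow> ('k, 'w, 'n) normed_space_scheme \<Rightarrow> ('v \<Rightarrow> 'w) \<Rightarrow> bool"
  where "bounded_map V W f \<longleftrightarrow> (\<exists>C. \<forall>x\<in>carrier V. nrm W (f x) \<le> C * nrm V x)"

definition banach_algebra :: "('k::real_normed_field, 'a, 'm) normed_space_scheme \<Rightarrow> bool" where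
  "banach_algebra A \<longleftrightarrow> banach_space A \<and>
     (\<forall>a\<in>carrier A. linear_map A A (\<lambda>b. a \<otimes>\<^bsub>A\<^esub> b) \<and> linear_map A A (\<lambda>b. b \<otimes>\<^bsub>A\<^esub> a)) \<and>
     (\<forall>a\<in>carrier A. \<forall>b\<in>carrier A. \<forall>c\<in>carrier A.
        a \<otimes>\<^bsub>A\<^esub> b \<otimes>\<^bsub>A\<^esub> c = a \<otimes>\<^bsub>A\<^esub> (b \<otimes>\<^bsub>A\<^esub> c)) \<and>
     (\<forall>a\<in>carrier A. \<forall>b\<in>carrier A. nrm A (a \<otimes>\<^bsub>A\<^esub> b) \<le> nrm A a * nrm A b)"

record ('k, 'a, 'e) bimodule = "('k, 'e) normed_space" +
  lact :: "'a \<Rightarrow> 'e \<Rightarrow> 'e"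
  ract :: "'e \<Rightarrow> 'a \<Rightarrow> 'e"

definition banach_bimodule ::
  "('k::real_normed_field, 'a, 'm) normed_space_scheme \<Rightarrow> ('k, 'a, 'e) bimodule \<Rightarrow> bool" where
  "banach_bimodule A E \<longleftrightarrow> banach_space E \<and>
     (\<forall>a\<in>carrier A. linear_map E E (lact E a) \<and> linear_map E E (\<lambda>x. ract E x a)) \<and>
     (\<forall>x\<in>carrier E. linear_map A E (\<lambda>a. lact E a x) \<and> linear_map A E (ract E x)) \<and>
     (\<forall>a\<in>carrier A. \<forall>b\<in>carrier A. \<forall>x\<in>carrier E.
        lact E (a \<otimes>\<^bsub>A\<^esub> b) x = lact E a (lact E b x) \<and>
        ract E x (a \<otimes>\<^bsub>A\<^esub> b) = ract E (ract E x a) b \<and>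
        ract E (lact E a x) b = lact E a (ract E x b)) \<and>
     (\<exists>C. \<forall>a\<in>carrier A. \<forall>x\<in>carrier E.
        nrm E (lact E a x) \<le> C * nrm A a * nrm E x \<and>
        nrm E (ract E x a) \<le> C * nrm A a * nrm E x)"

definition scalar_space :: "('k::real_normed_field, 'k) normed_space" where
  "scalar_space = \<lparr>carrier = UNIV, mult = (*), one = 1, zero = 0, add = (+), smult = (*), nrm = norm\<rparr>"

definition dual_bimodule ::
  "('k::real_normed_field, 'a, 'e) bimodule \<Rightarrow> ('k, 'a, 'e \<Rightarrow> 'k) bimodule" where
  "dual_bimodule E =
     \<lparr>carrier = {f \<in> extensional (carrier E).
                   linear_map E scalar_space f \<and> bounded_map E scalar_space f},
      mult = undefined, one = undefined,
      zero = (\<lambda>x\<in>carrier E. 0),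
      add = (\<lambda>f g. \<lambda>x\<in>carrier E. f x + g x),
      smult = (\<lambda>c f. \<lambda>x\<in>carrier E. c * f x),
      nrm = (\<lambda>f. SUP x\<in>{x\<in>carrier E. nrm E x \<le> 1}. norm (f x)),
      lact = (\<lambda>a f. \<lambda>x\<in>carrier E. f (ract E x a)),
      ract = (\<lambda>f a. \<lambda>x\<in>carrier E. f (lact E a x))\<rparr>"

definition derivation ::
  "('k::real_normed_field, 'a, 'm) normed_space_scheme \<Rightarrow> ('k, 'a, 'e) bimodule \<Rightarrow> ('a \<Rightarrow> 'e) \<Rightarrow> bool"
  where
  "derivation A X D \<longleftrightarrow> linear_map A X D \<and>
     (\<forall>a\<in>carrier A. \<forall>b\<in>carrier A. D (a \<otimes>\<^bsub>A\<^esub> b) = lact X a (D b) \<oplus>\<^bsub>X\<^esub> ract X (D a) b)"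

definition inner_derivation ::
  "('k::real_normed_field, 'a, 'm) normed_space_scheme \<Rightarrow> ('k, 'a, 'e) bimodule \<Rightarrow> ('a \<Rightarrow> 'e) \<Rightarrow> bool"
  where
  "inner_derivation A X D \<longleftrightarrow>
     (\<exists>x\<in>carrier X. \<forall>a\<in>carrier A. D a = lact X a x \<ominus>\<^bsub>X\<^esub> ract X x a)"

text \<open>
  HOL cannot quantify over all types inside a definition, so the bimodules range over all Banach
  bimodules whose carrier is a subset of one fixed type, the sets of functions \<open>'a \<times> 'a \<rightarrow> 'k\<close>
  (no relation to the structure of that type is assumed). This is no restriction. By Johnson's
  theorem it suffices, for amenability in the unrestricted sense, to treat the bimodules \<open>A\<^sup>*\<close> (with
  one of the two actions replaced by 0; this gives a bounded approximate identity) and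
  \<open>(ker \<pi>)\<^sup>*\<close>, where \<open>\<pi>\<close> is the product map on the projective tensor square of \<open>A\<close> (this gives
  a virtual diagonal); the latter is a quotient of the space of bounded bilinear forms on \<open>A\<close>, so
  both have copies carried by this type. In any case non-amenability in the sense below trivially
  implies non-amenability in the unrestricted sense.
\<close>

definition amenable :: "('k::real_normed_field, 'a, 'm) normed_space_scheme \<Rightarrow> bool" where
  "amenable A \<longleftrightarrow>
     (\<forall>E :: ('k, 'a, ('a \<Rightarrow> 'a \<Rightarrow> 'k) set) bimodule. banach_bimodule A E \<longrightarrow>
        (\<forall>D. derivation A (dual_bimodule E) D \<and> bounded_map A (dual_bimodule E) D \<longrightarrow>
           inner_derivation A (dual_bimodule E) D))"

section \<open>Approximable operators\<close>

text \<open>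
  \<open>sc\<close> is the multiplication by \<open>'k\<close>-scalars on the space \<open>'x\<close>; a \<open>blinfun\<close> is only real-linear
  a priori.
\<close>

definition finite_rank ::
  "('k::field \<Rightarrow> 'x::real_normed_vector \<Rightarrow> 'x) \<Rightarrow> ('x \<Rightarrow>\<^sub>L 'x) \<Rightarrow> bool" where
  "finite_rank sc u \<longleftrightarrow> (\<forall>c x. u (sc c x) = sc c (u x)) \<and>
     (\<exists>B. finite B \<and> range u \<subseteq> module.span sc B)"

definition scale_op ::
  "('k \<Rightarrow> 'x::real_normed_vector \<Rightarrow> 'x) \<Rightarrow> 'k \<Rightarrow> ('x \<Rightarrow>\<^sub>L 'x) \<Rightarrow> ('x \<Rightarrow>\<^sub>L 'x)" where
  "scale_op sc c u = Blinfun (\<lambda>x. sc c (u x))"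

definition approximable_algebra ::
  "('k::field \<Rightarrow> 'x::real_normed_vector \<Rightarrow> 'x) \<Rightarrow> ('k, 'x \<Rightarrow>\<^sub>L 'x) normed_space" where
  "approximable_algebra sc =
     \<lparr>carrier = closure {u. finite_rank sc u},
      mult = (o\<^sub>L), one = undefined,
      zero = 0, add = (+),
      smult = scale_op sc,
      nrm = norm\<rparr>"

interpretation tsirelson: vector_space
  "scale_tsirelson :: 'k::{real_normed_field, banach} \<Rightarrow> 'k tsirelson \<Rightarrow> 'k tsirelson"
  by standard (transfer, rule blinfun_eqI, simp add: blinfun.bilinear_simps algebra_simps)+

lemma norm_scale_tsirelson: "norm (scale_tsirelson c f) = norm c * norm f"
proof (cases "c = 0")
  case True
  then show ?thesis by simp
next
  case False
  have le: "norm (scale_tsirelson c f) \<le> norm c * norm f" for c :: 'a and f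
  proof transfer
    fix c :: 'a and f :: "'a tsirelson_dual \<Rightarrow>\<^sub>L 'a"
    show "norm (blinfun_mult_right c o\<^sub>L f) \<le> norm c * norm f"
    proof (rule norm_blinfun_bound)
      fix x
      have "norm c * norm (f x) \<le> norm c * (norm f * norm x)"
        by (intro mult_left_mono norm_blinfun) simp
      then show "norm ((blinfun_mult_right c o\<^sub>L f) x) \<le> norm c * norm f * norm x"
        by (simp add: norm_mult mult.assoc)
    qed simp
  qed
  have "norm c * norm f = norm c * norm (scale_tsirelson (inverse c) (scale_tsirelson c f))"
    using False by simp
  also have "\<dots> \<le> norm c * (norm (inverse c) * norm (scale_tsirelson c f))"
    by (intro mult_left_mono le) simp
  also have "\<dots> = norm (scale_tsirelson c f)"
    using False by (simp add: norm_inverse)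
  finally show ?thesis using le[of c f] by simp
qed

lemma scaleR_tsirelson: "r *\<^sub>R f = scale_tsirelson (of_real r) f"
  by transfer (auto intro!: blinfun_eqI simp: blinfun.bilinear_simps scaleR_conv_of_real)

lemma bounded_linear_scale_tsirelson: "bounded_linear (scale_tsirelson c)"
  by (rule bounded_linear_intro[where K = "norm c"])
     (auto simp: tsirelson.scale_right_distrib norm_scale_tsirelson scaleR_tsirelson
        tsirelson.scale_left_commute mult.commute)

context
  notes [simp] = approximable_algebra_def
begin

abbreviation (input) "AT \<equiv> approximable_algebra (scale_tsirelson :: 'k::{real_normed_field, banach} \<Rightarrow> _)"

lemma smult_AT [simp]:
  "blinfun_apply (scale_op scale_tsirelson c u) x = scale_tsirelson c (blinfun_apply u x)"
  unfolding scale_op_def by (subst bounded_linear_Blinfun_apply)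
     (auto intro!: bounded_linear_compose[OF bounded_linear_scale_tsirelson] blinfun.bounded_linear_right)

lemma norm_smult_AT:
  "norm (scale_op scale_tsirelson c u) = norm c * norm u"
  (is "norm (?s c u) = _")
proof (cases "c = 0")
  case True
  then have "?s c u = 0" by (intro blinfun_eqI) simp
  then show ?thesis using True by simp
next
  case False
  have le: "norm (?s c u) \<le> norm c * norm u" for c u
  proof (rule norm_blinfun_bound)
    fix x
    have "norm c * norm (u x) \<le> norm c * (norm u * norm x)"
      by (intro mult_left_mono norm_blinfun) simp
    then show "norm (?s c u x) \<le> norm c * norm u * norm x"
      by (simp add: norm_scale_tsirelson mult.assoc)
  qed simp
  have "?s (inverse c) (?s c u) = u" using False by (intro blinfun_eqI) simp
  then have "norm c * norm u = norm c * norm (?s (inverse c) (?s c u))" by simp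
  also have "\<dots> \<le> norm c * (norm (inverse c) * norm (?s c u))"
    by (intro mult_left_mono le) simp
  also have "\<dots> = norm (?s c u)" using False by (simp add: norm_inverse)
  finally show ?thesis using le[of c u] by simp
qed

lemma bounded_linear_smult_AT:
  "bounded_linear (scale_op scale_tsirelson c)"
  by (rule bounded_linear_intro[where K = "norm c"])
     (auto intro!: blinfun_eqI simp: norm_smult_AT blinfun.bilinear_simps scaleR_tsirelson
        tsirelson.scale_right_distrib tsirelson.scale_left_commute)

lemma finite_rank_add:
  assumes "finite_rank scale_tsirelson u" "finite_rank scale_tsirelson v"
  shows "finite_rank scale_tsirelson (u + v)"
proof -
  obtain B C where B: "finite B" "range u \<subseteq> tsirelson.span B"
    and C: "finite C" "range v \<subseteq> tsirelson.span C"
    using assms unfolding finite_rank_def by blast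
  have "range u \<subseteq> tsirelson.span (B \<union> C)" "range v \<subseteq> tsirelson.span (B \<union> C)"
    using B(2) C(2) tsirelson.span_mono[of B "B \<union> C"] tsirelson.span_mono[of C "B \<union> C"] by blast+
  then have "range (u + v) \<subseteq> tsirelson.span (B \<union> C)"
    by (auto simp: blinfun.add_left intro!: tsirelson.span_add)
  moreover have "finite (B \<union> C)" using B C by simp
  ultimately show ?thesis using assms
    unfolding finite_rank_def by (auto simp: blinfun.add_left tsirelson.scale_right_distrib)
qed

lemma finite_rank_smult:
  assumes "finite_rank scale_tsirelson u"
  shows "finite_rank scale_tsirelson (scale_op scale_tsirelson c u)"
proof -
  obtain B where B: "finite B" "range u \<subseteq> tsirelson.span B"
    using assms unfolding finite_rank_def by blast
  then have "range (scale_op scale_tsirelson c u) \<subseteq> tsirelson.span B"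
    by (auto intro!: tsirelson.span_scale)
  then show ?thesis using assms B(1)
    unfolding finite_rank_def by (auto simp: tsirelson.scale_left_commute)
qed

lemma finite_rank_compose:
  assumes "finite_rank scale_tsirelson u" "finite_rank scale_tsirelson v"
  shows "finite_rank scale_tsirelson (u o\<^sub>L v)"
proof -
  have "range (u o\<^sub>L v) \<subseteq> range u" by auto
  then show ?thesis using assms unfolding finite_rank_def by fastforce
qed

lemma finite_rank_0: "finite_rank scale_tsirelson 0"
  unfolding finite_rank_def by (auto intro!: exI[of _ "{}"])

lemma closure_closed2:
  fixes f :: "'a::real_normed_vector \<Rightarrow> 'a \<Rightarrow> 'a"
  assumes "\<And>x y. x \<in> S \<Longrightarrow> y \<in> S \<Longrightarrow> f x y \<in> S"
    and "\<And>X Y x y. X \<longlonglongrightarrow> x \<Longrightarrow> Y \<longlonglongrightarrow> y \<Longrightarrow> (\<lambda>n. f (X n) (Y n)) \<longlonglongrightarrow> f x y"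
    and "x \<in> closure S" "y \<in> closure S"
  shows "f x y \<in> closure S"
proof -
  obtain X Y where "\<And>n. X n \<in> S" "\<And>n. Y n \<in> S" "X \<longlonglongrightarrow> x" "Y \<longlonglongrightarrow> y"
    using assms(3,4) unfolding closure_sequential by blast
  then show ?thesis using assms(1,2) unfolding closure_sequential
    by (intro exI[of _ "\<lambda>n. f (X n) (Y n)"]) blast
qed

lemma AT_add: "u \<in> carrier AT \<Longrightarrow> v \<in> carrier AT \<Longrightarrow> u + v \<in> carrier AT"
  by (simp, rule closure_closed2) (auto intro: finite_rank_add tendsto_add)

lemma AT_compose: "u \<in> carrier AT \<Longrightarrow> v \<in> carrier AT \<Longrightarrow> u o\<^sub>L v \<in> carrier AT"
  by (simp, rule closure_closed2)
     (auto intro: finite_rank_compose bounded_bilinear.tendsto[OF bounded_bilinear_blinfun_compose])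

lemma AT_smult: "u \<in> carrier AT \<Longrightarrow> c \<odot>\<^bsub>AT\<^esub> u \<in> carrier AT"
  by (simp, rule closure_closed2)
     (auto intro: finite_rank_smult bounded_linear.tendsto[OF bounded_linear_smult_AT])

lemma AT_0: "0 \<in> carrier AT"
  using closure_subset[of "{u. finite_rank scale_tsirelson u}"] finite_rank_0 by auto

lemma AT_linear:
  assumes "u \<in> carrier AT"
  shows "u (scale_tsirelson c x) = scale_tsirelson c (u x)"
proof -
  obtain U where U: "\<And>n. finite_rank scale_tsirelson (U n)" "U \<longlonglongrightarrow> u"
    using assms by (auto simp: closure_sequential)
  have "(\<lambda>n. U n (scale_tsirelson c x)) \<longlonglongrightarrow> u (scale_tsirelson c x)"
    "(\<lambda>n. scale_tsirelson c (U n x)) \<longlonglongrightarrow> scale_tsirelson c (u x)"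
    using U(2) by (auto intro!: tendsto_intros bounded_linear.tendsto[OF bounded_linear_scale_tsirelson])
  then show ?thesis using U(1) LIMSEQ_unique by (simp add: finite_rank_def)
qed

lemma AT_uminus: "u \<in> carrier AT \<Longrightarrow> - u \<in> carrier AT"
proof -
  assume "u \<in> carrier AT"
  then have "(-1) \<odot>\<^bsub>AT\<^esub> u \<in> carrier AT" by (rule AT_smult)
  moreover have "(-1) \<odot>\<^bsub>AT\<^esub> u = - u"
    by (auto intro!: blinfun_eqI simp: blinfun.minus_left)
  ultimately show ?thesis by simp
qed

lemma abelian_group_AT: "abelian_group AT"
proof (rule abelian_groupI)
  fix u assume "u \<in> carrier AT"
  then show "\<exists>v\<in>carrier AT. v \<oplus>\<^bsub>AT\<^esub> u = \<zero>\<^bsub>AT\<^esub>"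
    by (intro bexI[of _ "- u"] AT_uminus) auto
qed (use AT_add AT_0 in \<open>auto simp: add.assoc add.commute\<close>)

lemma AT_diff:
  assumes "u \<in> carrier AT" "v \<in> carrier AT"
  shows "u \<ominus>\<^bsub>AT\<^esub> v = u - v"
proof -
  have "\<ominus>\<^bsub>AT\<^esub> v = - v"
    by (rule abelian_group.minus_equality[OF abelian_group_AT])
       (use assms AT_uminus in auto)
  then show ?thesis by (simp add: a_minus_def)
qed

lemma cring_scalars: "cring (scalars :: 'k::field ring)"
  by (rule cringI, rule abelian_groupI, unfold_locales)
     (auto simp: scalars_def algebra_simps intro: exI[of _ "- _"])

lemma module_AT: "Module.module scalars AT"
  by (rule Module.moduleI[OF cring_scalars abelian_group_AT])
     (use AT_smult in \<open>auto simp: scalars_def blinfun.bilinear_simps tsirelson.scale_left_distrib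
        tsirelson.scale_right_distrib intro!: blinfun_eqI\<close>)

lemma banach_space_AT: "banach_space AT"
  unfolding banach_space_def
proof (intro conjI allI impI ballI module_AT)
  fix X :: "nat \<Rightarrow> 'a tsirelson \<Rightarrow>\<^sub>L 'a tsirelson"
  assume *: "range X \<subseteq> carrier AT \<and>
    (\<forall>e>0. \<exists>M. \<forall>m\<ge>M. \<forall>n\<ge>M. nrm AT (X m \<ominus>\<^bsub>AT\<^esub> X n) < e)"
  then have X: "\<And>n. X n \<in> carrier AT" by blast
  have "Cauchy X" using * unfolding AT_diff[OF X X] by (simp add: Cauchy_iff)
  then obtain u where u: "X \<longlonglongrightarrow> u" using Cauchy_convergent convergent_def by blast
  have "u \<in> carrier AT" using u X closed_sequentially[of "carrier AT" X u] by simp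
  moreover have "(\<lambda>n. nrm AT (X n \<ominus>\<^bsub>AT\<^esub> u)) \<longlonglongrightarrow> 0"
    unfolding AT_diff[OF X \<open>u \<in> carrier AT\<close>] using u
    by (simp add: LIM_zero tendsto_norm_zero)
  ultimately show "\<exists>u\<in>carrier AT. (\<lambda>n. nrm AT (X n \<ominus>\<^bsub>AT\<^esub> u)) \<longlonglongrightarrow> 0" by blast
qed (auto simp: norm_smult_AT norm_triangle_ineq)

lemma banach_algebra_AT: "banach_algebra AT"
  unfolding banach_algebra_def linear_map_def
  by (rule conjI[OF banach_space_AT])
     (use AT_compose AT_linear in \<open>auto simp: norm_blinfun_compose blinfun.bilinear_simps
        intro!: blinfun_eqI\<close>)

end

lemma abelian_group_dual:
  assumes "banach_space E"
  shows "abelian_group (dual_bimodule E)"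
proof -
  interpret E: Module.module scalars E using assms by (simp add: banach_space_def)
  have sc: "c \<odot>\<^bsub>E\<^esub> x \<in> carrier E" if "x \<in> carrier E" for c x
    using E.smult_closed[of c x] that by (simp add: scalars_def)
  note simps = dual_bimodule_def linear_map_def bounded_map_def scalar_space_def
  have add: "f \<oplus>\<^bsub>dual_bimodule E\<^esub> g \<in> carrier (dual_bimodule E)"
    if fg: "f \<in> carrier (dual_bimodule E)" "g \<in> carrier (dual_bimodule E)" for f g
  proof -
    obtain C D where "\<forall>x\<in>carrier E. norm (f x) \<le> C * nrm E x"
      "\<forall>x\<in>carrier E. norm (g x) \<le> D * nrm E x" using fg by (auto simp: simps)
    then have "\<forall>x\<in>carrier E. norm (f x + g x) \<le> (C + D) * nrm E x"
      by (auto intro!: norm_triangle_le add_mono simp: distrib_right)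
    then have "\<exists>K. \<forall>x\<in>carrier E. norm (f x + g x) \<le> K * nrm E x" by blast
    then show ?thesis using fg sc by (auto simp: simps algebra_simps)
  qed
  have minus: "(\<lambda>x\<in>carrier E. - f x) \<in> carrier (dual_bimodule E)"
    if "f \<in> carrier (dual_bimodule E)" for f
    using that sc by (auto simp: simps)
  have zero: "\<zero>\<^bsub>dual_bimodule E\<^esub> \<in> carrier (dual_bimodule E)"
    using sc by (auto simp: simps intro!: exI[of _ 0])
  show ?thesis
  proof (rule abelian_groupI)
    fix f assume f: "f \<in> carrier (dual_bimodule E)"
    then show "\<exists>g\<in>carrier (dual_bimodule E). g \<oplus>\<^bsub>dual_bimodule E\<^esub> f = \<zero>\<^bsub>dual_bimodule E\<^esub>"
      by (intro bexI[OF _ minus[OF f]]) (auto simp: dual_bimodule_def)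
    show "\<zero>\<^bsub>dual_bimodule E\<^esub> \<oplus>\<^bsub>dual_bimodule E\<^esub> f = f"
      using f by (auto simp: dual_bimodule_def extensional_def restrict_def)
  qed (use add zero in \<open>auto simp: dual_bimodule_def algebra_simps intro!: restrict_ext\<close>)
qed

end

theory Submission
  imports Defs
begin

text \<open>
  Suppose that the algebra is amenable. A virtual diagonal \<open>m\<close> satisfies \<open>m(\<phi>) =
  m(\<phi>\<^sub>k)\<close> for the forms \<open>\<phi>(a, b) = tr(D ab)\<close> and \<open>\<phi>\<^sub>k(a, b) = tr(D a
  Q b)\<close>, where \<open>D\<close> is a diagonal operator with finitely many nonzero entries \<open>u\<close> and
  \<open>Q\<close> is the projection onto the coordinates from \<open>k\<close> on: by invariance, \<open>m\<close> takes
  on the forms \<open>a\<^sub>i\<^sub>j b\<^sub>j\<^sub>i\<close> a value that does not depend on \<open>i\<close>, and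
  the sums over \<open>i\<close> are bounded, so this value is 0. As \<open>m(\<phi>)\<close> is the sum of
  \<open>u\<close>, it is enough to find \<open>u\<close> with sum 1 and \<open>k\<close> such that the norm of
  \<open>\<phi>\<^sub>k\<close> is small. The norm of \<open>T\<^sup>*\<close> is not equivalent to that of
  \<open>\<ell>\<^sub>1\<close>, so \<open>u\<close> can be chosen of small norm in \<open>T\<^sup>*\<close>. On the other
  hand the norm of \<open>T\<^sup>*\<close> dominates the \<open>\<ell>\<^sub>2\<close> norm, and a fixed number of
  vectors of \<open>T\<close> supported far out behaves as in \<open>c\<^sub>0\<close>, even if their supports interleave.
  With Grothendieck's inequality, which here reduces to that of Khinchin, the norm of \<open>\<phi>\<^sub>k\<close> is at
  most a constant times the norm of \<open>u\<close>.
\<close>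


section \<open>The norm of \<open>c\<^sub>0\<^sub>0\<close>\<close>

text \<open>The difficulty lies in the order of choices. A \<open>u\<close> with sum 1 and small
  norm has long support, so an estimate that loses a factor depending on the support of
  \<open>u\<close> is worthless. In the bound on the form with \<open>Q\<close> only the cutoff
  depends on that support; the constant 768 is absolute. This is possible because the tail behaves
  like \<open>c\<^sub>0\<close> for any prescribed number of vectors, with a constant independent of
  that number.

  The forms live on all bounded operators, since \<open>a \<otimes> 1 - 1 \<otimes> a\<close> needs
  the identity. That the derivation is inner yields a functional on forms vanishing at
  \<open>x = 1\<close>, which stands for \<open>1 \<otimes> 1\<close> minus a virtual diagonal. The
  form \<open>tr (D x Q y)\<close> is among them as soon as the cutoff lies beyond the support of
  \<open>u\<close>, because then \<open>D Q = 0\<close>; so \<open>tr (D x y)\<close> never has to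
  be evaluated separately.

  The lemma on convex sets moving to infinity serves twice: it gives \<open>u\<close>, and it shows
  that truncations converge on Tsirelson's space, so that operators can be computed through their
  matrices.\<close>

lemma norm_coord_le: "norm (coord x n) \<le> norm x"
  using coord_le_tnorm0[of x n] tnorm_le_norm[of 0 x] by linarith

lemma tnorm_mono:
  assumes "\<And>n. norm (coord y n) \<le> norm (coord x n)"
  shows "tnorm m y \<le> tnorm m x"
  using assms
proof (induction m arbitrary: x y)
  case 0
  have "norm (coord y n) \<le> tnorm 0 x" for n
    using 0 coord_le_tnorm0[of x n] order_trans by blast
  then show ?case unfolding tnorm.simps(1)[of y] by (intro cSUP_least) auto
next
  case (Suc m)
  have "(SUP Es \<in> Collect admissible. \<Sum>E\<leftarrow>Es. tnorm m (proj E y))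
      \<le> (SUP Es \<in> Collect admissible. \<Sum>E\<leftarrow>Es. tnorm m (proj E x))"
  proof (rule cSUP_mono[OF _ bdd_tnorm_sum])
    show "Collect admissible \<noteq> {}" using admissible_singleton by auto
    fix Es assume "Es \<in> Collect admissible"
    moreover have "(\<Sum>E\<leftarrow>Es. tnorm m (proj E y)) \<le> (\<Sum>E\<leftarrow>Es. tnorm m (proj E x))"
      by (intro sum_list_mono Suc.IH) (simp add: Suc.prems)
    ultimately show "\<exists>Fs\<in>Collect admissible. (\<Sum>E\<leftarrow>Es. tnorm m (proj E y)) \<le> (\<Sum>E\<leftarrow>Fs. tnorm m (proj E x))"
      by blast
  qed
  moreover have "tnorm m y \<le> tnorm m x" by (intro Suc.IH Suc.prems)
  ultimately show ?case by (auto simp: max_def)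
qed

lemma norm_c00_mono:
  assumes "\<And>n. norm (coord y n) \<le> norm (coord x n)"
  shows "norm y \<le> norm x"
  by (rule LIMSEQ_le[OF tnorm_tendsto tnorm_tendsto]) (use tnorm_mono[OF assms] in blast)

lemma norm_proj_le: "norm (proj E x) \<le> norm x"
  by (rule norm_c00_mono) simp

lemma proj_proj [simp]: "proj E (proj F x) = proj (E \<inter> F) x"
  by (rule coord_eqI) auto

lemma proj_cong: "(\<And>n. coord x n \<noteq> 0 \<Longrightarrow> n \<in> E \<longleftrightarrow> n \<in> F) \<Longrightarrow> proj E x = proj F x"
  by (rule coord_eqI) auto

lemma proj_add: "proj E (x + y) = proj E x + proj E y"
  by (rule coord_eqI) auto

lemma proj_scaleR: "proj E (r *\<^sub>R x) = r *\<^sub>R proj E x"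
  by (rule coord_eqI) auto

lemma proj_zero: "proj E 0 = 0"
  by (rule coord_eqI) auto

lemma proj_sum: "proj E (\<Sum>i\<in>I. f i) = (\<Sum>i\<in>I. proj E (f i))"
  by (induction I rule: infinite_finite_induct) (auto simp: proj_add proj_zero)

lemma coord_sum: "coord (\<Sum>i\<in>I. f i) n = (\<Sum>i\<in>I. coord (f i) n)"
  by (induction I rule: infinite_finite_induct) auto

lemma supp_bounded: obtains M where "\<And>n. coord x n \<noteq> 0 \<Longrightarrow> n < M"
proof -
  obtain M where "\<forall>n\<in>{n. coord x n \<noteq> 0}. n < M"
    using finite_supp[of x] finite_nat_set_iff_bounded by meson
  then show thesis by (intro that) auto
qed

text \<open>The limit norm satisfies the implicit equation of Tsirelson's norm, being the maximum of
  the sup norm and half the best admissible sum. This is one inequality, \<open>norm_c00_leI\<close>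
  is the other.\<close>

lemma sum_norm_admissible_le:
  assumes "admissible Es"
  shows "(\<Sum>E\<leftarrow>Es. norm (proj E x)) \<le> 2 * norm x"
proof (rule LIMSEQ_le_const2)
  have "(\<lambda>m. \<Sum>E\<leftarrow>Fs. tnorm m (proj E x)) \<longlonglongrightarrow> (\<Sum>E\<leftarrow>Fs. norm (proj E x))" for Fs
    by (induction Fs) (auto intro!: tendsto_add tnorm_tendsto)
  then show "(\<lambda>m. \<Sum>E\<leftarrow>Es. tnorm m (proj E x)) \<longlonglongrightarrow> (\<Sum>E\<leftarrow>Es. norm (proj E x))" .
  show "\<exists>N. \<forall>m\<ge>N. (\<Sum>E\<leftarrow>Es. tnorm m (proj E x)) \<le> 2 * norm x"
  proof (intro exI[of _ 0] allI impI)
    fix m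
    have "(\<Sum>E\<leftarrow>Es. tnorm m (proj E x)) \<le> (SUP Es \<in> Collect admissible. \<Sum>E\<leftarrow>Es. tnorm m (proj E x))"
      using assms by (intro cSUP_upper bdd_tnorm_sum) auto
    also have "\<dots> \<le> 2 * tnorm (Suc m) x" by simp
    also have "\<dots> \<le> 2 * norm x" using tnorm_le_norm[of "Suc m" x] by linarith
    finally show "(\<Sum>E\<leftarrow>Es. tnorm m (proj E x)) \<le> 2 * norm x" .
  qed
qed

text \<open>The hypothesis on admissible families concerns the limit norm, which dominates each
  \<open>tnorm m\<close>; so the induction on \<open>m\<close> can keep \<open>x\<close>
  fixed.\<close>

lemma norm_c00_leI:
  assumes coord: "\<And>n. norm (coord x n) \<le> s"
    and adm: "\<And>Es. admissible Es \<Longrightarrow> (\<Sum>E\<leftarrow>Es. norm (proj E x)) \<le> 2 * s"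
  shows "norm x \<le> s"
proof -
  have "tnorm m x \<le> s" for m
  proof (induction m)
    case 0
    show ?case unfolding tnorm.simps(1) by (intro cSUP_least coord) auto
  next
    case (Suc m)
    have "(SUP Es \<in> Collect admissible. \<Sum>E\<leftarrow>Es. tnorm m (proj E x)) \<le> 2 * s"
    proof (rule cSUP_least)
      show "Collect admissible \<noteq> {}" using admissible_singleton by auto
      fix Es assume "Es \<in> Collect admissible"
      then have "(\<Sum>E\<leftarrow>Es. norm (proj E x)) \<le> 2 * s" by (intro adm) auto
      moreover have "(\<Sum>E\<leftarrow>Es. tnorm m (proj E x)) \<le> (\<Sum>E\<leftarrow>Es. norm (proj E x))"
        by (intro sum_list_mono tnorm_le_norm)
      ultimately show "(\<Sum>E\<leftarrow>Es. tnorm m (proj E x)) \<le> 2 * s" by linarith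
    qed
    with Suc show ?case by simp
  qed
  then show ?thesis by (intro LIMSEQ_le_const2[OF tnorm_tendsto]) auto
qed

text \<open>For \<open>a\<close> in \<open>P\<close> this is the interval from \<open>a\<close> up
  to the next point of \<open>P\<close>, unbounded for the last point. If \<open>P\<close> is
  finite, these intervals partition everything from its least point on.\<close>

definition block :: "nat set \<Rightarrow> nat \<Rightarrow> nat set" where
  "block P a = {n. a \<le> n \<and> (\<forall>q\<in>P. q \<le> n \<longrightarrow> q \<le> a)}"

lemma disjoint_block:
  "a \<in> P \<Longrightarrow> b \<in> P \<Longrightarrow> a \<noteq> b \<Longrightarrow> n \<in> block P a \<Longrightarrow> n \<notin> block P b"
  unfolding block_def by (metis (mono_tags, lifting) mem_Collect_eq order_antisym)

lemma ex_block:
  assumes "finite P" "p \<in> P" "p \<le> n"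
  obtains a where "a \<in> P" "n \<in> block P a"
proof
  let ?a = "Max {q\<in>P. q \<le> n}"
  have fin: "finite {q\<in>P. q \<le> n}" and ne: "{q\<in>P. q \<le> n} \<noteq> {}" using assms by auto
  have "?a \<in> {q\<in>P. q \<le> n}" by (rule Max_in[OF fin ne])
  then show "?a \<in> P" "n \<in> block P ?a"
    unfolding block_def using Max_ge[OF fin] by auto
qed

lemma sum_norm_block_le:
  assumes P: "finite P" "P \<noteq> {}" "card P \<le> Suc (Min P)"
  shows "(\<Sum>a\<in>P. norm (proj (block P a) x)) \<le> 2 * norm x"
proof -
  obtain M0 where M0: "\<And>n. coord x n \<noteq> 0 \<Longrightarrow> n < M0" by (rule supp_bounded) blast
  \<comment> \<open>Admissible sets are finite, so the blocks are cut behind the support of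
    \<open>x\<close>; \<open>Max P\<close> keeps the last one nonempty.\<close>
  define M where "M = max M0 (Max P)"
  define I where "I a = block P a \<inter> {..M}" for a
  let ?Es = "map I (sorted_list_of_set P)"
  have a_in: "a \<in> I a" if "a \<in> P" for a
    using that P(1) unfolding I_def M_def block_def by (auto simp: le_max_iff_disj)
  have finI: "finite (I a)" for a unfolding I_def by auto
  have minI: "Min (I a) = a" if "a \<in> P" for a
    using a_in[OF that] finI by (intro Min_eqI) (auto simp: I_def block_def)
  have lt: "Max (I a) < Min (I b)" if "a \<in> P" "b \<in> P" "a < b" for a b
  proof -
    have "\<forall>n\<in>I a. n < b" using that unfolding I_def block_def by (auto simp: not_le[symmetric])
    then have "Max (I a) < b" using a_in[OF that(1)] finI by (subst Max_less_iff) auto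
    then show ?thesis using minI[OF that(2)] by simp
  qed
  have "admissible ?Es"
    unfolding admissible_def
  proof (intro conjI ballI)
    show "?Es \<noteq> []" using P by auto
    fix E assume "E \<in> set ?Es"
    then show "finite E" "E \<noteq> {}" using finI a_in P(1) by auto
  next
    have "sorted_wrt (\<lambda>a b. Max (I a) < Min (I b)) (sorted_list_of_set P)"
      by (rule sorted_wrt_mono_rel[OF _ strict_sorted_list_of_set[of P]]) (use lt P(1) in auto)
    then show "sorted_wrt (\<lambda>E F. Max E < Min F) ?Es" by (simp add: sorted_wrt_map)
    have "hd ?Es = I (Min P)"
      using P by (simp add: hd_map sorted_list_of_set_nonempty)
    then show "length ?Es \<le> Suc (Min (hd ?Es))"
      using minI[of "Min P"] P by (simp add: distinct_card)
  qed
  then have "(\<Sum>E\<leftarrow>?Es. norm (proj E x)) \<le> 2 * norm x" by (rule sum_norm_admissible_le)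
  also have "(\<Sum>E\<leftarrow>?Es. norm (proj E x)) = (\<Sum>a\<in>P. norm (proj (I a) x))"
    using P(1) by (simp add: sum_list_distinct_conv_sum_set o_def)
  also have "\<dots> = (\<Sum>a\<in>P. norm (proj (block P a) x))"
    by (intro sum.cong refl arg_cong[where f = norm] proj_cong)
       (use M0 in \<open>force simp: I_def M_def\<close>)
  finally show ?thesis .
qed

text \<open>On a set with no more points than its first index (a Schreier set) the norm is
  equivalent to that of \<open>\<ell>\<^sub>1\<close>: each coordinate is dominated by the block
  that starts there.\<close>

lemma sum_norm_coord_le:
  assumes P: "finite P" "card P \<le> Suc (Min P)"
  shows "(\<Sum>a\<in>P. norm (coord x a)) \<le> 2 * norm x"
proof (cases "P = {}")
  case False
  have "norm (coord x a) \<le> norm (proj (block P a) x)" for a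
    using norm_coord_le[of "proj (block P a) x" a] by (simp add: block_def)
  then have "(\<Sum>a\<in>P. norm (coord x a)) \<le> (\<Sum>a\<in>P. norm (proj (block P a) x))"
    by (rule sum_mono)
  also have "\<dots> \<le> 2 * norm x" using P False by (intro sum_norm_block_le)
  finally show ?thesis .
qed simp

text \<open>Two levels of admissibility: the interval consists of \<open>\<kappa> - 1\<close> pieces
  of length \<open>q\<close>, each of them a Schreier set, and the pieces are few enough to be
  admissible themselves. Each level costs a factor 2.\<close>

lemma sum_norm_coord_le_interval:
  assumes \<kappa>: "\<kappa> \<le> q" and "q > 0"
  shows "(\<Sum>n\<in>{q..<\<kappa>*q}. norm (coord x n)) \<le> 4 * norm x"
proof (cases "\<kappa> \<le> 1")
  case True
  then have "{q..<\<kappa>*q} = {}" by (cases "\<kappa> = 0"; cases "\<kappa> = 1") auto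
  then show ?thesis by (simp only: sum.empty) simp
next
  case False
  let ?P = "(\<lambda>j. j*q) ` {1..<\<kappa>}"
  have inj: "inj_on (\<lambda>j. j*q) {1..<\<kappa>}" using \<open>q > 0\<close> by (auto simp: inj_on_def)
  have Min: "Min ?P = q"
    using False by (intro Min_eqI) (auto intro!: image_eqI[of _ _ 1])
  have "card ?P = \<kappa> - 1" by (simp only: card_image[OF inj]) simp
  then have P: "finite ?P" "?P \<noteq> {}" "card ?P \<le> Suc (Min ?P)"
    using False \<kappa> Min by (simp, simp, linarith)
  have split: "(\<Sum>n\<in>{q..<K*q}. norm (coord x n)) = (\<Sum>j\<in>{1..<K}. \<Sum>n\<in>{j*q..<j*q+q}. norm (coord x n))"
    if "K \<ge> 1" for K using that
  proof (induction K rule: nat_induct_at_least)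
    case (Suc K)
    have "{q..<Suc K*q} = {q..<K*q} \<union> {K*q..<K*q+q}" 
      using Suc \<open>q > 0\<close> by (cases K) auto
    then have "(\<Sum>n\<in>{q..<Suc K*q}. norm (coord x n)) = (\<Sum>n\<in>{q..<K*q}. norm (coord x n)) + (\<Sum>n\<in>{K*q..<K*q+q}. norm (coord x n))"
      by (simp add: sum.union_disjoint del: mult_Suc)
    then show ?case using Suc by simp
  qed simp
  have "(\<Sum>n\<in>{j*q..<j*q+q}. norm (coord x n)) \<le> 2 * norm (proj (block ?P (j*q)) x)"
    if j: "j \<in> {1..<\<kappa>}" for j
  proof -
    let ?J = "{j*q..<j*q+q}"
    have sub: "?J \<subseteq> block ?P (j*q)"
    proof
      fix n assume "n \<in> ?J"
      moreover have "i*q \<le> j*q" if "i*q \<le> n" "n < j*q + q" for i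
      proof -
        have "i * q < Suc j * q" using that by simp
        then have "i < Suc j" unfolding mult_less_cancel2 by blast
        then have "i \<le> j" by simp
        then show ?thesis by simp
      qed
      ultimately show "n \<in> block ?P (j*q)" by (auto simp: block_def)
    qed
    have "(\<Sum>n\<in>?J. norm (coord x n)) = (\<Sum>n\<in>?J. norm (coord (proj (block ?P (j*q)) x) n))"
      using sub by (intro sum.cong) auto
    also have "\<dots> \<le> 2 * norm (proj (block ?P (j*q)) x)"
    proof (rule sum_norm_coord_le)
      have "Min ?J = j*q" using \<open>q > 0\<close> by (intro Min_eqI) auto
      moreover have "card ?J = q" by simp
      moreover have "1 * q \<le> j * q" using j by (intro mult_right_mono) auto
      ultimately show "card ?J \<le> Suc (Min ?J)" by linarith
    qed simp
    finally show ?thesis .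
  qed
  then have "(\<Sum>j\<in>{1..<\<kappa>}. \<Sum>n\<in>{j*q..<j*q+q}. norm (coord x n))
    \<le> (\<Sum>j\<in>{1..<\<kappa>}. 2 * norm (proj (block ?P (j*q)) x))" by (rule sum_mono)
  also have "\<dots> = 2 * (\<Sum>a\<in>?P. norm (proj (block ?P a) x))"
    by (simp only: sum.reindex[OF inj] sum_distrib_left o_def)
  also have "\<dots> \<le> 4 * norm x" using sum_norm_block_le[OF P, of x] by simp
  finally show ?thesis using split[of \<kappa>] False by simp
qed


section \<open>Convex sets moving to infinity contain small vectors\<close>

text \<open>Successive sets overlap at most in endpoints; restarting the count at the maximum of the
  previous set counts one point twice per set.\<close>

lemma sum_card_successive_le:
  fixes Js :: "nat set list"
  assumes "sorted_wrt (\<lambda>A B. \<forall>a\<in>A. \<forall>b\<in>B. a \<le> b) Js" "\<forall>J\<in>set Js. J \<subseteq> {s..r}" "s \<le> Suc r"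
  shows "(\<Sum>J\<leftarrow>Js. card J) \<le> Suc r - s + length Js"
  using assms
proof (induction Js arbitrary: s)
  case (Cons A Js)
  show ?case
  proof (cases "A = {}")
    case True
    then have "(\<Sum>J\<leftarrow>Js. card J) \<le> Suc r - s + length Js" using Cons.prems by (intro Cons.IH) auto
    then show ?thesis using True by simp
  next
    case False
    have fin: "finite A" using Cons.prems by (meson finite_atLeastAtMost finite_subset list.set_intros(1))
    define M where "M = Max A"
    have M: "M \<in> A" unfolding M_def using fin False by (rule Max_in)
    then have sM: "s \<le> M" "M \<le> r" using Cons.prems by auto
    have "A \<subseteq> {s..M}" using Cons.prems fin by (auto simp: M_def)
    then have "card A \<le> Suc M - s" using card_mono[of "{s..M}" A] by simp
    moreover have "(\<Sum>J\<leftarrow>Js. card J) \<le> Suc r - M + length Js"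
    proof (rule Cons.IH)
      show "\<forall>J\<in>set Js. J \<subseteq> {M..r}" using Cons.prems M by fastforce
    qed (use Cons.prems sM in auto)
    ultimately show ?thesis using sM by simp
  qed
qed simp

text \<open>The family and the vectors are both successive, so the pairs \<open>(E, j)\<close> in
  which \<open>E\<close> meets \<open>w j\<close> number at most \<open>r + length Es\<close>, and
  each contributes at most \<open>B\<close>. For a family that is short compared with
  \<open>r\<close> this gains almost a factor 2 over the general bound.\<close>

lemma sum_norm_proj_spread_le:
  fixes w :: "nat \<Rightarrow> 'k::real_normed_vector c00"
  assumes w: "\<And>j. norm (w j) \<le> B" and supp: "\<And>j n. coord (w j) n \<noteq> 0 \<Longrightarrow> t j \<le> n \<and> n < t (Suc j)"
    and t: "mono t" and Es: "admissible Es"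
  shows "(\<Sum>E\<leftarrow>Es. norm (proj E (\<Sum>j\<in>{1..r}. w j))) \<le> real (r + length Es) * B"
proof -
  define J where "J E = {j\<in>{1..r}. proj E (w j) \<noteq> 0}" for E
  have B: "B \<ge> 0" using w[of 0] norm_ge_zero order_trans by blast
  have JE: "norm (proj E (\<Sum>j\<in>{1..r}. w j)) \<le> real (card (J E)) * B" for E
  proof -
    have "norm (proj E (\<Sum>j\<in>{1..r}. w j)) \<le> (\<Sum>j\<in>{1..r}. norm (proj E (w j)))"
      unfolding proj_sum by (rule norm_sum)
    also have "\<dots> = (\<Sum>j\<in>J E. norm (proj E (w j)))"
      by (rule sum.mono_neutral_right) (auto simp: J_def)
    also have "\<dots> \<le> (\<Sum>j\<in>J E. B)"
      by (intro sum_mono order_trans[OF norm_proj_le w])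
    finally show ?thesis by simp
  qed
  have "(\<Sum>E\<leftarrow>Es. norm (proj E (\<Sum>j\<in>{1..r}. w j))) \<le> (\<Sum>E\<leftarrow>Es. real (card (J E)) * B)"
    by (intro sum_list_mono JE)
  also have "\<dots> = real (\<Sum>E\<leftarrow>Es. card (J E)) * B"
    by (induction Es) (auto simp: algebra_simps)
  also have "\<dots> \<le> real (r + length Es) * B"
  proof (intro mult_right_mono B)
    have "sorted_wrt (\<lambda>E F. \<forall>a\<in>J E. \<forall>b\<in>J F. a \<le> b) Es"
    proof (rule sorted_wrt_mono_rel)
      show "sorted_wrt (\<lambda>E F. Max E < Min F) Es" using Es by (simp add: admissible_def)
      fix E F assume EF: "E \<in> set Es" "F \<in> set Es" "Max E < Min F"
      show "\<forall>a\<in>J E. \<forall>b\<in>J F. a \<le> b"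
      proof (intro ballI)
        fix a b assume ab: "a \<in> J E" "b \<in> J F"
        have ex: "\<exists>n\<in>E. coord (w j) n \<noteq> 0" if "proj E (w j) \<noteq> 0" for E j
        proof (rule ccontr)
          assume "\<not> ?thesis"
          then have "proj E (w j) = 0" by (intro coord_eqI) auto
          with that show False by simp
        qed
        obtain n where n: "n \<in> E" "coord (w a) n \<noteq> 0" using ab ex by (auto simp: J_def)
        obtain k where k: "k \<in> F" "coord (w b) k \<noteq> 0" using ab ex by (auto simp: J_def)
        have "finite E" "finite F" using EF Es by (auto simp: admissible_def)
        then have "n \<le> Max E" "Min F \<le> k" using n k by auto
        then have "n < k" using EF by simp
        then have "t a < t (Suc b)" using supp[OF n(2)] supp[OF k(2)] by linarith
        then have "a < Suc b" using t by (meson leD monoD not_less)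
        then show "a \<le> b" by simp
      qed
    qed
    then have "sorted_wrt (\<lambda>A B. \<forall>a\<in>A. \<forall>b\<in>B. a \<le> b) (map J Es)" by (simp add: sorted_wrt_map)
    then have "(\<Sum>A\<leftarrow>map J Es. card A) \<le> Suc r - 1 + length (map J Es)"
      by (rule sum_card_successive_le) (auto simp: J_def)
    then have "(\<Sum>E\<leftarrow>Es. card (J E)) \<le> r + length Es" by (simp add: o_def)
    then show "real (\<Sum>E\<leftarrow>Es. card (J E)) \<le> real (r + length Es)" by (simp only: of_nat_le_iff)
  qed
  finally show ?thesis .
qed

text \<open>
  The argument that Tsirelson's norm admits no \<open>\<ell>\<^sub>1\<close>: if the norms on \<open>C N\<close> had a positive limit
  infimum \<open>L\<close>, take almost minimal successive vectors \<open>w 0, w 1, \<dots>\<close>. An admissible family that meets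
  \<open>w 0\<close> has too few sets to norm a long average of the others, so the mean of \<open>w 0\<close> and that
  average has norm below \<open>L\<close>.
\<close>

lemma ex_small_norm:
  fixes C :: "nat \<Rightarrow> 'k::real_normed_vector c00 set"
  assumes conv: "\<And>N. convex (C N)" and ne: "\<And>N. C N \<noteq> {}"
    and dec: "\<And>M N. M \<le> N \<Longrightarrow> C N \<subseteq> C M"
    and supp: "\<And>N y n. y \<in> C N \<Longrightarrow> coord y n \<noteq> 0 \<Longrightarrow> N \<le> n"
    and bdd: "\<And>y. y \<in> C 0 \<Longrightarrow> norm y \<le> 1" and e: "e > 0"
  shows "\<exists>y\<in>C 0. norm y < e"
proof (rule ccontr)
  assume "\<not> ?thesis"
  then have ge: "norm y \<ge> e" if "y \<in> C N" for y N
    using that dec[of 0 N] by fastforce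
  define l where "l N = (INF y\<in>C N. norm y)" for N
  have l_ge: "e \<le> l N" for N
    unfolding l_def by (rule cINF_greatest[OF ne]) (rule ge)
  have bb: "bdd_below (norm ` C N)" for N by (rule bdd_belowI2[of _ 0]) simp
  have l_le: "l N \<le> norm y" if "y \<in> C N" for N y
    unfolding l_def using bb that by (rule cINF_lower)
  have l1: "l N \<le> 1" for N
  proof -
    obtain y where "y \<in> C N" using ne by blast
    then show ?thesis using l_le[of y N] bdd[of y] dec[of 0 N] by force
  qed
  define L where "L = (SUP N. l N)"
  have lL: "l N \<le> L" for N
    unfolding L_def by (rule cSUP_upper) (auto intro!: bdd_aboveI2 l1)
  have L: "L > 0" using e l_ge[of 0] lL[of 0] by linarith
  have "\<exists>N. 15/16 * L < l N"
  proof (rule ccontr)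
    assume "\<not> ?thesis"
    then have "(SUP N. l N) \<le> 15/16 * L" by (intro cSUP_least) (auto simp: not_less)
    then show False using L by (simp add: L_def[symmetric])
  qed
  then obtain N where N: "15/16 * L < l N" by blast
  \<comment> \<open>The margins 15/16 and 17/16 are such that \<open>13/16 * B = 221/256 * L\<close>
    stays below \<open>15/16 * L = 240/256 * L\<close>, a lower bound for the norms on
    \<open>C N\<close>.\<close>
  define B where "B = 17/16 * L"
  have "\<exists>y\<in>C t. norm y < B" for t
  proof (rule ccontr)
    assume "\<not> ?thesis"
    then have "B \<le> l t" unfolding l_def by (intro cINF_greatest[OF ne]) (auto simp: not_less)
    then show False using lL[of t] L by (simp add: B_def)
  qed
  then obtain pick where pick: "\<And>t. pick t \<in> C t" "\<And>t. norm (pick t) < B" by metis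
  have "\<forall>t. \<exists>M. \<forall>n. coord (pick t) n \<noteq> 0 \<longrightarrow> n < M" using supp_bounded by metis
  then obtain bd where bd: "\<And>t n. coord (pick t) n \<noteq> 0 \<Longrightarrow> n < bd t" by metis
  \<comment> \<open>Each vector is picked beyond the support of the previous one.\<close>
  define t where "t = rec_nat N (\<lambda>_ s. max s (bd s))"
  have t: "t 0 = N" "\<And>j. t (Suc j) = max (t j) (bd (t j))" by (simp_all add: t_def)
  have mono: "mono t" by (rule mono_iff_le_Suc[THEN iffD2]) (simp add: t)
  define w where "w j = pick (t j)" for j
  have wB: "norm (w j) \<le> B" for j using pick(2) by (simp add: w_def less_imp_le)
  have B: "B \<ge> 0" using L by (simp add: B_def)
  have wsupp: "t j \<le> n \<and> n < t (Suc j)" if "coord (w j) n \<noteq> 0" for j n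
    using that supp[OF pick(1)] bd unfolding w_def t by (metis less_max_iff_disj)
  have wC: "w j \<in> C N" for j
    using pick(1)[of "t j"] dec[of N "t j"] monoD[OF mono, of 0 j] t(1) by (auto simp: w_def)
  \<comment> \<open>A family that starts before \<open>t 1\<close> has at most
    \<open>Suc (t 1)\<close> sets, a quarter of \<open>r\<close>; hence the factor 5/4
    below.\<close>
  define r where "r = 4 * Suc (t 1)"
  define s where "s = (\<Sum>j\<in>{1..r}. w j)"
  define v where "v = (1/2) *\<^sub>R w 0 + (1/2) *\<^sub>R ((1 / real r) *\<^sub>R s)"
  have r: "r > 0" by (simp add: r_def)
  have "(\<Sum>j\<in>{1..r}. (1 / real r) *\<^sub>R w j) \<in> C N"
    by (rule convex_sum[OF _ conv]) (use r wC in auto)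
  then have "v \<in> C N"
    unfolding v_def s_def scaleR_sum_right[symmetric] using conv[of N] wC[of 0]
    by (intro convexD) auto
  then have "15/16 * L < norm v" using N l_le by fastforce
  moreover have "norm v \<le> 13/16 * B"
  proof (rule norm_c00_leI)
    have s0: "coord s n = 0" if "n < t 1" for n
    proof -
      have "coord (w j) n = 0" if "j \<in> {1..r}" for j
        using wsupp[of j n] monoD[OF mono, of 1 j] \<open>n < t 1\<close> that by force
      then show ?thesis by (simp add: s_def coord_sum)
    qed
    have "norm s \<le> (\<Sum>j\<in>{1..r}. B)" unfolding s_def by (intro sum_norm_le wB)
    then have ns: "norm ((1 / real r) *\<^sub>R s) \<le> B" using r by (simp add: field_simps)
    fix n
    show "norm (coord v n) \<le> 13/16 * B"
    proof (cases "n < t 1")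
      case True
      then have "norm (coord v n) = 1/2 * norm (coord (w 0) n)" using s0 by (simp add: v_def)
      then show ?thesis using norm_coord_le[of "w 0" n] wB[of 0] B by linarith
    next
      case False
      then have "coord (w 0) n = 0" using wsupp[of 0 n] by auto
      then have "norm (coord v n) = 1/2 * norm (coord ((1 / real r) *\<^sub>R s) n)" by (simp add: v_def)
      then show ?thesis using norm_coord_le[of "(1 / real r) *\<^sub>R s" n] ns B by linarith
    qed
    fix Es assume Es: "admissible Es"
    have "(\<Sum>E\<leftarrow>Es. norm (proj E v)) \<le> (\<Sum>E\<leftarrow>Es. 1/2 * norm (proj E (w 0)) + 1/2 * norm (proj E ((1 / real r) *\<^sub>R s)))"
    proof (rule sum_list_mono)
      fix E
      have "norm (proj E v) \<le> norm ((1/2) *\<^sub>R proj E (w 0)) + norm ((1/2) *\<^sub>R proj E ((1 / real r) *\<^sub>R s))"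
        unfolding v_def proj_add proj_scaleR[of E "1/2"] by (rule norm_triangle_ineq)
      then show "norm (proj E v) \<le> 1/2 * norm (proj E (w 0)) + 1/2 * norm (proj E ((1 / real r) *\<^sub>R s))"
        by simp
    qed
    also have "\<dots> = 1/2 * (\<Sum>E\<leftarrow>Es. norm (proj E (w 0))) + 1/2 * (\<Sum>E\<leftarrow>Es. norm (proj E ((1 / real r) *\<^sub>R s)))"
      by (simp only: sum_list_addf sum_list_const_mult)
    \<comment> \<open>If the family starts before \<open>t 1\<close>, the bound is
      \<open>1/2 * 2 * B + 1/2 * 5/4 * B\<close>. Otherwise \<open>w 0\<close> contributes nothing
      and \<open>B\<close> is enough.\<close>
    also have "\<dots> \<le> 13/8 * B"
    proof (cases "Min (hd Es) < t 1")
      case True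
      have 1: "(\<Sum>E\<leftarrow>Es. norm (proj E (w 0))) \<le> 2 * B"
        using sum_norm_admissible_le[OF Es, of "w 0"] wB[of 0] by linarith
      have len: "length Es \<le> Suc (t 1)" using Es True by (simp add: admissible_def)
      have "(\<Sum>E\<leftarrow>Es. norm (proj E s)) \<le> real (r + length Es) * B"
        unfolding s_def by (rule sum_norm_proj_spread_le[OF wB wsupp mono Es])
      also have "\<dots> \<le> (5/4 * real r) * B"
        using len B by (intro mult_right_mono) (simp_all add: r_def)
      finally have "(1 / real r) * (\<Sum>E\<leftarrow>Es. norm (proj E s)) \<le> (1 / real r) * ((5/4 * real r) * B)"
        by (intro mult_left_mono) auto
      then have "(1 / real r) * (\<Sum>E\<leftarrow>Es. norm (proj E s)) \<le> 5/4 * B" using r by simp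
      moreover have "(\<Sum>E\<leftarrow>Es. norm (proj E ((1 / real r) *\<^sub>R s))) = (1 / real r) * (\<Sum>E\<leftarrow>Es. norm (proj E s))"
        by (simp add: proj_scaleR sum_list_const_mult[symmetric])
      ultimately show ?thesis using 1 by linarith
    next
      case False
      have "proj E (w 0) = 0" if E: "E \<in> set Es" for E
      proof (rule coord_eqI)
        fix n
        have "t 1 \<le> n" if "n \<in> E"
        proof -
          have fin: "\<forall>E\<in>set Es. finite E \<and> E \<noteq> {}" using Es by (simp add: admissible_def)
          have "Min (hd Es) \<le> Min E"
          proof (cases Es)
            case (Cons F Fs)
            show ?thesis
            proof (cases "E = F")
              case False
              then have E': "E \<in> set Fs" using Cons E by simp
              have "sorted_wrt (\<lambda>E F. Max E < Min F) (F # Fs)" using Es Cons by (simp only: admissible_def)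
              then have "Max F < Min E" unfolding sorted_wrt.simps using E' by blast
              moreover have "Min F \<le> Max F" using fin Cons by simp
              ultimately show ?thesis using Cons by simp
            qed (use Cons in simp)
          qed (use E in simp)
          also have "\<dots> \<le> n" using fin E that by simp
          finally show ?thesis using \<open>\<not> Min (hd Es) < t 1\<close> by simp
        qed
        then show "coord (proj E (w 0)) n = coord 0 n" using wsupp[of 0 n] by force
      qed
      then have "(\<Sum>E\<leftarrow>Es. norm (proj E (w 0))) = (\<Sum>E\<leftarrow>Es. 0)"
        by (intro arg_cong[where f = sum_list] map_cong) auto
      moreover have "(\<Sum>E\<leftarrow>Es. norm (proj E ((1 / real r) *\<^sub>R s))) \<le> 2 * B"
        using sum_norm_admissible_le[OF Es, of "(1 / real r) *\<^sub>R s"] ns by linarith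
      ultimately show ?thesis using B by simp
    qed
    finally show "(\<Sum>E\<leftarrow>Es. norm (proj E v)) \<le> 2 * (13/16 * B)" by simp
  qed
  ultimately show False using L by (simp add: B_def)
qed


section \<open>Disjointly supported vectors far out\<close>

text \<open>
  Norming functionals of depth \<open>r\<close>. The parameter \<open>b\<close> is a lower bound of the support, and it
  bounds the number of branches at the root in place of the minimum of the support; thus the
  predicate is inherited by restrictions, and \<open>b\<close> can be enlarged (\<open>norming_restrict\<close>).
\<close>

primrec norming :: "nat \<Rightarrow> nat \<Rightarrow> (nat \<Rightarrow> real) \<Rightarrow> bool" where
  "norming 0 b f \<longleftrightarrow> f = (\<lambda>_. 0)"
| "norming (Suc r) b f \<longleftrightarrow> f = (\<lambda>_. 0) \<or> (\<exists>i\<ge>b. f = (\<lambda>n. of_bool (n = i))) \<or>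
     (\<exists>p \<beta> g. p \<le> Suc b \<and> b \<le> \<beta> 0 \<and> mono \<beta> \<and>
        (\<forall>l<p. norming r (\<beta> l) (g l) \<and> (\<forall>n. g l n \<noteq> 0 \<longrightarrow> \<beta> l \<le> n \<and> n < \<beta> (Suc l))) \<and>
        f = (\<lambda>n. 1/2 * (\<Sum>l<p. g l n)))"

lemma norming_SucE:
  assumes "norming (Suc r) b f"
  obtains "f = (\<lambda>_. 0)" | i where "i \<ge> b" "f = (\<lambda>n. of_bool (n = i))"
    | p \<beta> g where "p \<le> Suc b" "b \<le> \<beta> 0" "mono \<beta>" "\<forall>l<p. norming r (\<beta> l) (g l)"
      "\<forall>l<p. \<forall>n. g l n \<noteq> 0 \<longrightarrow> \<beta> l \<le> n \<and> n < \<beta> (Suc l)" "f = (\<lambda>n. 1/2 * (\<Sum>l<p. g l n))"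
  using assms unfolding norming.simps by blast

lemma mono_interval_unique:
  fixes \<beta> :: "nat \<Rightarrow> nat"
  assumes "mono \<beta>" "\<beta> l \<le> n" "n < \<beta> (Suc l)" "\<beta> k \<le> n" "n < \<beta> (Suc k)"
  shows "l = k"
proof (rule ccontr)
  assume "l \<noteq> k"
  then have "Suc l \<le> k \<or> Suc k \<le> l" by auto
  then show False
    using monoD[OF assms(1), of "Suc l" k] monoD[OF assms(1), of "Suc k" l] assms by auto
qed

lemma sum_separated:
  fixes g :: "nat \<Rightarrow> nat \<Rightarrow> real"
  assumes \<beta>: "mono \<beta>" and g: "\<forall>l<p. \<forall>n. g l n \<noteq> 0 \<longrightarrow> \<beta> l \<le> n \<and> n < \<beta> (Suc l)"
    and l: "l < p" "\<beta> l \<le> n" "n < \<beta> (Suc l)"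
  shows "(\<Sum>k<p. g k n) = g l n"
proof -
  have "(\<Sum>k<p. g k n) = (\<Sum>k\<in>{l}. g k n)"
    by (rule sum.mono_neutral_right) (use l g mono_interval_unique[OF \<beta>] in blast)+
  then show ?thesis by simp
qed

lemma norming_bounds: "norming r b f \<Longrightarrow> 0 \<le> f n \<and> f n \<le> 1 \<and> (f n \<noteq> 0 \<longrightarrow> b \<le> n)"
proof (induction r arbitrary: b f n)
  case (Suc r)
  from Suc.prems show ?case
  proof (cases rule: norming_SucE)
    case (3 p \<beta> g)
    show ?thesis
    proof (cases "\<exists>l<p. g l n \<noteq> 0")
      case True
      then obtain l where l: "l < p" "\<beta> l \<le> n" "n < \<beta> (Suc l)" using 3(5) by blast
      then have f: "f n = 1/2 * g l n"
        using sum_separated[OF 3(3,5) l] 3(6) by simp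
      have "b \<le> n" using 3(2) monoD[OF 3(3), of 0 l] l by simp
      then show ?thesis using f Suc.IH[of "\<beta> l" "g l" n] 3(4) l by auto
    next
      case False
      then have "f n = 0" using 3(6) by (auto intro!: sum.neutral)
      then show ?thesis by simp
    qed
  qed auto
qed auto

text \<open>A node keeps its branches when \<open>b\<close> grows; starts below \<open>b'\<close>
  are moved up to \<open>b'\<close>, which leaves some branches empty. For this
  \<open>\<beta>\<close> must be allowed to repeat values.\<close>

lemma norming_restrict:
  "norming r b f \<Longrightarrow> b \<le> b' \<Longrightarrow> norming r b' (\<lambda>n. if n \<in> I \<and> b' \<le> n then f n else 0)"
proof (induction r arbitrary: b f b')
  case (Suc r)
  let ?f = "\<lambda>n. if n \<in> I \<and> b' \<le> n then f n else 0"
  from Suc.prems(1) show ?case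
  proof (cases rule: norming_SucE)
    case (2 i)
    show ?thesis
    proof (cases "i \<in> I \<and> b' \<le> i")
      case True
      then have "?f = (\<lambda>n. of_bool (n = i))" using 2 by auto
      then show ?thesis using True unfolding norming.simps by blast
    next
      case False
      then have "?f = (\<lambda>_. 0)" using 2 by auto
      then show ?thesis unfolding norming.simps by blast
    qed
  next
    case (3 p \<beta> g)
    define \<beta>' where "\<beta>' l = max b' (\<beta> l)" for l
    define g' where "g' l = (\<lambda>n. if n \<in> I \<and> \<beta>' l \<le> n then g l n else 0)" for l
    have "\<beta> l \<le> n" if "l < p" "g l n \<noteq> 0" for l n using that 3(5) by blast
    then have eq: "g' l n = (if n \<in> I \<and> b' \<le> n then g l n else 0)" if "l < p" for l n
      using that unfolding g'_def \<beta>'_def by (cases "g l n = 0") auto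
    have "?f = (\<lambda>n. 1/2 * (\<Sum>l<p. g' l n))"
      unfolding 3(6) using eq by (intro ext) (auto intro!: sum.neutral)
    moreover have "mono \<beta>'" using 3(3) by (auto simp: \<beta>'_def mono_def max_def intro: order_trans)
    moreover have "norming r (\<beta>' l) (g' l)" if "l < p" for l
      unfolding g'_def by (rule Suc.IH) (use 3(4) that in \<open>auto simp: \<beta>'_def\<close>)
    moreover have "\<beta>' l \<le> n \<and> n < \<beta>' (Suc l)" if "l < p" "g' l n \<noteq> 0" for l n
    proof -
      have "\<beta>' l \<le> n" "g l n \<noteq> 0" using that(2) by (auto simp: g'_def split: if_splits)
      then show ?thesis using 3(5) that(1) by (auto simp: \<beta>'_def less_max_iff_disj)
    qed
    moreover have "p \<le> Suc b'" "b' \<le> \<beta>' 0" using 3(1) Suc.prems(2) by (auto simp: \<beta>'_def)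
    ultimately show ?thesis unfolding norming.simps by blast
  qed auto
qed auto

lemma norming_Suc: "norming r b f \<Longrightarrow> norming (Suc r) b f"
proof (induction r arbitrary: b f)
  case (Suc r)
  from Suc.prems show ?case
  proof (cases rule: norming_SucE)
    case (3 p \<beta> g)
    then show ?thesis using Suc.IH unfolding norming.simps(2)[of "Suc r"] by blast
  qed auto
qed simp

text \<open>\<open>B\<close> is the set of starts of the branches at the root. If no start separates
  \<open>q\<close> from the points of \<open>S\<close>, then \<open>S\<close> meets only the last
  branch that starts up to \<open>q\<close>, and there \<open>2 * f\<close> is this branch. As
  \<open>q < n\<close> is strict, \<open>S\<close> also misses the point of a unit functional, which
  has no branch to descend to.\<close>

lemma norming_split:
  assumes "norming (Suc r) b f"
  shows "\<exists>B. finite B \<and> card B \<le> Suc b \<and>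
    (\<forall>q S. (\<forall>n\<in>S. q < n \<and> (\<forall>i\<in>B. i \<le> n \<longrightarrow> i \<le> q)) \<longrightarrow>
       norming r q (\<lambda>n. if n \<in> S then 2 * f n else 0))"
proof -
  have zero: "norming r q (\<lambda>n. 0)" for q by (cases r) auto
  from assms show ?thesis
  proof (cases rule: norming_SucE)
    case 1
    then have "(\<lambda>n. if n \<in> S then 2 * f n else 0) = (\<lambda>n. 0)" for S by auto
    then show ?thesis using zero by (intro exI[of _ "{}"]) simp
  next
    case (2 i)
    show ?thesis
    proof (intro exI[of _ "{i}"] conjI allI impI)
      fix q S assume "\<forall>n\<in>S. q < n \<and> (\<forall>i\<in>{i}. i \<le> n \<longrightarrow> i \<le> q)"
      then have "i \<notin> S" by force
      then have "(\<lambda>n. if n \<in> S then 2 * f n else 0) = (\<lambda>n. 0)" using 2 by auto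
      then show "norming r q (\<lambda>n. if n \<in> S then 2 * f n else 0)" using zero by simp
    qed auto
  next
    case (3 p \<beta> g)
    show ?thesis
    proof (intro exI[of _ "\<beta> ` {..<p}"] conjI allI impI)
      show "card (\<beta> ` {..<p}) \<le> Suc b"
        using card_image_le[of "{..<p}" \<beta>] 3(1) by simp
      fix q S assume S: "\<forall>n\<in>S. q < n \<and> (\<forall>i\<in>\<beta> ` {..<p}. i \<le> n \<longrightarrow> i \<le> q)"
      let ?f = "\<lambda>n. if n \<in> S then 2 * f n else 0"
      show "norming r q ?f"
      proof (cases "\<exists>l<p. \<beta> l \<le> q")
        case False
        have "f n = 0" if "n \<in> S" for n
        proof -
          have "g l n = 0" if "l < p" for l
            using 3(5) S False \<open>n \<in> S\<close> that by fastforce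
          then show ?thesis by (simp add: 3(6))
        qed
        then have "?f = (\<lambda>n. 0)" by auto
        then show ?thesis using zero by simp
      next
        case True
        define L where "L = Max {l. l < p \<and> \<beta> l \<le> q}"
        have fin: "finite {l. l < p \<and> \<beta> l \<le> q}" by simp
        have L: "L < p" "\<beta> L \<le> q"
          using Max_in[OF fin] True unfolding L_def by auto
        have "2 * f n = g L n" if n: "n \<in> S" for n
        proof -
          have "g l n = 0" if l: "l < p" "l \<noteq> L" for l
          proof (rule ccontr)
            assume "g l n \<noteq> 0"
            then have gl: "\<beta> l \<le> n" "n < \<beta> (Suc l)" using 3(5) l by auto
            then have "\<beta> l \<le> q" using S n l by auto
            then have "l \<le> L" unfolding L_def using l fin by auto
            then have "\<beta> (Suc l) \<le> \<beta> L" using monoD[OF 3(3), of "Suc l" L] l by simp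
            then show False using gl L S n by force
          qed
          then have "(\<Sum>l<p. g l n) = (\<Sum>l\<in>{L}. g l n)"
            using L by (intro sum.mono_neutral_right) auto
          then show ?thesis by (simp add: 3(6))
        qed
        then have "?f = (\<lambda>n. if n \<in> S \<and> q \<le> n then g L n else 0)" using S by force
        then show ?thesis using norming_restrict[of r "\<beta> L" "g L" q S] 3(4) L by simp
      qed
    qed auto
  qed
qed

text \<open>Moduli suffice, since the norm depends only on the moduli of the coordinates and norming
  functionals are nonnegative.\<close>

definition pair :: "(nat \<Rightarrow> real) \<Rightarrow> 'k::real_normed_vector c00 \<Rightarrow> real" where
  "pair f x = (\<Sum>n | coord x n \<noteq> 0. f n * norm (coord x n))"

lemma pair_eq:
  assumes "finite A" "{n. coord x n \<noteq> 0} \<subseteq> A"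
  shows "pair f x = (\<Sum>n\<in>A. f n * norm (coord x n))"
  unfolding pair_def using assms by (intro sum.mono_neutral_left) auto

lemma pair_proj: "pair f (proj S x) = (\<Sum>n | coord x n \<noteq> 0. if n \<in> S then f n * norm (coord x n) else 0)"
  by (subst pair_eq[of "{n. coord x n \<noteq> 0}"]) (auto simp: finite_supp intro!: sum.cong split: if_splits)

lemma pair_blocks:
  assumes P: "finite P" "p \<in> P" and x: "\<And>n. coord x n \<noteq> 0 \<Longrightarrow> p \<le> n"
  shows "pair f x = (\<Sum>a\<in>P. pair f (proj (block P a) x))"
proof -
  have "(\<Sum>a\<in>P. if n \<in> block P a then f n * norm (coord x n) else 0) = f n * norm (coord x n)"
    if n: "coord x n \<noteq> 0" for n
  proof -
    obtain a where a: "a \<in> P" "n \<in> block P a" using ex_block[OF P x[OF n]] by blast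
    have "(\<Sum>a\<in>P. if n \<in> block P a then f n * norm (coord x n) else 0) =
      (\<Sum>a\<in>{a}. if n \<in> block P a then f n * norm (coord x n) else 0)"
      using a P(1) disjoint_block[OF a(1)] a(2) by (intro sum.mono_neutral_right) auto
    then show ?thesis using a by simp
  qed
  then show ?thesis unfolding pair_proj by (subst sum.swap) (simp add: pair_def)
qed

text \<open>
  At a node that starts at \<open>b\<close>, the branches of all \<open>N\<close> functionals cut \<open>[\<kappa>b, \<infinity>)\<close> into
  intervals; an interval that starts at \<open>q\<close> is cut once more at \<open>\<kappa>q\<close>. This makes at most \<open>\<kappa>b\<close> pieces,
  which form an admissible family. On a first piece \<open>[q, \<kappa>q)\<close> the norm is equivalent to that of
  \<open>\<ell>\<^sub>1\<close>, and the other pieces are covered by the induction hypothesis.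
\<close>

lemma sum_pair_norming_le:
  fixes f :: "nat \<Rightarrow> nat \<Rightarrow> real" and x :: "'k::real_normed_vector c00" and N :: nat
  defines "\<kappa> \<equiv> 4 * N + 4"
  assumes "\<kappa> \<le> b" "\<And>c. c < N \<Longrightarrow> norming r b (f c)"
    and "\<And>n c d. c < N \<Longrightarrow> d < N \<Longrightarrow> f c n \<noteq> 0 \<Longrightarrow> f d n \<noteq> 0 \<Longrightarrow> c = d"
    and "\<And>n. coord x n \<noteq> 0 \<Longrightarrow> \<kappa> * b \<le> n"
  shows "(\<Sum>c<N. pair (f c) x) \<le> 8 * norm x"
  using assms(2-)
proof (induction r arbitrary: b f x)
  case 0
  then show ?case by (simp add: pair_def)
next
  case (Suc r)
  define good where "good c B \<longleftrightarrow> finite B \<and> card B \<le> Suc b \<and>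
    (\<forall>q S. (\<forall>n\<in>S. q < n \<and> (\<forall>i\<in>B. i \<le> n \<longrightarrow> i \<le> q)) \<longrightarrow>
       norming r q (\<lambda>n. if n \<in> S then 2 * f c n else 0))" for c B
  have "\<exists>B. good c B" if "c < N" for c
    using norming_split[OF Suc.prems(2)[OF that]] unfolding good_def .
  then obtain B where good: "\<And>c. c < N \<Longrightarrow> good c (B c)" by metis
  have B: "\<And>c. c < N \<Longrightarrow> finite (B c)" "\<And>c. c < N \<Longrightarrow> card (B c) \<le> Suc b"
    "\<And>c q S. c < N \<Longrightarrow> (\<And>n. n \<in> S \<Longrightarrow> q < n \<and> (\<forall>i\<in>B c. i \<le> n \<longrightarrow> i \<le> q)) \<Longrightarrow>
       norming r q (\<lambda>n. if n \<in> S then 2 * f c n else 0)"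
    using good unfolding good_def by blast+
  define P where "P = insert (\<kappa> * b) {i \<in> \<Union>(B ` {..<N}). \<kappa> * b < i}"
  define Q where "Q = P \<union> (*) \<kappa> ` P"
  have \<kappa>: "\<kappa> \<ge> 4" and b: "b > 0" using Suc.prems(1) by (auto simp: \<kappa>_def)
  have finU: "finite (\<Union>(B ` {..<N}))" using B(1) by auto
  then have finP: "finite P" by (simp add: P_def)
  then have finQ: "finite Q" by (simp add: Q_def)
  have P_ge: "\<kappa> * b \<le> q" if "q \<in> P" for q using that by (auto simp: P_def)
  have Q_ge: "\<kappa> * b \<le> q" if q: "q \<in> Q" for q
  proof -
    have "\<kappa> * b \<le> \<kappa> * p" if "p \<in> P" for p
    proof -
      have "p \<le> \<kappa> * p" using \<kappa> by simp
      then show ?thesis using P_ge[OF that] by linarith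
    qed
    then show ?thesis using q P_ge unfolding Q_def by blast
  qed
  have inP: "\<kappa> * b \<in> P" and inQ: "\<kappa> * b \<in> Q" by (auto simp: P_def Q_def)
  have minQ: "Min Q = \<kappa> * b" by (rule Min_eqI[OF finQ Q_ge inQ])
  have "card P \<le> Suc (N * Suc b)"
  proof -
    have "card P \<le> Suc (card {i \<in> \<Union>(B ` {..<N}). \<kappa> * b < i})"
      using finU by (simp add: P_def card_insert_if)
    also have "card {i \<in> \<Union>(B ` {..<N}). \<kappa> * b < i} \<le> card (\<Union>(B ` {..<N}))"
      by (rule card_mono[OF finU]) blast
    also have "card (\<Union>(B ` {..<N})) \<le> (\<Sum>c<N. card (B c))" by (rule card_UN_le) simp
    also have "\<dots> \<le> (\<Sum>c<N. Suc b)" by (rule sum_mono) (use B(2) in auto)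
    finally show ?thesis by simp
  qed
  moreover have "card Q \<le> card P + card P"
    unfolding Q_def by (rule order_trans[OF card_Un_le]) (use card_image_le[OF finP] in simp)
  ultimately have "card Q \<le> 2 + 2 * N * b + 2 * N" by simp
  also have "\<dots> \<le> \<kappa> * b"
  proof -
    have "N \<le> N * b" "1 \<le> b" using b by simp_all
    moreover have "\<kappa> * b = 4 * (N * b) + 4 * b" by (simp add: \<kappa>_def algebra_simps)
    moreover have "2 * N * b = 2 * (N * b)" by simp
    ultimately show ?thesis by linarith
  qed
  finally have cardQ: "card Q \<le> Suc (Min Q)" using minQ by simp
  \<comment> \<open>The bound 4 closes the induction: summed over the admissible pieces it becomes
    8, and the factor 2 in \<open>f'\<close> below turns the 8 of the induction hypothesis back into
    4.\<close>
  have piece: "(\<Sum>c<N. pair (f c) (proj (block Q a) x)) \<le> 4 * norm (proj (block Q a) x)"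
    if a: "a \<in> Q" for a
  proof -
    let ?x = "proj (block Q a) x"
    define q where "q = Max {q\<in>P. q \<le> a}"
    have fin: "finite {q\<in>P. q \<le> a}" using finP by simp
    have "{q\<in>P. q \<le> a} \<noteq> {}" using inP Q_ge[OF a] by auto
    then have q: "q \<in> P" "q \<le> a" using Max_in[OF fin] by (auto simp: q_def)
    have q_max: "p \<le> q" if "p \<in> P" "p \<le> a" for p using that fin by (auto simp: q_def)
    have block: "a \<le> n" "\<And>p. p \<in> Q \<Longrightarrow> p \<le> n \<Longrightarrow> p \<le> a" if "n \<in> block Q a" for n
      using that by (auto simp: block_def)
    have "\<kappa> \<le> \<kappa> * b" using b by simp
    then have \<kappa>q: "\<kappa> \<le> q" and q0: "q > 0" using P_ge[OF q(1)] \<kappa> by linarith+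
    show ?thesis
    proof (cases "a < \<kappa> * q")
      case True
      have sub: "q \<le> n \<and> n < \<kappa> * q" if n: "n \<in> block Q a" for n
      proof -
        have "\<kappa> * q \<in> Q" unfolding Q_def using q by blast
        then have "\<not> \<kappa> * q \<le> n" using block(2)[OF n, of "\<kappa> * q"] True by linarith
        then show ?thesis using block(1)[OF n] q by linarith
      qed
      have le1: "(\<Sum>c<N. f c n) \<le> 1" for n
      proof (cases "\<exists>c<N. f c n \<noteq> 0")
        case True
        then obtain c where c: "c < N" "f c n \<noteq> 0" by blast
        have "(\<Sum>c<N. f c n) = (\<Sum>c\<in>{c}. f c n)"
          using c Suc.prems(3) by (intro sum.mono_neutral_right) auto
        then show ?thesis using norming_bounds[OF Suc.prems(2)[OF c(1)], of n] by simp
      next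
        case False
        then have "(\<Sum>c<N. f c n) = 0" by (intro sum.neutral) auto
        then show ?thesis by simp
      qed
      have "(\<Sum>c<N. pair (f c) ?x) = (\<Sum>c<N. \<Sum>n\<in>{q..<\<kappa>*q}. f c n * norm (coord ?x n))"
        using sub by (intro sum.cong refl pair_eq) (auto split: if_splits)
      also have "\<dots> = (\<Sum>n\<in>{q..<\<kappa>*q}. (\<Sum>c<N. f c n) * norm (coord ?x n))"
        by (subst sum.swap) (simp add: sum_distrib_right)
      also have "\<dots> \<le> (\<Sum>n\<in>{q..<\<kappa>*q}. 1 * norm (coord ?x n))"
        by (intro sum_mono mult_right_mono le1) simp
      also have "\<dots> \<le> 4 * norm ?x"
        using sum_norm_coord_le_interval[OF \<kappa>q q0, of ?x] by simp
      finally show ?thesis .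
    next
      case False
      define f' where "f' c = (\<lambda>n. if n \<in> block Q a then 2 * f c n else 0)" for c
      have "(\<Sum>c<N. pair (f' c) ?x) \<le> 8 * norm ?x"
      proof (rule Suc.IH[OF \<kappa>q])
        fix c assume c: "c < N"
        show "norming r q (f' c)" unfolding f'_def
        proof (rule B(3)[OF c], intro conjI ballI impI)
          fix n assume n: "n \<in> block Q a"
          have "q < \<kappa> * q" using \<kappa> q0 by simp
          then show "q < n" using False block(1)[OF n] by linarith
          fix i assume i: "i \<in> B c" "i \<le> n"
          \<comment> \<open>A branch start beyond \<open>\<kappa> * b\<close> is a cut in
            \<open>P\<close>, so it cannot separate \<open>q\<close> from a point of this piece. The
            remaining starts are at most \<open>\<kappa> * b\<close>, hence at most
            \<open>q\<close>.\<close>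
          show "i \<le> q"
          proof (cases "\<kappa> * b < i")
            case True
            have "i \<in> \<Union>(B ` {..<N})" using i c by blast
            with True have iP: "i \<in> P" unfolding P_def by blast
            then have "i \<in> Q" unfolding Q_def by blast
            then show ?thesis by (intro q_max[OF iP] block(2)[OF n] i)
          qed (use P_ge[OF q(1)] in simp)
        qed
      next
        show "c = d" if "c < N" "d < N" "f' c n \<noteq> 0" "f' d n \<noteq> 0" for n c d
          using that Suc.prems(3)[of c d n] by (auto simp: f'_def split: if_splits)
        show "\<kappa> * q \<le> n" if "coord ?x n \<noteq> 0" for n
          using that block(1)[of n] False by (auto split: if_splits)
      qed
      moreover have "pair (f' c) ?x = 2 * pair (f c) ?x" for c
        unfolding pair_def sum_distrib_left by (intro sum.cong) (auto simp: f'_def split: if_splits)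
      ultimately show ?thesis by (simp add: sum_distrib_left[symmetric])
    qed
  qed
  have "(\<Sum>c<N. pair (f c) x) = (\<Sum>c<N. \<Sum>a\<in>Q. pair (f c) (proj (block Q a) x))"
    by (intro sum.cong refl pair_blocks[OF finQ inQ Suc.prems(4)])
  also have "\<dots> = (\<Sum>a\<in>Q. \<Sum>c<N. pair (f c) (proj (block Q a) x))" by (rule sum.swap)
  also have "\<dots> \<le> (\<Sum>a\<in>Q. 4 * norm (proj (block Q a) x))" by (rule sum_mono[OF piece])
  also have "\<dots> \<le> 8 * norm x"
    using sum_norm_block_le[OF finQ _ cardQ, of x] inQ by (auto simp: sum_distrib_left[symmetric])
  finally show ?case .
qed

text \<open>Depth \<open>Suc r\<close> belongs to \<open>tnorm r\<close>, because a unit functional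
  already has depth 1. The slack \<open>\<eta>\<close> avoids proving that the suprema are attained;
  at a node it is shared among the branches.\<close>

lemma tnorm_le_pair:
  fixes x :: "'k::real_normed_vector c00"
  assumes "\<eta> > 0"
  shows "\<exists>b f. norming (Suc r) b f \<and> (\<forall>n. f n \<noteq> 0 \<longrightarrow> coord x n \<noteq> 0) \<and> tnorm r x \<le> pair f x + \<eta>"
  using assms
proof (induction r arbitrary: x \<eta>)
  case 0
  have "\<exists>n. tnorm 0 x - \<eta> < norm (coord x n)"
    unfolding tnorm.simps using less_cSUP_iff[OF _ bdd_coord, of "(SUP n. norm (coord x n)) - \<eta>" x] 0 by auto
  then obtain n where n: "tnorm 0 x - \<eta> < norm (coord x n)" by blast
  show ?case
  proof (cases "coord x n = 0")
    case True
    then show ?thesis using n by (intro exI[of _ 0] exI[of _ "\<lambda>_. 0"]) (auto simp: pair_def)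
  next
    case False
    have "pair (\<lambda>k. of_bool (k = n)) x = (\<Sum>k\<in>{n}. norm (coord x k))"
      unfolding pair_def using False
      by (intro sum.mono_neutral_cong_right) (auto simp: finite_supp)
    then show ?thesis using n False
      by (intro exI[of _ n] exI[of _ "\<lambda>k. of_bool (k = n)"]) auto
  qed
next
  case (Suc r)
  show ?case
  proof (cases "tnorm (Suc r) x = tnorm r x")
    case True
    obtain b f where "norming (Suc r) b f" "\<forall>n. f n \<noteq> 0 \<longrightarrow> coord x n \<noteq> 0" "tnorm r x \<le> pair f x + \<eta>"
      using Suc.IH[OF Suc.prems] by blast
    then show ?thesis using norming_Suc[of "Suc r" b f] unfolding True by blast
  next
    case False
    let ?S = "SUP Es \<in> Collect admissible. \<Sum>E\<leftarrow>Es. tnorm r (proj E x)"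
    have S: "tnorm (Suc r) x = 1/2 * ?S" using False unfolding tnorm.simps(2) max_def by presburger
    have "\<exists>Es\<in>Collect admissible. ?S - \<eta> < (\<Sum>E\<leftarrow>Es. tnorm r (proj E x))"
      using less_cSUP_iff[OF _ bdd_tnorm_sum, of "?S - \<eta>" r x] admissible_singleton Suc.prems by auto
    then obtain Es where Es: "admissible Es" "?S - \<eta> < (\<Sum>E\<leftarrow>Es. tnorm r (proj E x))" by auto
    define p where "p = length Es"
    have p: "p > 0" using Es by (auto simp: p_def admissible_def)
    have fin: "finite (Es ! l)" "Es ! l \<noteq> {}" if "l < p" for l
      using that Es(1) by (auto simp: p_def admissible_def)
    have succ: "Max (Es ! l) < Min (Es ! k)" if "l < k" "k < p" for l k
    proof -
      have "sorted_wrt (\<lambda>E F. Max E < Min F) Es" using Es(1) by (simp only: admissible_def)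
      then show ?thesis using that unfolding p_def by (rule sorted_wrt_nth_less)
    qed
    have "\<eta> / real p > 0" using p Suc.prems by simp
    then have "\<forall>l. \<exists>b f. norming (Suc r) b f \<and> (\<forall>n. f n \<noteq> 0 \<longrightarrow> coord (proj (Es ! l) x) n \<noteq> 0) \<and>
      tnorm r (proj (Es ! l) x) \<le> pair f (proj (Es ! l) x) + \<eta> / real p"
      using Suc.IH by blast
    then obtain b g where g: "\<And>l. norming (Suc r) (b l) (g l)"
      "\<And>l n. g l n \<noteq> 0 \<Longrightarrow> coord (proj (Es ! l) x) n \<noteq> 0"
      "\<And>l. tnorm r (proj (Es ! l) x) \<le> pair (g l) (proj (Es ! l) x) + \<eta> / real p"
      by metis
    have g_in: "n \<in> Es ! l" "coord x n \<noteq> 0" if "g l n \<noteq> 0" for l n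
      using g(2)[OF that] by (auto split: if_splits)
    \<comment> \<open>A nonzero \<open>g l\<close> is supported inside \<open>Es ! l\<close> from
      \<open>b l\<close> on, so the maximum stays within the range of that set. For
      \<open>g l = 0\<close> the bound \<open>b l\<close> is arbitrary and may lie too far
      out.\<close>
    define \<beta>0 where "\<beta>0 l = (if g l = (\<lambda>_. 0) then Min (Es ! l) else max (b l) (Min (Es ! l)))" for l
    define \<beta> where "\<beta> l = (if l < p then \<beta>0 l else Suc (Max (Es ! (p - 1))))" for l
    have \<beta>0: "Min (Es ! l) \<le> \<beta>0 l" "\<beta>0 l \<le> Max (Es ! l)" if l: "l < p" for l
    proof -
      show "Min (Es ! l) \<le> \<beta>0 l" by (simp add: \<beta>0_def)
      show "\<beta>0 l \<le> Max (Es ! l)"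
      proof (cases "g l = (\<lambda>_. 0)")
        case True
        then show ?thesis using fin[OF l] by (simp add: \<beta>0_def)
      next
        case False
        then obtain n where n: "g l n \<noteq> 0" by auto
        then have "b l \<le> n" using norming_bounds[OF g(1)] by blast
        moreover have "n \<le> Max (Es ! l)" using g_in[OF n] fin[OF l] by simp
        ultimately show ?thesis using fin[OF l] by (simp add: \<beta>0_def)
      qed
    qed
    have \<beta>_Suc: "Max (Es ! l) < \<beta> (Suc l)" if l: "l < p" for l
    proof (cases "Suc l < p")
      case True
      then show ?thesis using succ[of l "Suc l"] \<beta>0(1)[OF True] by (simp add: \<beta>_def)
    next
      case False
      then have "l = p - 1" using l by simp
      then show ?thesis using False by (simp add: \<beta>_def)
    qed
    have mono: "mono \<beta>"
    proof (rule incseq_SucI)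
      fix l show "\<beta> l \<le> \<beta> (Suc l)"
        using \<beta>_Suc[of l] \<beta>0(2)[of l] by (cases "l < p") (auto simp: \<beta>_def)
    qed
    have supp: "\<beta> l \<le> n \<and> n < \<beta> (Suc l)" if l: "l < p" and n: "g l n \<noteq> 0" for l n
    proof
      have "b l \<le> n" using norming_bounds[OF g(1)] n by blast
      moreover have "Min (Es ! l) \<le> n" "n \<le> Max (Es ! l)" using g_in[OF n] fin[OF l] by auto
      ultimately show "\<beta> l \<le> n" "n < \<beta> (Suc l)"
        using l \<beta>_Suc[OF l] by (auto simp: \<beta>_def \<beta>0_def)
    qed
    have norming_g: "norming (Suc r) (\<beta> l) (g l)" if l: "l < p" for l
    proof (cases "g l = (\<lambda>_. 0)")
      case False
      then have "b l \<le> \<beta> l" using l by (simp add: \<beta>_def \<beta>0_def)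
      then have "norming (Suc r) (\<beta> l) (\<lambda>n. if n \<in> UNIV \<and> \<beta> l \<le> n then g l n else 0)"
        by (rule norming_restrict[OF g(1)])
      moreover have "(\<lambda>n. if n \<in> UNIV \<and> \<beta> l \<le> n then g l n else 0) = g l"
        using supp[OF l] by (intro ext) auto
      ultimately show ?thesis by (simp only:)
    qed simp
    define f where "f = (\<lambda>n. 1/2 * (\<Sum>l<p. g l n))"
    have "p \<le> Suc (Min (hd Es))" using Es(1) by (simp add: admissible_def p_def)
    also have "hd Es = Es ! 0" using p by (simp add: hd_conv_nth p_def)
    finally have "p \<le> Suc (\<beta> 0)" using \<beta>0(1)[OF p] p by (simp add: \<beta>_def)
    then have "norming (Suc (Suc r)) (\<beta> 0) f"
      unfolding norming.simps(2)[of "Suc r"] using mono norming_g supp f_def by blast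
    moreover have "coord x n \<noteq> 0" if "f n \<noteq> 0" for n
    proof -
      have "\<exists>l<p. g l n \<noteq> 0"
      proof (rule ccontr)
        assume "\<not> ?thesis"
        then have "f n = 0" unfolding f_def by (auto intro!: sum.neutral)
        with that show False by simp
      qed
      then show ?thesis using g_in by blast
    qed
    moreover have "tnorm (Suc r) x \<le> pair f x + \<eta>"
    proof -
      have pg: "pair (g l) (proj (Es ! l) x) = pair (g l) x" for l
        unfolding pair_proj unfolding pair_def using g_in by (intro sum.cong) auto
      have "(\<Sum>E\<leftarrow>Es. tnorm r (proj E x)) = (\<Sum>l<p. tnorm r (proj (Es ! l) x))"
        by (simp add: sum_list_sum_nth p_def atLeast0LessThan)
      also have "\<dots> \<le> (\<Sum>l<p. pair (g l) x + \<eta> / real p)"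
        using g(3) unfolding pg by (rule sum_mono)
      also have "\<dots> = (\<Sum>l<p. pair (g l) x) + \<eta>" using p by (simp add: sum.distrib)
      also have "(\<Sum>l<p. pair (g l) x) = 2 * pair f x"
        unfolding pair_def f_def by (subst sum.swap) (simp add: sum_distrib_left sum_distrib_right)
      finally show ?thesis using S Es(2) by linarith
    qed
    ultimately show ?thesis by blast
  qed
qed

text \<open>The colour classes are normed by functionals with disjoint supports, whose joint pairing
  with \<open>z\<close> is bounded by \<open>sum_pair_norming_le\<close>. Only the required distance
  \<open>\<kappa> * \<kappa>\<close> depends on the number of colours, the constant does
  not.\<close>

lemma sum_norm_colour_le:
  fixes z :: "'k::real_normed_vector c00" and N :: nat
  defines "\<kappa> \<equiv> 4 * N + 4"
  assumes z: "\<And>n. coord z n \<noteq> 0 \<Longrightarrow> \<kappa> * \<kappa> \<le> n"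
  shows "(\<Sum>c<N. norm (proj {n. col n = c} z)) \<le> 16 * norm z"
proof (rule LIMSEQ_le_const2)
  show "(\<lambda>r. \<Sum>c<N. tnorm r (proj {n. col n = c} z)) \<longlonglongrightarrow> (\<Sum>c<N. norm (proj {n. col n = c} z))"
    by (intro tendsto_sum tnorm_tendsto)
  have "(\<Sum>c<N. tnorm r (proj {n. col n = c} z)) \<le> 16 * norm z + e" if e: "e > 0" for r e
  proof -
    have "e / (real N + 1) > 0" using e by simp
    then have "\<forall>c. \<exists>b f. norming (Suc r) b f \<and> (\<forall>n. f n \<noteq> 0 \<longrightarrow> coord (proj {n. col n = c} z) n \<noteq> 0) \<and>
      tnorm r (proj {n. col n = c} z) \<le> pair f (proj {n. col n = c} z) + e / (real N + 1)"
      using tnorm_le_pair by blast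
    then obtain b f where f: "\<And>c. norming (Suc r) (b c) (f c)"
      "\<And>c n. f c n \<noteq> 0 \<Longrightarrow> coord (proj {n. col n = c} z) n \<noteq> 0"
      "\<And>c. tnorm r (proj {n. col n = c} z) \<le> pair (f c) (proj {n. col n = c} z) + e / (real N + 1)"
      by metis
    have f_supp: "col n = c" "coord z n \<noteq> 0" if "f c n \<noteq> 0" for c n
      using f(2)[OF that] by (auto split: if_splits)
    obtain M where M: "\<And>n. coord z n \<noteq> 0 \<Longrightarrow> n < M" by (rule supp_bounded) blast
    \<comment> \<open>The bound of a norming functional cannot simply be lowered to
      \<open>\<kappa>\<close>, as its root may have too many branches. A new root with a single
      branch has bound \<open>\<kappa>\<close> while the branch starts later; its factor 1/2 turns 8
      into 16.\<close>
    have "norming (Suc (Suc r)) \<kappa> (\<lambda>n. 1/2 * f c n)" for c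
    proof -
      define \<beta>' where "\<beta>' = max \<kappa> (b c)"
      define \<beta> where "\<beta> l = (case l of 0 \<Rightarrow> \<beta>' | Suc _ \<Rightarrow> max \<beta>' M)" for l
      have f_ge: "\<beta>' \<le> n" if "f c n \<noteq> 0" for n
      proof -
        have "\<kappa> \<le> \<kappa> * \<kappa>" unfolding \<kappa>_def by simp
        then have "\<kappa> \<le> n" using z[OF f_supp(2)[OF that]] by linarith
        then show ?thesis using norming_bounds[OF f(1)[of c], of n] that by (auto simp: \<beta>'_def)
      qed
      have "norming (Suc r) \<beta>' (\<lambda>n. if n \<in> UNIV \<and> \<beta>' \<le> n then f c n else 0)"
        by (rule norming_restrict[OF f(1)]) (simp add: \<beta>'_def)
      moreover have "(\<lambda>n. if n \<in> UNIV \<and> \<beta>' \<le> n then f c n else 0) = f c"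
        using f_ge by (intro ext) auto
      ultimately have nf: "norming (Suc r) \<beta>' (f c)" by (simp only:)
      have "mono \<beta>" by (rule incseq_SucI) (simp add: \<beta>_def split: nat.split)
      moreover have "\<forall>l<1. norming (Suc r) (\<beta> l) (f c) \<and> (\<forall>n. f c n \<noteq> 0 \<longrightarrow> \<beta> l \<le> n \<and> n < \<beta> (Suc l))"
      proof (intro allI impI conjI)
        fix l :: nat assume "l < 1"
        then have l: "\<beta> l = \<beta>'" "\<beta> (Suc l) = max \<beta>' M" by (simp_all add: \<beta>_def)
        show "norming (Suc r) (\<beta> l) (f c)" using nf by (simp only: l)
        fix n assume n: "f c n \<noteq> 0"
        show "\<beta> l \<le> n" using f_ge[OF n] by (simp only: l)
        show "n < \<beta> (Suc l)" using M[OF f_supp(2)[OF n]] by (simp only: l less_max_iff_disj simp_thms)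
      qed
      moreover have "(\<lambda>n. 1/2 * f c n) = (\<lambda>n. 1/2 * (\<Sum>l<(1::nat). f c n))" by simp
      moreover have "1 \<le> Suc \<kappa>" "\<kappa> \<le> \<beta> 0" by (auto simp: \<beta>_def \<beta>'_def)
      ultimately show ?thesis
        unfolding norming.simps(2)[of "Suc r"]
        by (intro disjI2 exI[of _ 1] exI[of _ \<beta>] exI[of _ "\<lambda>_. f c"] conjI)
    qed
    then have "(\<Sum>c<N. pair (\<lambda>n. 1/2 * f c n) z) \<le> 8 * norm z"
    proof (intro sum_pair_norming_le[where b = \<kappa> and r = "Suc (Suc r)"])
      show "c = d" if "1/2 * f c n \<noteq> 0" "1/2 * f d n \<noteq> 0" for n c d
        using f_supp(1)[of c n] f_supp(1)[of d n] that by simp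
    qed (use z in \<open>simp_all only: \<kappa>_def order_refl\<close>)
    moreover have "pair (\<lambda>n. 1/2 * f c n) z = 1/2 * pair (f c) z" for c
      by (simp only: pair_def sum_distrib_left mult.assoc)
    ultimately have "1/2 * (\<Sum>c<N. pair (f c) z) \<le> 8 * norm z"
      by (simp only: sum_distrib_left)
    then have "(\<Sum>c<N. pair (f c) z) \<le> 16 * norm z" by linarith
    moreover have "(\<Sum>c<N. tnorm r (proj {n. col n = c} z)) \<le> (\<Sum>c<N. pair (f c) z + e / (real N + 1))"
    proof (rule sum_mono)
      fix c
      have "pair (f c) (proj {n. col n = c} z) = pair (f c) z"
        unfolding pair_proj unfolding pair_def using f_supp by (intro sum.cong) auto
      then show "tnorm r (proj {n. col n = c} z) \<le> pair (f c) z + e / (real N + 1)"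
        using f(3)[of c] by simp
    qed
    moreover have "(\<Sum>c<N. pair (f c) z + e / (real N + 1)) \<le> (\<Sum>c<N. pair (f c) z) + e"
    proof -
      have "real N * (e / (real N + 1)) \<le> e" using e by (simp add: field_simps)
      then show ?thesis by (simp add: sum.distrib)
    qed
    ultimately show ?thesis by linarith
  qed
  then show "\<exists>r0. \<forall>r\<ge>r0. (\<Sum>c<N. tnorm r (proj {n. col n = c} z)) \<le> 16 * norm z"
    using field_le_epsilon by blast
qed


section \<open>Averages over signs, and the Euclidean norm\<close>

definition signs :: "nat set \<Rightarrow> nat \<Rightarrow> real" where
  "signs A i = (if i \<in> A then 1 else - 1)"

lemma abs_signs [simp]: "\<bar>signs A i\<bar> = 1"
  by (simp add: signs_def)

lemma sum_Pow_Suc: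
  "(\<Sum>A\<in>Pow {..<Suc J}. h A) = (\<Sum>A\<in>Pow {..<J}. h A + h (insert J A))"
proof -
  have "Pow {..<Suc J} = Pow {..<J} \<union> insert J ` Pow {..<J}"
    by (simp only: lessThan_Suc Pow_insert)
  moreover have "Pow {..<J} \<inter> insert J ` Pow {..<J} = {}" by auto
  moreover have "inj_on (insert J) (Pow {..<J})"
    by (rule inj_onI) (metis Diff_insert_absorb PowD lessThan_iff less_irrefl subsetD)
  ultimately show ?thesis
    by (simp add: sum.union_disjoint sum.reindex sum.distrib)
qed

lemma sum_signs_Suc:
  fixes a :: "nat \<Rightarrow> 'a::real_vector"
  assumes "A \<in> Pow {..<J}"
  shows "(\<Sum>i<Suc J. signs A i *\<^sub>R a i) = (\<Sum>i<J. signs A i *\<^sub>R a i) - a J"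
    and "(\<Sum>i<Suc J. signs (insert J A) i *\<^sub>R a i) = (\<Sum>i<J. signs A i *\<^sub>R a i) + a J"
  using assms by (auto simp: signs_def intro!: sum.cong)

text \<open>Adding the two values of the last sign removes the odd terms. Inner product spaces are
  used so that complex scalars are covered.\<close>

lemma sum_signs_moments:
  fixes a :: "nat \<Rightarrow> 'a::real_inner"
  shows "(\<Sum>A\<in>Pow {..<J}. (norm (\<Sum>i<J. signs A i *\<^sub>R a i))\<^sup>2) = 2 ^ J * (\<Sum>i<J. (norm (a i))\<^sup>2)"
    and "(\<Sum>A\<in>Pow {..<J}. (norm (\<Sum>i<J. signs A i *\<^sub>R a i))^4) \<le> 3 * 2 ^ J * (\<Sum>i<J. (norm (a i))\<^sup>2)\<^sup>2"
proof (induction J)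
  case 0
  { case 1 show ?case by simp next case 2 show ?case by simp }
next
  case (Suc J)
  let ?g = "\<lambda>A. \<Sum>i<J. signs A i *\<^sub>R a i" and ?s = "\<Sum>i<J. (norm (a i))\<^sup>2"
  { case 1
    have "(\<Sum>A\<in>Pow {..<Suc J}. (norm (\<Sum>i<Suc J. signs A i *\<^sub>R a i))\<^sup>2)
      = (\<Sum>A\<in>Pow {..<J}. (norm (?g A - a J))\<^sup>2 + (norm (?g A + a J))\<^sup>2)"
      unfolding sum_Pow_Suc by (intro sum.cong refl) (simp only: sum_signs_Suc)
    also have "\<dots> = (\<Sum>A\<in>Pow {..<J}. 2 * (norm (?g A))\<^sup>2 + 2 * (norm (a J))\<^sup>2)"
      by (intro sum.cong refl) (simp add: power2_norm_eq_inner inner_simps inner_commute)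
    also have "\<dots> = 2 ^ Suc J * (\<Sum>i<Suc J. (norm (a i))\<^sup>2)"
      by (simp add: sum.distrib sum_distrib_left[symmetric] Suc.IH(1) card_Pow algebra_simps)
    finally show ?case .
  next
    case 2
    \<comment> \<open>With \<open>P\<close> and \<open>Q\<close> the squared norms and
      \<open>I\<close> the inner product, the mixed terms are
      \<open>4 * P * Q + 8 * I\<^sup>2\<close>, at most \<open>12 * P * Q\<close> by
      Cauchy-Schwarz.\<close>
    have "(norm (g - h))^4 + (norm (g + h))^4 \<le> 2 * (norm g)^4 + 12 * (norm g)\<^sup>2 * (norm h)\<^sup>2 + 2 * (norm h)^4"
      for g h :: 'a
    proof -
      have "(norm (g + h))\<^sup>2 = (norm g)\<^sup>2 + (norm h)\<^sup>2 + 2 * (g \<bullet> h)"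
        "(norm (g - h))\<^sup>2 = (norm g)\<^sup>2 + (norm h)\<^sup>2 - 2 * (g \<bullet> h)"
        by (simp_all add: power2_norm_eq_inner inner_simps inner_commute)
      moreover have "(g \<bullet> h)\<^sup>2 \<le> (norm g)\<^sup>2 * (norm h)\<^sup>2"
        using Cauchy_Schwarz_ineq[of g h] by (simp add: power2_norm_eq_inner)
      moreover have t4: "t^4 = (t\<^sup>2)\<^sup>2" for t :: real by simp
      moreover have "(P + Q - 2 * I)\<^sup>2 + (P + Q + 2 * I)\<^sup>2 = 2 * P\<^sup>2 + 4 * P * Q + 2 * Q\<^sup>2 + 8 * I\<^sup>2" for P Q I :: real
        by (simp add: power2_eq_square algebra_simps)
      ultimately show ?thesis unfolding t4 by simp
    qed
    note four = this
    have "(\<Sum>A\<in>Pow {..<Suc J}. (norm (\<Sum>i<Suc J. signs A i *\<^sub>R a i))^4)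
      = (\<Sum>A\<in>Pow {..<J}. (norm (?g A - a J))^4 + (norm (?g A + a J))^4)"
      unfolding sum_Pow_Suc by (intro sum.cong refl) (simp only: sum_signs_Suc)
    also have "\<dots> \<le> (\<Sum>A\<in>Pow {..<J}. 2 * (norm (?g A))^4 + 12 * (norm (?g A))\<^sup>2 * (norm (a J))\<^sup>2 + 2 * (norm (a J))^4)"
      by (intro sum_mono four)
    also have "\<dots> = 2 * (\<Sum>A\<in>Pow {..<J}. (norm (?g A))^4)
      + 12 * (norm (a J))\<^sup>2 * (\<Sum>A\<in>Pow {..<J}. (norm (?g A))\<^sup>2) + 2 ^ J * (2 * (norm (a J))^4)"
      by (simp add: sum.distrib sum_distrib_left card_Pow mult_ac)
    also have "\<dots> \<le> 2 * (3 * 2 ^ J * ?s\<^sup>2) + 12 * (norm (a J))\<^sup>2 * (2 ^ J * ?s) + 2 ^ J * (2 * (norm (a J))^4)"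
      unfolding Suc.IH(1) using Suc.IH(2) by (intro add_mono mult_left_mono order_refl) auto
    also have "\<dots> \<le> 3 * 2 ^ Suc J * (?s + (norm (a J))\<^sup>2)\<^sup>2"
    proof -
      have "(norm (a J))^4 = ((norm (a J))\<^sup>2)\<^sup>2" by simp
      then have "3 * 2 ^ Suc J * (?s + (norm (a J))\<^sup>2)\<^sup>2 =
        2 * (3 * 2 ^ J * ?s\<^sup>2) + 12 * (norm (a J))\<^sup>2 * (2 ^ J * ?s) + 2 ^ J * (6 * (norm (a J))^4)"
        by (simp add: power2_eq_square algebra_simps)
      moreover have "2 ^ J * (2 * (norm (a J))^4) \<le> 2 ^ J * (6 * (norm (a J))^4)"
        by (intro mult_left_mono) auto
      ultimately show ?thesis by linarith
    qed
    finally show ?case by simp }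
qed

text \<open>
  From the second and the fourth moment, by \<open>t\<^sup>2 - t\<^sup>4 / 4 \<le> t\<close>.
\<close>

lemma khinchin:
  fixes a :: "nat \<Rightarrow> 'a::real_inner"
  shows "2 ^ J * sqrt (\<Sum>i<J. (norm (a i))\<^sup>2) \<le> 4 * (\<Sum>A\<in>Pow {..<J}. norm (\<Sum>i<J. signs A i *\<^sub>R a i))"
proof -
  define s where "s = sqrt (\<Sum>i<J. (norm (a i))\<^sup>2)"
  let ?g = "\<lambda>A. norm (\<Sum>i<J. signs A i *\<^sub>R a i)"
  have s2: "s\<^sup>2 = (\<Sum>i<J. (norm (a i))\<^sup>2)" by (simp add: s_def sum_nonneg)
  have elem: "t\<^sup>2 - t^4 / 4 \<le> t" if "t \<ge> 0" for t :: real
  proof -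
    \<comment> \<open>For \<open>t > 0\<close> the claim is
      \<open>t * t * t - 4 * t + 4 \<ge> 0\<close>, with the minimum of the left side at
      \<open>2 / sqrt 3\<close>. The cubic with a double zero at the nearby point 6/5 is a lower
      bound for 125 times it.\<close>
    have "0 \<le> (5 * t - 6)\<^sup>2 * (5 * t + 12)" using that by simp
    also have "\<dots> = 125 * (t * t * t) - 540 * t + 432"
      by (simp add: power2_eq_square algebra_simps)
    finally have "0 \<le> t * t * t - 4 * t + 4" using that by linarith
    then have "0 \<le> t * (t * t * t - 4 * t + 4)" using that by simp
    then show ?thesis by (simp add: power2_eq_square power4_eq_xxxx algebra_simps)
  qed
  show ?thesis
  proof (cases "s = 0")
    case True
    then show ?thesis unfolding s_def[symmetric] by (simp add: sum_nonneg)
  next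
    case False
    then have s: "s > 0" by (simp add: s_def sum_nonneg order.strict_iff_order)
    \<comment> \<open>After normalisation the second moment is 1 and the fourth at most 3, which
      leaves \<open>1 - 3/4 = 1/4\<close>; hence the constant 4.\<close>
    have "2 ^ J / 4 \<le> (\<Sum>A\<in>Pow {..<J}. (?g A / s)\<^sup>2 - (?g A / s)^4 / 4)"
    proof -
      have 1: "(\<Sum>A\<in>Pow {..<J}. (?g A / s)\<^sup>2) = 2 ^ J"
        using s sum_signs_moments(1)[where a = a and J = J]
        by (simp add: power_divide sum_divide_distrib[symmetric] s2[symmetric])
      have "(\<Sum>A\<in>Pow {..<J}. (?g A / s)^4) = (\<Sum>A\<in>Pow {..<J}. ?g A^4) / s^4"
        by (simp add: power_divide sum_divide_distrib[symmetric])
      also have "\<dots> \<le> (3 * 2 ^ J * (s\<^sup>2)\<^sup>2) / s^4"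
        using sum_signs_moments(2)[where a = a and J = J] unfolding s2 by (intro divide_right_mono) auto
      also have "\<dots> = 3 * 2 ^ J" using s by simp
      finally have 2: "(\<Sum>A\<in>Pow {..<J}. (?g A / s)^4) \<le> 3 * 2 ^ J" .
      have "(\<Sum>A\<in>Pow {..<J}. (?g A / s)\<^sup>2 - (?g A / s)^4 / 4) =
        2 ^ J - (\<Sum>A\<in>Pow {..<J}. (?g A / s)^4) / 4"
        by (simp only: sum_subtractf 1 sum_divide_distrib[symmetric])
      then show ?thesis using 2 by linarith
    qed
    also have "\<dots> \<le> (\<Sum>A\<in>Pow {..<J}. ?g A / s)"
      by (intro sum_mono elem) (use s in simp)
    also have "\<dots> = (\<Sum>A\<in>Pow {..<J}. ?g A) / s" by (simp add: sum_divide_distrib)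
    finally show ?thesis using s unfolding s_def[symmetric] by (simp add: field_simps)
  qed
qed

text \<open>From weak \<open>\<ell>\<^sub>1\<close> to \<open>\<ell>\<^sub>2\<close>: the
  \<open>n\<close>-th largest value is at most \<open>R / n\<close>, and the sum of
  \<open>1 / j\<^sup>2\<close> up to \<open>n\<close> is at most \<open>2 - 1 / n\<close>. Removing
  a minimal value in each step avoids sorting.\<close>

lemma sum_squares_le:
  fixes t :: "'a \<Rightarrow> real"
  assumes "finite A" and "\<And>i. i \<in> A \<Longrightarrow> t i \<ge> 0"
    and "\<And>B l. B \<subseteq> A \<Longrightarrow> (\<And>i. i \<in> B \<Longrightarrow> l \<le> t i) \<Longrightarrow> real (card B) * l \<le> R"
  shows "(\<Sum>i\<in>A. (t i)\<^sup>2) \<le> 2 * R\<^sup>2"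
proof -
  have "A = {} \<or> (\<Sum>i\<in>A. (t i)\<^sup>2) \<le> R\<^sup>2 * (2 - 1 / real (card A))"
    using assms
  proof (induction "card A" arbitrary: A)
    case (Suc n)
    then have "A \<noteq> {}" by auto
    then have "Min (t ` A) \<in> t ` A" using Suc.prems(1) by (intro Min_in) auto
    then obtain i where i: "i \<in> A" "t i = Min (t ` A)" by auto
    then have min: "t i \<le> t j" if "j \<in> A" for j using Suc.prems(1) that by auto
    have ti: "real (Suc n) * t i \<le> R" using Suc.prems(3)[of A "t i"] min Suc.hyps(2) by simp
    have "0 \<le> t i" using Suc.prems(2) i by blast
    then have "(real (Suc n) * t i)\<^sup>2 \<le> R\<^sup>2" by (intro power_mono ti) auto
    then have sq: "(t i)\<^sup>2 \<le> R\<^sup>2 / (real (Suc n))\<^sup>2"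
      unfolding power_mult_distrib by (simp add: pos_le_divide_eq mult.commute)
    have card: "card (A - {i}) = n" using i Suc.hyps(2) by simp
    have split: "(\<Sum>i\<in>A. (t i)\<^sup>2) = (t i)\<^sup>2 + (\<Sum>i\<in>A - {i}. (t i)\<^sup>2)"
      using i Suc.prems(1) by (simp add: sum.remove)
    show ?case
    proof (cases "A - {i} = {}")
      case True
      have "n = 0" using card unfolding True by simp
      then show ?thesis using split sq by (simp add: True Suc.hyps(2)[symmetric])
    next
      case False
      have "(\<Sum>j\<in>A - {i}. (t j)\<^sup>2) \<le> R\<^sup>2 * (2 - 1 / real (card (A - {i})))"
      proof -
        have "real (card B) * l \<le> R" if "B \<subseteq> A - {i}" "\<And>i. i \<in> B \<Longrightarrow> l \<le> t i" for B l
          using Suc.prems(3)[of B l] that by blast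
        then have "A - {i} = {} \<or> (\<Sum>j\<in>A - {i}. (t j)\<^sup>2) \<le> R\<^sup>2 * (2 - 1 / real (card (A - {i})))"
          using card Suc.prems(1,2) by (intro Suc.hyps(1)) auto
        then show ?thesis using False by blast
      qed
      then have "(\<Sum>i\<in>A. (t i)\<^sup>2) \<le> R\<^sup>2 * (2 - 1 / real n + 1 / (real (Suc n))\<^sup>2)"
        using split sq card by (simp add: algebra_simps)
      also have "\<dots> \<le> R\<^sup>2 * (2 - 1 / real (Suc n))"
      proof (intro mult_left_mono)
        have n: "n > 0" using False card Suc.prems(1) by (metis card_gt_0_iff finite_Diff)
        then have "1 / real n - 1 / real (Suc n) = 1 / (real n * real (Suc n))"
          by (simp add: field_simps)
        moreover have "1 / (real (Suc n))\<^sup>2 \<le> 1 / (real n * real (Suc n))"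
          using n by (intro divide_left_mono) (auto simp: power2_eq_square)
        ultimately show "2 - 1 / real n + 1 / (real (Suc n))\<^sup>2 \<le> 2 - 1 / real (Suc n)" by linarith
      qed simp
      finally show ?thesis using Suc.hyps(2) by simp
    qed
  qed simp
  moreover have "R\<^sup>2 * (2 - 1 / real (card A)) \<le> R\<^sup>2 * 2" by (intro mult_left_mono) auto
  ultimately show ?thesis by auto
qed

text \<open>A finite 1/2-net of the unit sphere. Over the complex numbers exact phases would be
  infinitely many, and finiteness is what bounds the number of test vectors in
  \<open>trace_estimate\<close>.\<close>

lemma ex_finite_phases:
  "\<exists>\<Phi> :: 'k::{real_normed_field, euclidean_space} set. finite \<Phi> \<and> (\<forall>\<phi>\<in>\<Phi>. norm \<phi> = 1) \<and>
     (\<forall>t. \<exists>\<phi>\<in>\<Phi>. norm (\<phi> * t - of_real (norm t)) \<le> 1/2 * norm t)"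
proof -
  have "compact (sphere (0 :: 'k) 1)" by simp
  then obtain \<Phi> where \<Phi>: "finite \<Phi>" "\<Phi> \<subseteq> sphere (0 :: 'k) 1" "sphere 0 1 \<subseteq> (\<Union>\<phi>\<in>\<Phi>. ball \<phi> (1/2))"
    using seq_compact_imp_totally_bounded[OF compact_imp_seq_compact] by (metis half_gt_zero zero_less_one)
  have "\<exists>\<phi>\<in>\<Phi>. norm (\<phi> * t - of_real (norm t)) \<le> 1/2 * norm t" for t
  proof (cases "t = 0")
    case True
    have "(1 :: 'k) \<in> sphere 0 1" by simp
    then have "\<Phi> \<noteq> {}" using \<Phi>(3) by blast
    then show ?thesis using True by auto
  next
    case False
    define \<psi> where "\<psi> = of_real (norm t) / t"
    have "norm \<psi> = 1" using False by (simp add: \<psi>_def norm_divide)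
    then have "\<psi> \<in> sphere 0 1" by simp
    then obtain \<phi> where \<phi>: "\<phi> \<in> \<Phi>" "dist \<phi> \<psi> < 1/2" using \<Phi>(3) by fastforce
    have "\<phi> * t - of_real (norm t) = (\<phi> - \<psi>) * t" using False by (simp add: \<psi>_def algebra_simps)
    then have "norm (\<phi> * t - of_real (norm t)) = dist \<phi> \<psi> * norm t"
      by (simp only: norm_mult dist_norm)
    also have "\<dots> \<le> 1/2 * norm t" using \<phi>(2) by (intro mult_right_mono) auto
    finally have "norm (\<phi> * t - of_real (norm t)) \<le> 1/2 * norm t" .
    then show ?thesis using \<phi>(1) by blast
  qed
  moreover have "norm \<phi> = 1" if "\<phi> \<in> \<Phi>" for \<phi> using that \<Phi>(2) by auto
  ultimately show ?thesis using \<Phi>(1) by blast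
qed

text \<open>With \<open>h\<close> half the number of points, rounded down, at most \<open>h\<close>
  points of \<open>B\<close> lie below \<open>h\<close>, and the others start at \<open>h\<close> or
  later. For odd \<open>card B\<close> the upper half has \<open>h + 1\<close> points, which the
  \<open>Suc\<close> of the index shift just allows.\<close>

lemma ex_upper_half:
  fixes B :: "nat set"
  assumes "finite B"
  shows "\<exists>C\<subseteq>B. card B \<le> 2 * card C \<and> card C \<le> Suc (Min C)"
proof (cases "B = {}")
  case False
  define h where "h = card B div 2"
  have "card B \<le> card (B \<inter> {..<h}) + card (B - {..<h})"
    using card_Un_le[of "B \<inter> {..<h}" "B - {..<h}"] by (simp add: Int_Diff_Un)
  moreover have "card (B \<inter> {..<h}) \<le> h" using card_mono[of "{..<h}" "B \<inter> {..<h}"] by simp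
  ultimately have "card B - h \<le> card (B - {..<h})" by simp
  then obtain C where C: "C \<subseteq> B - {..<h}" "card C = card B - h"
    using obtain_subset_with_card_n by metis
  have fin: "finite C" using C assms finite_subset by blast
  have "card B > 0" using False assms by (simp add: card_gt_0_iff)
  then have "C \<noteq> {}" using C(2) by (auto simp: h_def)
  then have "h \<le> Min C" using C(1) fin by (subst Min_ge_iff) auto
  then show ?thesis using C by (intro exI[of _ C]) (auto simp: h_def)
qed (intro exI[of _ "{}"], simp)

text \<open>
  The norm of \<open>c\<^sub>0\<^sub>0\<close> dominates a weak-\<open>\<ell>\<^sub>1\<close> norm, because the upper half of every finite set is
  admissible, and hence the \<open>\<ell>\<^sub>2\<close> norm.
\<close>

lemma ex_finite_functionals:
  "\<exists>\<Omega> :: (nat \<Rightarrow> 'k::{real_normed_field, euclidean_space}) set. finite \<Omega> \<and>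
     (\<forall>\<omega>\<in>\<Omega>. \<forall>z. norm (\<Sum>i<J. \<omega> i * coord z i) \<le> 2 * norm z) \<and>
     (\<forall>\<tau>. \<exists>\<omega>\<in>\<Omega>. sqrt (\<Sum>i<J. (norm (\<tau> i))\<^sup>2) \<le> 6 * norm (\<Sum>i<J. \<omega> i * \<tau> i))"
proof -
  obtain \<Phi> :: "'k set" where \<Phi>: "finite \<Phi>" "\<And>\<phi>. \<phi> \<in> \<Phi> \<Longrightarrow> norm \<phi> = 1"
    "\<And>t. \<exists>\<phi>\<in>\<Phi>. norm (\<phi> * t - of_real (norm t)) \<le> 1/2 * norm t"
    using ex_finite_phases by blast
  define \<Omega> where "\<Omega> = {\<omega> \<in> {..<J} \<rightarrow>\<^sub>E insert 0 \<Phi>. \<forall>z. norm (\<Sum>i<J. \<omega> i * coord z i) \<le> 2 * norm z}"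
  have fin: "finite \<Omega>" unfolding \<Omega>_def
    by (rule finite_subset[OF _ finite_PiE[of "{..<J}" "\<lambda>_. insert 0 \<Phi>"]]) (use \<Phi>(1) in auto)
  have "(\<lambda>i\<in>{..<J}. 0) \<in> \<Omega>" by (auto simp: \<Omega>_def)
  then have ne: "\<Omega> \<noteq> {}" by blast
  have "\<exists>\<omega>\<in>\<Omega>. sqrt (\<Sum>i<J. (norm (\<tau> i))\<^sup>2) \<le> 6 * norm (\<Sum>i<J. \<omega> i * \<tau> i)" for \<tau>
  proof -
    \<comment> \<open>Every Schreier set with phases from the net is a member of
      \<open>\<Omega>\<close>; so the largest pairing \<open>R\<close> controls the weak
      \<open>\<ell>\<^sub>1\<close> norm of \<open>\<tau>\<close>.\<close>
    define R where "R = Max ((\<lambda>\<omega>. norm (\<Sum>i<J. \<omega> i * \<tau> i)) ` \<Omega>)"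
    have "R \<in> (\<lambda>\<omega>. norm (\<Sum>i<J. \<omega> i * \<tau> i)) ` \<Omega>" unfolding R_def using fin ne by (intro Max_in) auto
    then obtain \<omega> where \<omega>: "\<omega> \<in> \<Omega>" "R = norm (\<Sum>i<J. \<omega> i * \<tau> i)" by blast
    have R: "norm (\<Sum>i<J. \<omega> i * \<tau> i) \<le> R" if "\<omega> \<in> \<Omega>" for \<omega>
      unfolding R_def using fin that by (intro Max_ge) auto
    \<comment> \<open>The 4 is a factor 2 for passing to the upper half and a factor 2 for the
      inexact phases; then \<open>2 * 4\<^sup>2 = 32 \<le> 6\<^sup>2\<close>.\<close>
    have "(\<Sum>i<J. (norm (\<tau> i))\<^sup>2) \<le> 2 * (4 * R)\<^sup>2"
    proof (rule sum_squares_le)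
      fix B l assume B: "B \<subseteq> {..<J}" and l: "\<And>i. i \<in> B \<Longrightarrow> l \<le> norm (\<tau> i)"
      have R0: "R \<ge> 0" using \<omega> by simp
      show "real (card B) * l \<le> 4 * R"
      proof (cases "l \<ge> 0")
        case False
        then show ?thesis using R0 by (smt (verit) mult_nonneg_nonpos of_nat_0_le_iff)
      next
        case True
        have finB: "finite B" using B finite_subset by blast
        obtain C where C: "C \<subseteq> B" "card B \<le> 2 * card C" "card C \<le> Suc (Min C)"
          using ex_upper_half[OF finB] by blast
        have finC: "finite C" using C finB finite_subset by blast
        obtain \<phi> where \<phi>: "\<And>i. \<phi> i \<in> \<Phi>" "\<And>i. norm (\<phi> i * \<tau> i - of_real (norm (\<tau> i))) \<le> 1/2 * norm (\<tau> i)"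
        proof -
          have "\<forall>i. \<exists>p. p \<in> \<Phi> \<and> norm (p * \<tau> i - of_real (norm (\<tau> i))) \<le> 1/2 * norm (\<tau> i)"
            using \<Phi>(3) by blast
          then show thesis using that by metis
        qed
        define \<nu> where "\<nu> = (\<lambda>i\<in>{..<J}. if i \<in> C then \<phi> i else 0)"
        have \<nu>: "(\<Sum>i<J. \<nu> i * y i) = (\<Sum>i\<in>C. \<phi> i * y i)" for y
          using B C(1) by (intro sum.mono_neutral_cong_right) (auto simp: \<nu>_def)
        have "norm (\<Sum>i<J. \<nu> i * coord z i) \<le> 2 * norm z" for z
        proof -
          have "norm (\<Sum>i\<in>C. \<phi> i * coord z i) \<le> (\<Sum>i\<in>C. norm (coord z i))"
            using \<Phi>(2)[OF \<phi>(1)] by (intro sum_norm_le) (simp add: norm_mult)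
          also have "\<dots> \<le> 2 * norm z" by (rule sum_norm_coord_le[OF finC C(3)])
          finally show ?thesis unfolding \<nu> .
        qed
        moreover have "\<nu> \<in> {..<J} \<rightarrow>\<^sub>E insert 0 \<Phi>" using \<phi>(1) by (auto simp: \<nu>_def)
        ultimately have "\<nu> \<in> \<Omega>" by (simp add: \<Omega>_def)
        then have R1: "norm (\<Sum>i\<in>C. \<phi> i * \<tau> i) \<le> R" using R \<nu> by metis
        have "norm ((\<Sum>i\<in>C. \<phi> i * \<tau> i) - of_real (\<Sum>i\<in>C. norm (\<tau> i))) \<le> (\<Sum>i\<in>C. 1/2 * norm (\<tau> i))"
          unfolding of_real_sum sum_subtractf[symmetric] by (intro sum_norm_le \<phi>(2))
        also have "\<dots> = 1/2 * (\<Sum>i\<in>C. norm (\<tau> i))" by (simp only: sum_distrib_left)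
        finally have d: "norm ((\<Sum>i\<in>C. \<phi> i * \<tau> i) - of_real (\<Sum>i\<in>C. norm (\<tau> i))) \<le> 1/2 * (\<Sum>i\<in>C. norm (\<tau> i))" .
        have "norm (of_real (\<Sum>i\<in>C. norm (\<tau> i)) :: 'k) = (\<Sum>i\<in>C. norm (\<tau> i))"
          by (simp only: norm_of_real) (simp add: sum_nonneg)
        then have "(\<Sum>i\<in>C. norm (\<tau> i)) \<le> 2 * R"
          using d R1 norm_triangle_ineq3[of "\<Sum>i\<in>C. \<phi> i * \<tau> i" "of_real (\<Sum>i\<in>C. norm (\<tau> i))"] by linarith
        moreover have "real (card C) * l \<le> (\<Sum>i\<in>C. norm (\<tau> i))"
          using sum_bounded_below[of C l "\<lambda>i. norm (\<tau> i)"] l C(1) by auto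
        moreover have "real (card B) * l \<le> 2 * (real (card C) * l)"
          using mult_right_mono[of "real (card B)" "2 * real (card C)" l] C(2) True by simp
        ultimately show ?thesis by linarith
      qed
    qed auto
    also have "\<dots> \<le> (6 * R)\<^sup>2" by (simp add: power_mult_distrib)
    finally have "sqrt (\<Sum>i<J. (norm (\<tau> i))\<^sup>2) \<le> 6 * R"
      using \<omega>(2) by (intro real_le_lsqrt) auto
    then show ?thesis using \<omega> by blast
  qed
  then show ?thesis using fin unfolding \<Omega>_def by blast
qed


section \<open>Tsirelson's space as the dual of \<open>c\<^sub>0\<^sub>0\<close>\<close>

lemma embed_scale00: "embed (scale00 c x) = scale_dual c (embed x)"
  by (simp add: embed.abs_eq scale_dual.abs_eq same_limit_def convergent_Cauchy convergent_const)

lemma completion_cases: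
  obtains X where "Cauchy X" "A = abs_completion X" "(\<lambda>n. embed (X n)) \<longlonglongrightarrow> A"
proof -
  obtain X where X: "Cauchy X" "A = abs_completion X"
    by (metis Quotient_abs_rep Quotient_completion Quotient_rep_reflp same_limit_refl)
  then show thesis using that embed_approx by blast
qed

lemma tendsto_embed_scale00:
  fixes X :: "nat \<Rightarrow> 'k::real_normed_field c00"
  assumes "Cauchy X"
  shows "(\<lambda>n. embed (scale00 c (X n))) \<longlonglongrightarrow> scale_dual c (abs_completion X)"
proof -
  have lin: "bounded_linear (scale00 c :: 'k c00 \<Rightarrow> _)"
    by (rule bounded_linear_intro[where K = "norm c"])
       (auto intro!: coord_eqI simp: norm_scale00 algebra_simps)
  have "scale_dual c (abs_completion X) = abs_completion (\<lambda>n. scale00 c (X n))"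
    by (rule scale_dual.abs_eq) (simp add: same_limit_refl assms)
  then show ?thesis using embed_approx[OF bounded_linear.Cauchy[OF lin assms]] by simp
qed

definition tpair :: "'k::{real_normed_field, banach} tsirelson \<Rightarrow> 'k c00 \<Rightarrow> 'k" where
  "tpair f z = functional f (embed z)"

lemma tpair_add: "tpair (f + g) z = tpair f z + tpair g z"
  by (simp add: tpair_def plus_tsirelson.rep_eq blinfun.add_left)

lemma tpair_diff: "tpair (f - g) z = tpair f z - tpair g z"
  by (simp add: tpair_def minus_tsirelson.rep_eq blinfun.diff_left)

lemma tpair_scale: "tpair (scale_tsirelson c f) z = c * tpair f z"
  by (simp add: tpair_def scale_tsirelson.rep_eq)

lemma tpair_zero [simp]: "tpair 0 z = 0"
  by (simp add: tpair_def zero_tsirelson.rep_eq)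

lemma tpair_sum: "tpair (\<Sum>i\<in>I. f i) z = (\<Sum>i\<in>I. tpair (f i) z)"
  by (induction I rule: infinite_finite_induct) (simp_all add: tpair_add)

lemma tpair_add_right: "tpair f (z + w) = tpair f z + tpair f w"
  by (simp add: tpair_def linear_add[OF linear_embed] blinfun.add_right)

lemma tpair_zero_right [simp]: "tpair f 0 = 0"
  by (simp add: tpair_def linear_0[OF linear_embed] blinfun.zero_right)

lemma tpair_sum_right: "tpair f (\<Sum>i\<in>I. z i) = (\<Sum>i\<in>I. tpair f (z i))"
  by (induction I rule: infinite_finite_induct) (simp_all add: tpair_add_right)

lemma tpair_scale_right: "tpair f (scale00 c z) = c * tpair f z"
  using functional[of f] by (simp add: tpair_def embed_scale00)

lemma norm_tpair_le: "norm (tpair f z) \<le> norm f * norm z"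
  using norm_blinfun[of "functional f" "embed z"] by (simp add: tpair_def norm_tsirelson.rep_eq)

lemma bounded_linear_tpair: "bounded_linear (\<lambda>f. tpair f z)"
  by (rule bounded_linear_intro[where K = "norm z"])
     (auto simp: tpair_add norm_tpair_le scaleR_tsirelson tpair_scale scaleR_conv_of_real)

lemma norm_tsirelson_le:
  assumes "\<And>z. norm (tpair f z) \<le> C * norm z"
  shows "norm f \<le> C"
proof -
  \<comment> \<open>That \<open>C\<close> is nonnegative follows by testing the hypothesis on a
    nonzero vector.\<close>
  have "0 \<le> C * norm (Abs_c00 (\<lambda>n. if n = 0 then 1 else 0) :: 'a c00)"
    using norm_ge_zero assms by (rule order_trans)
  moreover have "(Abs_c00 (\<lambda>n. if n = 0 then 1 else 0) :: 'a c00) \<noteq> 0"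
  proof
    assume "(Abs_c00 (\<lambda>n. if n = 0 then 1 else 0) :: 'a c00) = 0"
    then have "coord (Abs_c00 (\<lambda>n. if n = 0 then 1 else 0) :: 'a c00) 0 = 0" by simp
    then show False by (subst (asm) Abs_c00_inverse) auto
  qed
  ultimately have C: "C \<ge> 0" by (simp add: zero_le_mult_iff)
  have "norm (functional f) \<le> C"
  proof (rule norm_blinfun_bound[OF C])
    fix A :: "'a c00 completion"
    obtain X where X: "Cauchy X" "(\<lambda>n. embed (X n)) \<longlonglongrightarrow> A" by (rule completion_cases[of A]) blast
    show "norm (functional f A) \<le> C * norm A"
    proof (rule LIMSEQ_le)
      show "(\<lambda>n. norm (functional f (embed (X n)))) \<longlonglongrightarrow> norm (functional f A)"
        by (intro tendsto_intros X)
      show "(\<lambda>n. C * norm (embed (X n))) \<longlonglongrightarrow> C * norm A" by (intro tendsto_intros X)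
    qed (use assms in \<open>auto simp: tpair_def\<close>)
  qed
  then show ?thesis by (simp add: norm_tsirelson.rep_eq)
qed

lemma ex_tsirelson:
  fixes f :: "'k::{real_normed_field, banach} c00 \<Rightarrow> 'k"
  assumes add: "\<And>x y. f (x + y) = f x + f y" and hom: "\<And>c x. f (scale00 c x) = c * f x"
    and bound: "\<And>x. norm (f x) \<le> C * norm x"
  shows "\<exists>F. \<forall>x. tpair F x = f x"
proof -
  have "scale00 (of_real r) x = r *\<^sub>R x" for r and x :: "'k c00"
    by (rule coord_eqI) (simp add: scaleR_conv_of_real)
  then have lin: "bounded_linear f"
    using hom[of "of_real _"] by (intro bounded_linear_intro[where K = C])
      (auto simp: add scaleR_conv_of_real bound mult.commute)
  \<comment> \<open>One limit serves all sequences that represent \<open>A\<close>; so the extension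
    \<open>g\<close> is well defined and the algebraic laws pass to the limit.\<close>
  have "\<exists>L. \<forall>X. Cauchy X \<longrightarrow> (\<lambda>n. embed (X n)) \<longlonglongrightarrow> A \<longrightarrow> (\<lambda>n. f (X n)) \<longlonglongrightarrow> L" for A
  proof -
    obtain Y where Y: "Cauchy Y" "(\<lambda>n. embed (Y n)) \<longlonglongrightarrow> A" by (rule completion_cases[of A]) blast
    have "convergent (\<lambda>n. f (Y n))"
      using bounded_linear.Cauchy[OF lin Y(1)] Cauchy_convergent by blast
    then obtain L where L: "(\<lambda>n. f (Y n)) \<longlonglongrightarrow> L" by (auto simp: convergent_def)
    have "(\<lambda>n. f (X n)) \<longlonglongrightarrow> L" if X: "(\<lambda>n. embed (X n)) \<longlonglongrightarrow> A" for X
    proof -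
      have "(\<lambda>n. embed (X n) - embed (Y n)) \<longlonglongrightarrow> A - A" by (intro tendsto_diff X Y)
      then have "(\<lambda>n. embed (X n - Y n)) \<longlonglongrightarrow> 0"
        by (simp only: embed_diff diff_self)
      then have "(\<lambda>n. norm (embed (X n - Y n))) \<longlonglongrightarrow> 0" by (rule tendsto_norm_zero)
      then have "(\<lambda>n. norm (X n - Y n)) \<longlonglongrightarrow> 0" by (simp only: norm_embed)
      then have "(\<lambda>n. X n - Y n) \<longlonglongrightarrow> 0" by (rule tendsto_norm_zero_cancel)
      then have "(\<lambda>n. f (X n - Y n)) \<longlonglongrightarrow> 0" by (rule bounded_linear.tendsto_zero[OF lin])
      then have "(\<lambda>n. f (Y n) + f (X n - Y n)) \<longlonglongrightarrow> L + 0" by (intro tendsto_add L)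
      then show ?thesis using linear_diff[OF bounded_linear.linear[OF lin]] by simp
    qed
    then show ?thesis by blast
  qed
  then obtain g where g: "\<And>A X. Cauchy X \<Longrightarrow> (\<lambda>n. embed (X n)) \<longlonglongrightarrow> A \<Longrightarrow> (\<lambda>n. f (X n)) \<longlonglongrightarrow> g A"
    by metis
  have g_embed: "g (embed x) = f x" for x
  proof -
    have "(\<lambda>n. f x) \<longlonglongrightarrow> g (embed x)"
      by (rule g) (auto simp: convergent_Cauchy convergent_const)
    then show ?thesis using LIMSEQ_unique tendsto_const by blast
  qed
  have g_add: "g (A + B) = g A + g B" for A B
  proof -
    obtain X where X: "Cauchy X" "(\<lambda>n. embed (X n)) \<longlonglongrightarrow> A" by (rule completion_cases[of A]) blast
    obtain Y where Y: "Cauchy Y" "(\<lambda>n. embed (Y n)) \<longlonglongrightarrow> B" by (rule completion_cases[of B]) blast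
    have "(\<lambda>n. f (X n + Y n)) \<longlonglongrightarrow> g (A + B)"
      using tendsto_add[OF X(2) Y(2)] X Y
      by (intro g Cauchy_add_seq) (simp_all add: linear_add[OF linear_embed])
    moreover have "(\<lambda>n. f (X n + Y n)) \<longlonglongrightarrow> g A + g B"
      unfolding add by (intro tendsto_add g X Y)
    ultimately show ?thesis by (rule LIMSEQ_unique)
  qed
  have g_dual: "g (scale_dual c A) = c * g A" for c A
  proof -
    obtain X where X: "Cauchy X" "A = abs_completion X" "(\<lambda>n. embed (X n)) \<longlonglongrightarrow> A"
      by (rule completion_cases[of A]) blast
    have lin: "bounded_linear (scale00 c :: 'k c00 \<Rightarrow> _)"
      by (rule bounded_linear_intro[where K = "norm c"])
         (auto intro!: coord_eqI simp: norm_scale00 algebra_simps)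
    have "(\<lambda>n. f (scale00 c (X n))) \<longlonglongrightarrow> g (scale_dual c A)"
      unfolding X(2) by (rule g[OF bounded_linear.Cauchy[OF lin X(1)] tendsto_embed_scale00[OF X(1)]])
    moreover have "(\<lambda>n. f (scale00 c (X n))) \<longlonglongrightarrow> c * g A"
      unfolding hom by (intro tendsto_mult tendsto_const g X)
    ultimately show ?thesis by (rule LIMSEQ_unique)
  qed
  have g_scaleR: "g (r *\<^sub>R A) = r *\<^sub>R g A" for r A
  proof -
    obtain X where X: "Cauchy X" "(\<lambda>n. embed (X n)) \<longlonglongrightarrow> A" by (rule completion_cases[of A]) blast
    have "(\<lambda>n. f (r *\<^sub>R X n)) \<longlonglongrightarrow> g (r *\<^sub>R A)"
      using tendsto_scaleR[OF tendsto_const X(2), of r] X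
      by (intro g Cauchy_scaleR_seq) (simp_all add: linear_scale[OF linear_embed])
    moreover have "(\<lambda>n. f (r *\<^sub>R X n)) \<longlonglongrightarrow> r *\<^sub>R g A"
      unfolding linear_scale[OF bounded_linear.linear[OF lin]] by (intro tendsto_scaleR tendsto_const g X)
    ultimately show ?thesis by (rule LIMSEQ_unique)
  qed
  have g_bound: "norm (g A) \<le> norm A * C" for A
  proof -
    obtain X where X: "Cauchy X" "(\<lambda>n. embed (X n)) \<longlonglongrightarrow> A" by (rule completion_cases[of A]) blast
    show ?thesis
    proof (rule LIMSEQ_le)
      show "(\<lambda>n. norm (f (X n))) \<longlonglongrightarrow> norm (g A)" by (intro tendsto_norm g X)
      show "(\<lambda>n. norm (embed (X n)) * C) \<longlonglongrightarrow> norm A * C" by (intro tendsto_intros X)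
    qed (use bound in \<open>auto simp: mult.commute\<close>)
  qed
  have bl: "bounded_linear g"
    by (rule bounded_linear_intro[where K = C]) (auto simp: g_add g_scaleR g_bound)
  then have "functional (Abs_tsirelson (Blinfun g)) = Blinfun g"
    by (intro Abs_tsirelson_inverse) (auto simp: bounded_linear_Blinfun_apply g_dual)
  then show ?thesis
    by (intro exI[of _ "Abs_tsirelson (Blinfun g)"])
       (simp add: tpair_def bounded_linear_Blinfun_apply[OF bl] g_embed)
qed

section \<open>Unit vector bases and truncations\<close>

lift_definition unit00 :: "nat \<Rightarrow> 'k::zero_neq_one c00" is "\<lambda>k n. if n = k then 1 else 0"
  by simp

lemma coord_unit00 [simp]: "coord (unit00 k) n = (if n = k then 1 else 0)"
  by transfer auto

lemma norm_unit00 [simp]: "norm (unit00 k :: 'k::real_normed_field c00) = 1"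
proof (rule antisym)
  have "l1norm (unit00 k :: 'k c00) = 1" by (subst l1norm_eq[of "{k}"]) auto
  then show "norm (unit00 k :: 'k c00) \<le> 1"
    using tnorm_le_l1[of _ "unit00 k :: 'k c00"]
    by (intro LIMSEQ_le_const2[OF tnorm_tendsto]) auto
  show "1 \<le> norm (unit00 k :: 'k c00)" using norm_coord_le[of "unit00 k :: 'k c00" k] by simp
qed

lemma c00_eq_sum:
  fixes z :: "'k::real_normed_field c00"
  assumes "finite A" "\<And>n. coord z n \<noteq> 0 \<Longrightarrow> n \<in> A"
  shows "z = (\<Sum>n\<in>A. scale00 (coord z n) (unit00 n))"
proof (rule coord_eqI)
  fix k
  have "(\<Sum>n\<in>A. coord (scale00 (coord z n) (unit00 n)) k) = (\<Sum>n\<in>A. if n = k then coord z n else 0)"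
    by (intro sum.cong) auto
  also have "\<dots> = coord z k" using assms by (auto simp: sum.delta)
  finally show "coord z k = coord (\<Sum>n\<in>A. scale00 (coord z n) (unit00 n)) k" by (simp add: coord_sum)
qed

lemma tpair_eq_sum:
  assumes "finite A" "\<And>n. coord z n \<noteq> 0 \<Longrightarrow> n \<in> A"
  shows "tpair f z = (\<Sum>n\<in>A. coord z n * tpair f (unit00 n))"
  by (subst c00_eq_sum[OF assms]) (simp_all add: tpair_sum_right tpair_scale_right)

text \<open>The unit vector basis of Tsirelson's space, as coordinate functionals on its
  predual.\<close>

definition biorth :: "nat \<Rightarrow> 'k::{real_normed_field, banach} tsirelson" where
  "biorth k = (SOME F. \<forall>x. tpair F x = coord x k)"

lemma tpair_biorth [simp]: "tpair (biorth k) x = coord x k"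
proof -
  have "\<exists>F. \<forall>x :: 'a c00. tpair F x = coord x k"
    by (rule ex_tsirelson[where C = 1]) (auto simp: norm_coord_le)
  then show ?thesis unfolding biorth_def by (rule someI2_ex) blast
qed

text \<open>The basis projection, adjoint to restriction to the first \<open>N\<close>
  coordinates.\<close>

definition trunc :: "nat \<Rightarrow> 'k::{real_normed_field, banach} tsirelson \<Rightarrow> 'k tsirelson" where
  "trunc N f = (\<Sum>k<N. scale_tsirelson (tpair f (unit00 k)) (biorth k))"

lemma tpair_trunc: "tpair (trunc N f) z = tpair f (proj {..<N} z)"
  by (subst tpair_eq_sum[of "{..<N}" "proj {..<N} z"])
     (auto simp: trunc_def tpair_sum tpair_scale mult.commute intro!: sum.cong split: if_splits)

lemma tpair_diff_trunc: "tpair (f - trunc N f) z = tpair f (proj {N..} z)"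
proof -
  have "z = proj {..<N} z + proj {N..} z" by (rule coord_eqI) auto
  then have "tpair f z = tpair f (proj {..<N} z) + tpair f (proj {N..} z)"
    using tpair_add_right by metis
  then show ?thesis by (simp add: tpair_diff tpair_trunc)
qed

lemma ex_phase: "\<exists>\<phi> :: 'k::real_normed_field. norm \<phi> = 1 \<and> \<phi> * t = of_real (norm t)"
proof (cases "t = 0")
  case False
  then show ?thesis by (intro exI[of _ "of_real (norm t) / t"]) (simp add: norm_divide)
qed (auto intro: exI[of _ 1])

text \<open>The unit vector basis is shrinking, since small vectors cannot pair with \<open>f\<close> to \<open>\<epsilon>\<close>.\<close>

lemma trunc_tendsto:
  fixes f :: "'k::{real_normed_field, banach} tsirelson"
  shows "(\<lambda>N. trunc N f) \<longlonglongrightarrow> f"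
proof (rule LIMSEQ_I)
  fix e :: real assume "e > 0"
  then have e: "e / 2 > 0" by simp
  have "\<exists>N. \<forall>z. (\<forall>n. coord z n \<noteq> 0 \<longrightarrow> N \<le> n) \<and> norm z \<le> 1 \<longrightarrow> norm (tpair f z) \<le> e / 2"
  proof (rule ccontr)
    assume contr: "\<not> ?thesis"
    \<comment> \<open>Prescribing real values from \<open>e/2\<close> on, rather than moduli, makes
      these sets convex; multiplication by a phase shows that they are nonempty.\<close>
    define C where "C N = {z. (\<forall>n. coord z n \<noteq> 0 \<longrightarrow> N \<le> n) \<and> norm z \<le> 1 \<and>
      (\<exists>r\<ge>e/2. tpair f z = of_real r)}" for N
    have "\<exists>y\<in>C 0. norm y < (e / 2) / (norm f + 1)"
    proof (rule ex_small_norm)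
      fix N
      show "convex (C N)"
      proof (rule convexI)
        fix x y and u v :: real
        assume xy: "x \<in> C N" "y \<in> C N" and uv: "0 \<le> u" "0 \<le> v" "u + v = 1"
        obtain r s where rs: "r \<ge> e/2" "tpair f x = of_real r" "s \<ge> e/2" "tpair f y = of_real s"
          using xy by (auto simp: C_def)
        have sc: "a *\<^sub>R z = scale00 (of_real a) z" for a and z :: "'k c00"
          by (rule coord_eqI) (simp add: scaleR_conv_of_real)
        have "u * (e/2) + v * (e/2) \<le> u * r + v * s"
          using rs uv by (intro add_mono mult_left_mono) auto
        moreover have "u * (e/2) + v * (e/2) = e/2" using uv(3) by (simp only: distrib_right[symmetric] mult_1)
        ultimately have "u * r + v * s \<ge> e/2" by linarith
        moreover have "tpair f (u *\<^sub>R x + v *\<^sub>R y) = of_real (u * r + v * s)"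
          by (simp add: tpair_add_right sc tpair_scale_right rs)
        moreover have "norm (u *\<^sub>R x + v *\<^sub>R y) \<le> 1"
          using xy uv convexD[OF convex_cball[of "0 :: 'k c00" 1], of x y u v] by (auto simp: C_def)
        moreover have "N \<le> n" if "coord (u *\<^sub>R x + v *\<^sub>R y) n \<noteq> 0" for n
          using xy that by (cases "coord x n = 0") (auto simp: C_def)
        ultimately show "u *\<^sub>R x + v *\<^sub>R y \<in> C N" unfolding C_def by blast
      qed
      obtain z where z: "\<And>n. coord z n \<noteq> 0 \<Longrightarrow> N \<le> n" "norm z \<le> 1" "norm (tpair f z) > e / 2"
      proof -
        have "\<not> (\<forall>z. (\<forall>n. coord z n \<noteq> 0 \<longrightarrow> N \<le> n) \<and> norm z \<le> 1 \<longrightarrow> norm (tpair f z) \<le> e / 2)"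
          using contr by blast
        then obtain z where "(\<forall>n. coord z n \<noteq> 0 \<longrightarrow> N \<le> n) \<and> norm z \<le> 1 \<and> \<not> norm (tpair f z) \<le> e / 2"
          by blast
        then show thesis by (intro that[of z]) auto
      qed
      obtain \<phi> where \<phi>: "norm \<phi> = 1" "\<phi> * tpair f z = of_real (norm (tpair f z))"
        using ex_phase by blast
      have "scale00 \<phi> z \<in> C N"
        using z \<phi> by (auto simp: C_def norm_scale00 tpair_scale_right intro!: exI[of _ "norm (tpair f z)"])
      then show "C N \<noteq> {}" by blast
      show "(e / 2) / (norm f + 1) > 0" by (intro divide_pos_pos e add_nonneg_pos) auto
    qed (auto simp: C_def)
    then obtain y where y: "y \<in> C 0" "norm y < (e / 2) / (norm f + 1)" by blast
    then obtain r where r: "r \<ge> e/2" "tpair f y = of_real r" by (auto simp: C_def)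
    have "e/2 \<le> norm (tpair f y)" using r by simp
    also have "\<dots> \<le> norm f * norm y" by (rule norm_tpair_le)
    also have "\<dots> \<le> (norm f + 1) * norm y" by (intro mult_right_mono) auto
    also have "\<dots> < e / 2"
      using y(2) pos_less_divide_eq[OF add_nonneg_pos[OF norm_ge_zero zero_less_one], of "norm y" "e/2" f]
      by (simp only: mult.commute)
    finally show False by simp
  qed
  then obtain N where "\<forall>z. (\<forall>n. coord z n \<noteq> 0 \<longrightarrow> N \<le> n) \<and> norm z \<le> 1 \<longrightarrow> norm (tpair f z) \<le> e / 2" ..
  then have N: "norm (tpair f z) \<le> e / 2" if "\<And>n. coord z n \<noteq> 0 \<Longrightarrow> N \<le> n" "norm z \<le> 1" for z
    using that by blast
  have "norm (trunc M f - f) < e" if M: "M \<ge> N" for M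
  proof -
    have "norm (f - trunc M f) \<le> e / 2"
    proof (rule norm_tsirelson_le)
      fix z :: "'k c00"
      show "norm (tpair (f - trunc M f) z) \<le> e / 2 * norm z"
      proof (cases "z = 0")
        case False
        define c where "c = norm z"
        have c: "c > 0" using False by (simp add: c_def)
        let ?w = "scale00 (of_real (1 / c)) (proj {M..} z)"
        have "norm (proj {M..} z) \<le> c" unfolding c_def by (rule norm_proj_le)
        then have "norm ?w \<le> 1" using c by (simp add: norm_scale00 divide_le_eq norm_divide)
        moreover have "N \<le> n" if "coord ?w n \<noteq> 0" for n using that M by (auto split: if_splits)
        ultimately have "norm (tpair f ?w) \<le> e / 2" by (intro N) auto
        then have "norm (tpair f (proj {M..} z)) / c \<le> e / 2"
          using c by (simp add: tpair_scale_right norm_mult norm_divide)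
        then show ?thesis using c by (simp add: tpair_diff_trunc pos_divide_le_eq c_def)
      qed simp
    qed
    then show ?thesis using e by (simp add: norm_minus_commute)
  qed
  then show "\<exists>N. \<forall>M\<ge>N. norm (trunc M f - f) < e" by blast
qed

text \<open>This is the failure of the norm to dominate that of \<open>\<ell>\<^sub>1\<close>: unit
  vectors far out have coordinate sum 1, and \<open>ex_small_norm\<close> finds small vectors in
  convex sets that contain them.\<close>

lemma ex_small_combination:
  assumes "e > 0"
  shows "\<exists>(u :: 'k::real_normed_field c00) J. (\<forall>n. coord u n \<noteq> 0 \<longrightarrow> n < J) \<and> (\<Sum>i<J. coord u i) = 1 \<and> norm u < e"
proof -
  define s where "s z = (\<Sum>n | coord z n \<noteq> 0. coord z n)" for z :: "'k c00"
  have s: "s z = (\<Sum>n\<in>A. coord z n)" if "finite A" "\<And>n. coord z n \<noteq> 0 \<Longrightarrow> n \<in> A" for A z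
    unfolding s_def using that by (intro sum.mono_neutral_left) auto
  define C where "C N = {z :: 'k c00. (\<forall>n. coord z n \<noteq> 0 \<longrightarrow> N \<le> n) \<and> norm z \<le> 1 \<and> s z = 1}" for N
  have "\<exists>y\<in>C 0. norm y < e"
  proof (rule ex_small_norm)
    fix N
    show "convex (C N)"
    proof (rule convexI)
      fix x y and u v :: real
      assume xy: "x \<in> C N" "y \<in> C N" and uv: "0 \<le> u" "0 \<le> v" "u + v = 1"
      let ?A = "{n. coord x n \<noteq> 0} \<union> {n. coord y n \<noteq> 0}"
      have fin: "finite ?A" by (simp add: finite_supp)
      have "s (u *\<^sub>R x + v *\<^sub>R y) = (\<Sum>n\<in>?A. coord (u *\<^sub>R x + v *\<^sub>R y) n)"
      proof (rule s[OF fin])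
        fix n assume "coord (u *\<^sub>R x + v *\<^sub>R y) n \<noteq> 0"
        then show "n \<in> ?A" by (cases "coord x n = 0") auto
      qed
      also have "\<dots> = u *\<^sub>R s x + v *\<^sub>R s y"
        using s[OF fin, of x] s[OF fin, of y] by (simp add: sum.distrib scaleR_sum_right)
      also have "\<dots> = 1" using xy uv by (simp add: C_def scaleR_add_left[symmetric])
      finally have "s (u *\<^sub>R x + v *\<^sub>R y) = 1" .
      moreover have "norm (u *\<^sub>R x + v *\<^sub>R y) \<le> 1"
        using xy uv convexD[OF convex_cball[of "0 :: 'k c00" 1], of x y u v] by (auto simp: C_def)
      moreover have "N \<le> n" if "coord (u *\<^sub>R x + v *\<^sub>R y) n \<noteq> 0" for n
        using xy that by (cases "coord x n = 0") (auto simp: C_def)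
      ultimately show "u *\<^sub>R x + v *\<^sub>R y \<in> C N" by (auto simp: C_def)
    qed
    have "s (unit00 N) = 1" by (subst s[of "{N}"]) (auto split: if_splits)
    then have "unit00 N \<in> C N" by (auto simp: C_def split: if_splits)
    then show "C N \<noteq> {}" by blast
  qed (use assms in \<open>auto simp: C_def\<close>)
  then obtain u where u: "u \<in> C 0" "norm u < e" by blast
  obtain J where J: "\<And>n. coord u n \<noteq> 0 \<Longrightarrow> n < J" by (rule supp_bounded) blast
  have "s u = (\<Sum>i<J. coord u i)" by (rule s) (use J in auto)
  then show ?thesis using u J by (intro exI[of _ u] exI[of _ J]) (auto simp: C_def)
qed


section \<open>Operators that factor through a tail\<close>

definition klinear :: "('k::{real_normed_field, banach} tsirelson \<Rightarrow>\<^sub>L 'k tsirelson) \<Rightarrow> bool" where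
  "klinear x \<longleftrightarrow> (\<forall>c f. x (scale_tsirelson c f) = scale_tsirelson c (x f))"

lemma blinfun_sum_scale:
  assumes "klinear x"
  shows "x (\<Sum>k\<in>K. scale_tsirelson (c k) (f k)) = (\<Sum>k\<in>K. scale_tsirelson (c k) (x (f k)))"
  using assms by (simp add: klinear_def blinfun.sum_right)

lemma tpair_blinfun_sum_scale:
  assumes "klinear x"
  shows "c * tpair (x (\<Sum>k\<in>K. scale_tsirelson (b k) (f k))) z = (\<Sum>k\<in>K. (c * tpair (x (f k)) z) * b k)"
  unfolding blinfun_sum_scale[OF assms] tpair_sum tpair_scale sum_distrib_left
  by (rule sum.cong[OF refl]) (simp only: mult_ac)

text \<open>Unconditionality with constant 1: phases on the coordinates of \<open>z\<close> turn the
  sum of moduli into a single value of \<open>f\<close> without increasing the norm.\<close>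

lemma sum_norm_tpair_le:
  assumes "finite K"
  shows "(\<Sum>k\<in>K. norm (tpair f (unit00 k) * coord z k)) \<le> norm f * norm (proj K z)"
proof -
  have "\<forall>k. \<exists>\<phi>. norm \<phi> = 1 \<and> \<phi> * (tpair f (unit00 k) * coord z k) = of_real (norm (tpair f (unit00 k) * coord z k))"
    by (intro allI ex_phase)
  then obtain \<phi> where \<phi>: "\<And>k. norm (\<phi> k) = 1"
    "\<And>k. \<phi> k * (tpair f (unit00 k) * coord z k) = of_real (norm (tpair f (unit00 k) * coord z k))"
    by metis
  define w where "w = (\<Sum>k\<in>K. scale00 (\<phi> k * coord z k) (unit00 k))"
  have w: "coord w n = (if n \<in> K then \<phi> n * coord z n else 0)" for n
  proof -
    have "coord w n = (\<Sum>k\<in>K. if k = n then \<phi> k * coord z k else 0)"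
      unfolding w_def coord_sum by (intro sum.cong) auto
    then show ?thesis using assms by (simp add: sum.delta)
  qed
  have "tpair f w = (\<Sum>k\<in>K. of_real (norm (tpair f (unit00 k) * coord z k)))"
    unfolding w_def tpair_sum_right tpair_scale_right
    by (intro sum.cong refl) (subst \<phi>(2)[symmetric], simp only: mult_ac)
  also have "\<dots> = of_real (\<Sum>k\<in>K. norm (tpair f (unit00 k) * coord z k))" by simp
  finally have "norm (tpair f w) = (\<Sum>k\<in>K. norm (tpair f (unit00 k) * coord z k))"
    by (simp only: norm_of_real) (simp add: sum_nonneg)
  moreover have "norm w \<le> norm (proj K z)"
    by (rule norm_c00_mono) (simp add: w norm_mult \<phi>(1))
  then have "norm f * norm w \<le> norm f * norm (proj K z)" by (rule mult_left_mono) simp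
  ultimately show ?thesis using norm_tpair_le[of f w] by linarith
qed

lemma ex_weighted_phase:
  fixes b :: "'k::real_normed_field"
  assumes "\<theta> \<ge> 0"
  shows "\<exists>c. norm c = \<theta> \<and> c * b = of_real (\<theta> * norm b)"
proof -
  obtain \<phi> :: 'k where "norm \<phi> = 1" "\<phi> * b = of_real (norm b)" using ex_phase by blast
  then show ?thesis using assms by (intro exI[of _ "of_real \<theta> * \<phi>"]) (simp add: norm_mult)
qed

text \<open>
  Grothendieck's inequality in the form needed here: Khinchin's inequality bounds the columns of the
  matrix of \<open>x\<close>, weighted with \<open>u\<close>, and the Euclidean norms of the columns of \<open>y\<close> are attained up to
  a constant on finitely many vectors, so that far out their images behave like those in \<open>c\<^sub>0\<close>.
\<close>

lemma trace_estimate: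
  fixes u :: "'k::{real_normed_field, euclidean_space} c00"
  shows "\<exists>m\<ge>J. \<forall>x y. klinear x \<longrightarrow> klinear y \<longrightarrow>
    norm (\<Sum>i<J. coord u i * tpair (x (y (biorth i) - trunc m (y (biorth i)))) (unit00 i))
      \<le> 768 * norm u * norm x * norm y"
proof -
  obtain \<Omega> :: "(nat \<Rightarrow> 'k) set" where \<Omega>: "finite \<Omega>"
    "\<And>\<omega> z. \<omega> \<in> \<Omega> \<Longrightarrow> norm (\<Sum>i<J. \<omega> i * coord z i) \<le> 2 * norm z"
    "\<And>\<tau>. \<exists>\<omega>\<in>\<Omega>. sqrt (\<Sum>i<J. (norm (\<tau> i))\<^sup>2) \<le> 6 * norm (\<Sum>i<J. \<omega> i * \<tau> i)"
    using ex_finite_functionals[where ?'k = 'k and J = J] by blast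
  define N where "N = card \<Omega>"
  obtain \<omega> where \<omega>: "bij_betw \<omega> {..<N} \<Omega>"
    unfolding N_def lessThan_atLeast0 using ex_bij_betw_nat_finite[OF \<Omega>(1)] by blast
  \<comment> \<open>The distance that \<open>sum_norm_colour_le\<close> requires for
    \<open>N\<close> colours. It depends on \<open>J\<close> alone, so \<open>m\<close> serves all
    \<open>x\<close> and \<open>y\<close>.\<close>
  define m where "m = max J ((4 * N + 4) * (4 * N + 4))"
  show ?thesis
  proof (intro exI[of _ m] conjI allI impI)
    show "J \<le> m" by (simp add: m_def)
    fix x y :: "'k tsirelson \<Rightarrow>\<^sub>L 'k tsirelson"
    assume x: "klinear x" and y: "klinear y"
    define t where "t k i = tpair (y (biorth i)) (unit00 k)" for k i
    define a where "a k i = coord u i * tpair (x (biorth k)) (unit00 i)" for k i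
    \<comment> \<open>Cauchy-Schwarz over \<open>i\<close> separates the two operators: the
      Euclidean norm of \<open>a k\<close> is averaged over signs, and \<open>\<theta> k\<close> is
      realised on test vectors.\<close>
    define \<theta> where "\<theta> k = sqrt (\<Sum>i<J. (norm (t k i))\<^sup>2)" for k
    have \<theta>0: "\<theta> k \<ge> 0" for k by (simp add: \<theta>_def sum_nonneg)
    define g where "g c = (\<Sum>i<J. scale_tsirelson (\<omega> c i) (biorth i))" for c
    have g: "norm (g c) \<le> 2" if "c < N" for c
    proof (rule norm_tsirelson_le)
      have "\<omega> c \<in> \<Omega>" using \<omega> that by (auto simp: bij_betw_def)
      then show "norm (tpair (g c) z) \<le> 2 * norm z" for z
        using \<Omega>(2) by (simp add: g_def tpair_sum tpair_scale)
    qed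
    have "\<exists>c<N. \<theta> k \<le> 6 * norm (tpair (y (g c)) (unit00 k))" for k
    proof -
      obtain \<nu> where \<nu>: "\<nu> \<in> \<Omega>" "\<theta> k \<le> 6 * norm (\<Sum>i<J. \<nu> i * t k i)"
        unfolding \<theta>_def using \<Omega>(3) by blast
      then obtain c where "c < N" "\<nu> = \<omega> c" using \<omega> by (auto simp: bij_betw_def)
      then show ?thesis using \<nu>(2)
        by (auto simp: g_def blinfun_sum_scale[OF y] tpair_sum tpair_scale t_def)
    qed
    \<comment> \<open>The colour of \<open>k\<close> names a test vector on which row
      \<open>k\<close> of \<open>y\<close>, cut to its first \<open>J\<close> entries, attains its
      Euclidean norm up to the factor 6.\<close>
    then obtain col where col: "\<And>k. col k < N" "\<And>k. \<theta> k \<le> 6 * norm (tpair (y (g (col k))) (unit00 k))"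
      by metis
    \<comment> \<open>\<open>192 = 6 * 2 * 16\<close>: the loss in the choice of colours, the norms
      of the \<open>g c\<close>, and the constant of \<open>sum_norm_colour_le\<close>.\<close>
    have sum_\<theta>: "(\<Sum>k\<in>{m..<M}. \<theta> k * norm (coord z k)) \<le> 192 * norm y * norm z" for M and z :: "'k c00"
    proof -
      let ?z = "proj {m..<M} z"
      have "(\<Sum>k\<in>{m..<M}. \<theta> k * norm (coord z k))
        \<le> (\<Sum>k\<in>{m..<M}. 6 * norm (tpair (y (g (col k))) (unit00 k) * coord z k))"
        using col(2) by (intro sum_mono) (simp add: norm_mult mult_right_mono mult.assoc[symmetric])
      also have "\<dots> = (\<Sum>c<N. \<Sum>k\<in>{k\<in>{m..<M}. col k = c}. 6 * norm (tpair (y (g (col k))) (unit00 k) * coord z k))"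
        using col(1) by (intro sum.group[symmetric]) auto
      also have "\<dots> \<le> (\<Sum>c<N. 12 * norm y * norm (proj {n. col n = c} ?z))"
      proof (rule sum_mono)
        fix c assume "c \<in> {..<N}"
        then have c: "c < N" by simp
        let ?K = "{k\<in>{m..<M}. col k = c}"
        have "(\<Sum>k\<in>?K. 6 * norm (tpair (y (g (col k))) (unit00 k) * coord z k))
          = 6 * (\<Sum>k\<in>?K. norm (tpair (y (g c)) (unit00 k) * coord z k))"
          unfolding sum_distrib_left by (intro sum.cong) auto
        also have "\<dots> \<le> 6 * (norm (y (g c)) * norm (proj ?K z))"
          by (intro mult_left_mono sum_norm_tpair_le) auto
        also have "\<dots> \<le> 6 * ((norm y * 2) * norm (proj ?K z))"
        proof -
          have "norm (y (g c)) \<le> norm y * norm (g c)" by (rule norm_blinfun)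
          also have "\<dots> \<le> norm y * 2" by (intro mult_left_mono g[OF c]) simp
          finally show ?thesis by (intro mult_left_mono mult_right_mono) auto
        qed
        also have "proj ?K z = proj {n. col n = c} ?z"
          unfolding proj_proj by (rule arg_cong[where f = "\<lambda>E. proj E z"]) auto
        also have "6 * ((norm y * 2) * norm (proj {n. col n = c} ?z)) = 12 * norm y * norm (proj {n. col n = c} ?z)"
          by simp
        finally show "(\<Sum>k\<in>?K. 6 * norm (tpair (y (g (col k))) (unit00 k) * coord z k))
          \<le> 12 * norm y * norm (proj {n. col n = c} ?z)" .
      qed
      also have "\<dots> = 12 * norm y * (\<Sum>c<N. norm (proj {n. col n = c} ?z))"
        by (simp only: sum_distrib_left)
      also have "\<dots> \<le> 12 * norm y * (16 * norm ?z)"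
        by (intro mult_left_mono sum_norm_colour_le) (auto simp: m_def split: if_splits)
      also have "\<dots> \<le> 12 * norm y * (16 * norm z)"
        by (intro mult_left_mono norm_proj_le) auto
      finally show ?thesis by simp
    qed
    \<comment> \<open>\<open>768 = 4 * 192\<close>, with the 4 from Khinchin's inequality.\<close>
    have finite_part: "norm (\<Sum>i<J. \<Sum>k\<in>{m..<M}. a k i * t k i) \<le> 768 * norm u * norm x * norm y" for M
    proof -
      have "norm (\<Sum>i<J. \<Sum>k\<in>{m..<M}. a k i * t k i) \<le> (\<Sum>k\<in>{m..<M}. \<Sum>i<J. norm (a k i) * norm (t k i))"
        by (subst sum.swap) (intro sum_norm_le order_refl, simp add: norm_mult)
      also have "\<dots> \<le> (\<Sum>k\<in>{m..<M}. sqrt (\<Sum>i<J. (norm (a k i))\<^sup>2) * \<theta> k)"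
      proof (rule sum_mono)
        fix k
        show "(\<Sum>i<J. norm (a k i) * norm (t k i)) \<le> sqrt (\<Sum>i<J. (norm (a k i))\<^sup>2) * \<theta> k"
          using L2_set_mult_ineq[of "\<lambda>i. norm (a k i)" "\<lambda>i. norm (t k i)" "{..<J}"]
          by (simp add: L2_set_def \<theta>_def)
      qed
      finally have 1: "norm (\<Sum>i<J. \<Sum>k\<in>{m..<M}. a k i * t k i)
        \<le> (\<Sum>k\<in>{m..<M}. sqrt (\<Sum>i<J. (norm (a k i))\<^sup>2) * \<theta> k)" .
      have "2 ^ J * (\<Sum>k\<in>{m..<M}. sqrt (\<Sum>i<J. (norm (a k i))\<^sup>2) * \<theta> k)
        = (\<Sum>k\<in>{m..<M}. (2 ^ J * sqrt (\<Sum>i<J. (norm (a k i))\<^sup>2)) * \<theta> k)"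
        by (simp only: sum_distrib_left mult.assoc)
      also have "\<dots> \<le> (\<Sum>k\<in>{m..<M}. (4 * (\<Sum>A\<in>Pow {..<J}. norm (\<Sum>i<J. signs A i *\<^sub>R a k i))) * \<theta> k)"
        by (intro sum_mono mult_right_mono khinchin \<theta>0)
      also have "\<dots> = (\<Sum>A\<in>Pow {..<J}. 4 * (\<Sum>k\<in>{m..<M}. \<theta> k * norm (\<Sum>i<J. signs A i *\<^sub>R a k i)))"
        unfolding sum_distrib_left sum_distrib_right by (subst sum.swap) (simp only: mult_ac)
      also have "\<dots> \<le> (\<Sum>A\<in>Pow {..<J}. 4 * (192 * norm y * norm x * norm u))"
      proof (intro sum_mono mult_left_mono)
        fix A
        define uA where "uA = (\<Sum>i<J. scale00 (of_real (signs A i) * coord u i) (unit00 i))"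
        have uA: "coord uA n = (if n < J then of_real (signs A n) * coord u n else 0)" for n
        proof -
          have "coord uA n = (\<Sum>i<J. if i = n then of_real (signs A i) * coord u i else 0)"
            unfolding uA_def coord_sum by (intro sum.cong) auto
          then show ?thesis by (simp add: sum.delta)
        qed
        have nuA: "norm uA \<le> norm u" by (rule norm_c00_mono) (simp add: uA norm_mult)
        have b: "(\<Sum>i<J. signs A i *\<^sub>R a k i) = tpair (x (biorth k)) uA" for k
          unfolding uA_def tpair_sum_right tpair_scale_right a_def scaleR_conv_of_real
          by (simp only: mult.assoc)
        have "\<forall>k. \<exists>c. norm c = \<theta> k \<and> c * tpair (x (biorth k)) uA = of_real (\<theta> k * norm (tpair (x (biorth k)) uA))"
          by (intro allI ex_weighted_phase \<theta>0)
        then obtain c where c: "\<And>k. norm (c k) = \<theta> k"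
          "\<And>k. c k * tpair (x (biorth k)) uA = of_real (\<theta> k * norm (tpair (x (biorth k)) uA))" by metis
        \<comment> \<open>Duality: by \<open>sum_\<theta>\<close> a vector with coordinates of
          modulus \<open>\<theta> k\<close> is bounded in norm, and with these phases the value of
          \<open>x h\<close> at \<open>uA\<close> is the sum to be estimated.\<close>
        define h where "h = (\<Sum>k\<in>{m..<M}. scale_tsirelson (c k) (biorth k))"
        have "norm h \<le> 192 * norm y"
        proof (rule norm_tsirelson_le)
          fix z
          have "norm (tpair h z) \<le> (\<Sum>k\<in>{m..<M}. norm (c k * coord z k))"
            unfolding h_def tpair_sum tpair_scale tpair_biorth by (rule norm_sum)
          also have "\<dots> \<le> 192 * norm y * norm z" using sum_\<theta> by (simp add: norm_mult c(1))
          finally show "norm (tpair h z) \<le> 192 * norm y * norm z" .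
        qed
        have "tpair (x h) uA = of_real (\<Sum>k\<in>{m..<M}. \<theta> k * norm (\<Sum>i<J. signs A i *\<^sub>R a k i))"
          unfolding b h_def blinfun_sum_scale[OF x] tpair_sum tpair_scale c(2) by (simp only: of_real_sum)
        then have "(\<Sum>k\<in>{m..<M}. \<theta> k * norm (\<Sum>i<J. signs A i *\<^sub>R a k i)) \<le> norm (tpair (x h) uA)"
          by (simp only: norm_of_real abs_ge_self)
        also have "\<dots> \<le> norm (x h) * norm uA" by (rule norm_tpair_le)
        also have "\<dots> \<le> (norm x * (192 * norm y)) * norm u"
        proof (intro mult_mono nuA)
          have "norm (x h) \<le> norm x * norm h" by (rule norm_blinfun)
          also have "\<dots> \<le> norm x * (192 * norm y)"
            using \<open>norm h \<le> 192 * norm y\<close> by (rule mult_left_mono) simp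
          finally show "norm (x h) \<le> norm x * (192 * norm y)" .
        qed auto
        finally show "(\<Sum>k\<in>{m..<M}. \<theta> k * norm (\<Sum>i<J. signs A i *\<^sub>R a k i)) \<le> 192 * norm y * norm x * norm u"
          by (simp only: mult_ac)
      qed simp
      also have "\<dots> = 2 ^ J * (768 * norm u * norm x * norm y)" by (simp add: card_Pow)
      finally have "(\<Sum>k\<in>{m..<M}. sqrt (\<Sum>i<J. (norm (a k i))\<^sup>2) * \<theta> k) \<le> 768 * norm u * norm x * norm y"
        by (rule mult_left_le_imp_le) simp
      with 1 show ?thesis by linarith
    qed
    \<comment> \<open>The tail is approximated by finite sections, which are expressed by the matrix
      entries of \<open>x\<close> and \<open>y\<close>; \<open>trunc_tendsto\<close> gives the
      limit.\<close>
    have lim: "(\<lambda>M. norm (\<Sum>i<J. coord u i * tpair (x (trunc M (y (biorth i)) - trunc m (y (biorth i)))) (unit00 i)))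
      \<longlonglongrightarrow> norm (\<Sum>i<J. coord u i * tpair (x (y (biorth i) - trunc m (y (biorth i)))) (unit00 i))"
      by (intro tendsto_norm tendsto_sum tendsto_mult tendsto_const
          bounded_linear.tendsto[OF bounded_linear_tpair] blinfun.tendsto tendsto_diff trunc_tendsto)
    have bound: "norm (\<Sum>i<J. coord u i * tpair (x (trunc M (y (biorth i)) - trunc m (y (biorth i)))) (unit00 i))
      \<le> 768 * norm u * norm x * norm y" if M: "M \<ge> m" for M
    proof -
      have "coord u i * tpair (x (trunc M (y (biorth i)) - trunc m (y (biorth i)))) (unit00 i)
        = (\<Sum>k\<in>{m..<M}. a k i * t k i)" for i
      proof -
        have "(\<Sum>k<M. h k) - (\<Sum>k<m. h k) = (\<Sum>k\<in>{m..<M}. h k)" for h :: "nat \<Rightarrow> 'k tsirelson"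
          using sum.atLeastLessThan_concat[of 0 m M h] M by (simp add: lessThan_atLeast0 algebra_simps)
        then have eq: "trunc M f - trunc m f = (\<Sum>k\<in>{m..<M}. scale_tsirelson (tpair f (unit00 k)) (biorth k))" for f :: "'k tsirelson"
          unfolding trunc_def .
        show ?thesis
          unfolding eq tpair_blinfun_sum_scale[OF x] a_def t_def by (rule refl)
      qed
      then show ?thesis using finite_part[of M] by (simp only:)
    qed
    show "norm (\<Sum>i<J. coord u i * tpair (x (y (biorth i) - trunc m (y (biorth i)))) (unit00 i))
      \<le> 768 * norm u * norm x * norm y"
      by (rule LIMSEQ_le_const2[OF lim], intro exI[of _ m] allI impI bound)
  qed
qed


section \<open>A bimodule of bilinear forms\<close>

type_synonym 'k op = "'k tsirelson \<Rightarrow>\<^sub>L 'k tsirelson"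

lemma klinear_add: "klinear x \<Longrightarrow> klinear y \<Longrightarrow> klinear (x + y)"
  by (simp add: klinear_def blinfun.add_left tsirelson.scale_right_distrib)

lemma klinear_smult: "klinear x \<Longrightarrow> klinear (scale_op scale_tsirelson c x)"
  by (simp add: klinear_def tsirelson.scale_left_commute)

lemma klinear_compose: "klinear x \<Longrightarrow> klinear y \<Longrightarrow> klinear (x o\<^sub>L y)"
  by (simp add: klinear_def)

lemma klinear_id: "klinear id_blinfun"
  by (simp add: klinear_def)

lemma klinear_AT: "a \<in> carrier (approximable_algebra scale_tsirelson) \<Longrightarrow> klinear a"
  by (simp only: klinear_def AT_linear simp_thms)

lemma compose_add: "(x + y) o\<^sub>L z = (x o\<^sub>L z) + (y o\<^sub>L z)" "z o\<^sub>L (x + y) = (z o\<^sub>L x) + (z o\<^sub>L y)"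
  by (auto intro!: blinfun_eqI simp: blinfun.bilinear_simps)

lemma compose_smult:
  "scale_op scale_tsirelson c x o\<^sub>L y = scale_op scale_tsirelson c (x o\<^sub>L y)"
  "klinear x \<Longrightarrow> x o\<^sub>L scale_op scale_tsirelson c y = scale_op scale_tsirelson c (x o\<^sub>L y)"
  by (auto intro!: blinfun_eqI simp: klinear_def)

lemma compose_assoc: "(x o\<^sub>L y) o\<^sub>L z = x o\<^sub>L (y o\<^sub>L z)"
  by (auto intro!: blinfun_eqI)

lemma compose_id [simp]: "x o\<^sub>L id_blinfun = x" "id_blinfun o\<^sub>L x = x"
  by (auto intro!: blinfun_eqI)

text \<open>
  With \<open>B\<close> the algebra of all bounded operators, these are the functionals on the kernel of the
  product map \<open>B \<otimes> B \<rightarrow> B\<close>: such a functional \<open>F\<close> is determined by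
  \<open>\<psi> x y = F (x \<otimes> y - 1 \<otimes> xy)\<close>, and the norm of \<open>F\<close> is equivalent to that of \<open>\<psi>\<close>.
\<close>

definition forms :: "('k::{real_normed_field, banach} op \<Rightarrow> 'k op \<Rightarrow> 'k) set" where
  "forms = {\<psi>. (\<forall>x y. \<not> (klinear x \<and> klinear y) \<longrightarrow> \<psi> x y = 0) \<and>
     (\<forall>x x' y. klinear x \<longrightarrow> klinear x' \<longrightarrow> klinear y \<longrightarrow> \<psi> (x + x') y = \<psi> x y + \<psi> x' y) \<and>
     (\<forall>x y y'. klinear x \<longrightarrow> klinear y \<longrightarrow> klinear y' \<longrightarrow> \<psi> x (y + y') = \<psi> x y + \<psi> x y') \<and>
     (\<forall>c x y. klinear x \<longrightarrow> klinear y \<longrightarrow> \<psi> (scale_op scale_tsirelson c x) y = c * \<psi> x y) \<and>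
     (\<forall>c x y. klinear x \<longrightarrow> klinear y \<longrightarrow> \<psi> x (scale_op scale_tsirelson c y) = c * \<psi> x y) \<and>
     (\<forall>y. \<psi> id_blinfun y = 0) \<and>
     (\<exists>C. \<forall>x y. norm (\<psi> x y) \<le> C * (norm x * norm y))}"

lemma formsI:
  assumes "\<And>x y. \<not> (klinear x \<and> klinear y) \<Longrightarrow> \<psi> x y = 0"
    and "\<And>x x' y. klinear x \<Longrightarrow> klinear x' \<Longrightarrow> klinear y \<Longrightarrow> \<psi> (x + x') y = \<psi> x y + \<psi> x' y"
    and "\<And>x y y'. klinear x \<Longrightarrow> klinear y \<Longrightarrow> klinear y' \<Longrightarrow> \<psi> x (y + y') = \<psi> x y + \<psi> x y'"
    and "\<And>c x y. klinear x \<Longrightarrow> klinear y \<Longrightarrow> \<psi> (scale_op scale_tsirelson c x) y = c * \<psi> x y"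
    and "\<And>c x y. klinear x \<Longrightarrow> klinear y \<Longrightarrow> \<psi> x (scale_op scale_tsirelson c y) = c * \<psi> x y"
    and "\<And>y. \<psi> id_blinfun y = 0"
    and "\<And>x y. norm (\<psi> x y) \<le> C * (norm x * norm y)"
  shows "\<psi> \<in> forms"
  using assms unfolding forms_def by blast

lemma formsD:
  assumes "\<psi> \<in> forms"
  shows "\<And>x y. \<not> (klinear x \<and> klinear y) \<Longrightarrow> \<psi> x y = 0"
    and "\<And>x x' y. klinear x \<Longrightarrow> klinear x' \<Longrightarrow> klinear y \<Longrightarrow> \<psi> (x + x') y = \<psi> x y + \<psi> x' y"
    and "\<And>x y y'. klinear x \<Longrightarrow> klinear y \<Longrightarrow> klinear y' \<Longrightarrow> \<psi> x (y + y') = \<psi> x y + \<psi> x y'"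
    and "\<And>c x y. klinear x \<Longrightarrow> klinear y \<Longrightarrow> \<psi> (scale_op scale_tsirelson c x) y = c * \<psi> x y"
    and "\<And>c x y. klinear x \<Longrightarrow> klinear y \<Longrightarrow> \<psi> x (scale_op scale_tsirelson c y) = c * \<psi> x y"
    and "\<And>y. \<psi> id_blinfun y = 0"
    and "\<exists>C. \<forall>x y. norm (\<psi> x y) \<le> C * (norm x * norm y)"
  using assms unfolding forms_def by blast+

section \<open>The Banach space of bounded forms\<close>

definition form_norm :: "('k::{real_normed_field, banach} op \<Rightarrow> 'k op \<Rightarrow> 'k) \<Rightarrow> real" where
  "form_norm \<psi> = Inf {C. 0 \<le> C \<and> (\<forall>x y. norm (\<psi> x y) \<le> C * (norm x * norm y))}"

lemma form_norm_le:
  assumes "0 \<le> C" "\<And>x y. norm (\<psi> x y) \<le> C * (norm x * norm y)"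
  shows "form_norm \<psi> \<le> C"
  unfolding form_norm_def using assms by (intro cInf_lower bdd_belowI[of _ 0]) auto

lemma form_bounds:
  assumes "\<psi> \<in> forms"
  shows "0 \<le> form_norm \<psi>" and "norm (\<psi> x y) \<le> form_norm \<psi> * (norm x * norm y)"
proof -
  let ?S = "{C. 0 \<le> C \<and> (\<forall>x y. norm (\<psi> x y) \<le> C * (norm x * norm y))}"
  obtain C where C: "\<And>x y. norm (\<psi> x y) \<le> C * (norm x * norm y)" using formsD(7)[OF assms] by blast
  have "norm (\<psi> x y) \<le> \<bar>C\<bar> * (norm x * norm y)" for x y
    by (rule order_trans[OF C mult_right_mono]) auto
  then have ne: "?S \<noteq> {}" by (auto intro!: exI[of _ "\<bar>C\<bar>"])
  show "0 \<le> form_norm \<psi>" unfolding form_norm_def by (rule cInf_greatest[OF ne]) auto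
  show "norm (\<psi> x y) \<le> form_norm \<psi> * (norm x * norm y)"
  proof (cases "norm x * norm y = 0")
    case True
    then show ?thesis using C[of x y] by (simp only: True mult_zero_right)
  next
    case False
    then have pos: "norm x * norm y > 0" by (simp add: order.strict_iff_order)
    have "norm (\<psi> x y) / (norm x * norm y) \<le> form_norm \<psi>"
      unfolding form_norm_def
      by (rule cInf_greatest[OF ne]) (use pos in \<open>simp add: pos_divide_le_eq\<close>)
    then show ?thesis using pos by (simp add: pos_divide_le_eq)
  qed
qed

lemma forms_zero: "(\<lambda>_ _. 0) \<in> forms"
  by (rule formsI[where C = 0]) auto

lemma forms_add:
  assumes "\<psi> \<in> forms" "\<phi> \<in> forms"
  shows "(\<lambda>x y. \<psi> x y + \<phi> x y) \<in> forms"
    and "form_norm (\<lambda>x y. \<psi> x y + \<phi> x y) \<le> form_norm \<psi> + form_norm \<phi>"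
proof -
  have le: "norm (\<psi> x y + \<phi> x y) \<le> (form_norm \<psi> + form_norm \<phi>) * (norm x * norm y)" for x y
    using norm_triangle_ineq[of "\<psi> x y" "\<phi> x y"] form_bounds(2)[OF assms(1), of x y]
      form_bounds(2)[OF assms(2), of x y] by (simp add: distrib_right)
  show "(\<lambda>x y. \<psi> x y + \<phi> x y) \<in> forms"
    by (rule formsI[OF _ _ _ _ _ _ le])
       (simp_all add: formsD[OF assms(1)] formsD[OF assms(2)] distrib_left)
  show "form_norm (\<lambda>x y. \<psi> x y + \<phi> x y) \<le> form_norm \<psi> + form_norm \<phi>"
    by (rule form_norm_le[OF _ le]) (simp add: form_bounds(1) assms)
qed

lemma forms_smult:
  assumes "\<psi> \<in> forms"
  shows "(\<lambda>x y. c * \<psi> x y) \<in> forms" and "form_norm (\<lambda>x y. c * \<psi> x y) = norm c * form_norm \<psi>"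
proof -
  have le: "norm (c * \<psi> x y) \<le> (norm c * form_norm \<psi>) * (norm x * norm y)" for c x y
    using mult_left_mono[OF form_bounds(2)[OF assms, of x y], of "norm c"] by (simp add: norm_mult mult.assoc)
  show *: "(\<lambda>x y. c * \<psi> x y) \<in> forms"
    by (rule formsI[OF _ _ _ _ _ _ le]) (simp_all add: formsD[OF assms] distrib_left)
  show "form_norm (\<lambda>x y. c * \<psi> x y) = norm c * form_norm \<psi>"
  proof (rule antisym)
    show "form_norm (\<lambda>x y. c * \<psi> x y) \<le> norm c * form_norm \<psi>"
      by (rule form_norm_le[OF _ le]) (simp add: form_bounds(1) assms)
    show "norm c * form_norm \<psi> \<le> form_norm (\<lambda>x y. c * \<psi> x y)"
    proof (cases "c = 0")
      case False
      have "form_norm \<psi> \<le> form_norm (\<lambda>x y. c * \<psi> x y) / norm c"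
      proof (rule form_norm_le)
        show "norm (\<psi> x y) \<le> form_norm (\<lambda>x y. c * \<psi> x y) / norm c * (norm x * norm y)" for x y
          using form_bounds(2)[OF *, of x y] False
          by (simp add: norm_mult field_simps)
      qed (simp add: form_bounds(1)[OF *])
      then show ?thesis using False by (simp add: field_simps)
    qed (simp add: form_bounds(1)[OF forms_zero])
  qed
qed

lemma forms_diff: "\<psi> \<in> forms \<Longrightarrow> \<phi> \<in> forms \<Longrightarrow> (\<lambda>x y. \<psi> x y - \<phi> x y) \<in> forms"
  using forms_add(1)[of \<psi> "\<lambda>x y. - 1 * \<phi> x y"] forms_smult(1)[of \<phi> "- 1"] by simp

lemma form_norm_eq_0:
  assumes "\<psi> \<in> forms"
  shows "form_norm \<psi> = 0 \<longleftrightarrow> \<psi> = (\<lambda>_ _. 0)"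
proof
  assume "form_norm \<psi> = 0"
  then show "\<psi> = (\<lambda>_ _. 0)" using form_bounds(2)[OF assms] by (intro ext) simp
next
  assume "\<psi> = (\<lambda>_ _. 0)"
  then have "form_norm \<psi> \<le> 0" by (intro form_norm_le) auto
  then show "form_norm \<psi> = 0" using form_bounds(1)[OF assms] by simp
qed

lemma forms_complete:
  fixes \<psi> :: "nat \<Rightarrow> 'k::{real_normed_field, banach} op \<Rightarrow> 'k op \<Rightarrow> 'k"
  assumes \<psi>: "\<And>n. \<psi> n \<in> forms"
    and cauchy: "\<And>e. e > 0 \<Longrightarrow> \<exists>M. \<forall>m\<ge>M. \<forall>n\<ge>M. form_norm (\<lambda>x y. \<psi> m x y - \<psi> n x y) < e"
  shows "\<exists>\<phi>\<in>forms. (\<lambda>n. form_norm (\<lambda>x y. \<psi> n x y - \<phi> x y)) \<longlonglongrightarrow> 0"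
proof -
  have le: "norm (\<psi> m x y - \<psi> n x y) \<le> form_norm (\<lambda>x y. \<psi> m x y - \<psi> n x y) * (norm x * norm y)" for m n x y
    by (rule form_bounds(2)[OF forms_diff[OF \<psi> \<psi>]])
  have "Cauchy (\<lambda>n. \<psi> n x y)" for x y
  proof (rule CauchyI)
    fix e :: real assume e: "e > 0"
    let ?t = "norm x * norm y"
    have t: "?t + 1 > 0" by (intro add_nonneg_pos mult_nonneg_nonneg) auto
    then obtain M where M: "\<forall>m\<ge>M. \<forall>n\<ge>M. form_norm (\<lambda>x y. \<psi> m x y - \<psi> n x y) < e / (?t + 1)"
      using cauchy[of "e / (?t + 1)"] e by auto
    have "norm (\<psi> m x y - \<psi> n x y) < e" if "m \<ge> M" "n \<ge> M" for m n
    proof -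
      have "norm (\<psi> m x y - \<psi> n x y) \<le> (e / (?t + 1)) * ?t"
        using M that by (intro order_trans[OF le] mult_right_mono) (auto intro: less_imp_le)
      also have "\<dots> < e" using e t by (simp add: field_simps)
      finally show ?thesis .
    qed
    then show "\<exists>M. \<forall>m\<ge>M. \<forall>n\<ge>M. norm (\<psi> m x y - \<psi> n x y) < e" by blast
  qed
  then have "\<exists>l. (\<lambda>n. \<psi> n x y) \<longlonglongrightarrow> l" for x y
    using Cauchy_convergent convergent_def by blast
  then obtain \<phi> where \<phi>: "\<And>x y. (\<lambda>n. \<psi> n x y) \<longlonglongrightarrow> \<phi> x y" by metis
  have close: "norm (\<psi> n x y - \<phi> x y) \<le> e * (norm x * norm y)"
    if "\<forall>m\<ge>M. \<forall>n\<ge>M. form_norm (\<lambda>x y. \<psi> m x y - \<psi> n x y) < e" "n \<ge> M" for e M n x y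
  proof (rule LIMSEQ_le_const2)
    show "(\<lambda>m. norm (\<psi> n x y - \<psi> m x y)) \<longlonglongrightarrow> norm (\<psi> n x y - \<phi> x y)"
      by (intro tendsto_intros \<phi>)
    have "norm (\<psi> n x y - \<psi> m x y) \<le> e * (norm x * norm y)" if "m \<ge> M" for m
      using \<open>\<forall>m\<ge>M. \<forall>n\<ge>M. form_norm (\<lambda>x y. \<psi> m x y - \<psi> n x y) < e\<close> \<open>n \<ge> M\<close> that
      by (intro order_trans[OF le] mult_right_mono) (auto intro: less_imp_le)
    then show "\<exists>N. \<forall>m\<ge>N. norm (\<psi> n x y - \<psi> m x y) \<le> e * (norm x * norm y)" by blast
  qed
  have "\<phi> \<in> forms"
  proof -
    obtain M where M: "\<forall>m\<ge>M. \<forall>n\<ge>M. form_norm (\<lambda>x y. \<psi> m x y - \<psi> n x y) < 1" using cauchy[of 1] by auto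
    have bound: "norm (\<phi> x y) \<le> (form_norm (\<psi> M) + 1) * (norm x * norm y)" for x y
      using norm_triangle_ineq3[of "\<psi> M x y" "\<phi> x y"] close[OF M order_refl, of x y]
        form_bounds(2)[OF \<psi>[of M], of x y] by (simp add: distrib_right)
    show ?thesis
    proof (rule formsI[OF _ _ _ _ _ _ bound])
      show "\<phi> x y = 0" if "\<not> (klinear x \<and> klinear y)" for x y
        using \<phi>[of x y] formsD(1)[OF \<psi> that] by (simp add: LIMSEQ_const_iff)
      show "\<phi> id_blinfun y = 0" for y
        using \<phi>[of id_blinfun y] formsD(6)[OF \<psi>] by (simp add: LIMSEQ_const_iff)
      fix x x' y y' :: "'k op" and c
      assume x: "klinear x" and y: "klinear y"
      show "\<phi> (scale_op scale_tsirelson c x) y = c * \<phi> x y"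
        using LIMSEQ_unique[OF \<phi>[of "scale_op scale_tsirelson c x" y]] tendsto_mult_left[OF \<phi>[of x y], of c]
        by (simp add: formsD(4)[OF \<psi> x y])
      show "\<phi> x (scale_op scale_tsirelson c y) = c * \<phi> x y"
        using LIMSEQ_unique[OF \<phi>[of x "scale_op scale_tsirelson c y"]] tendsto_mult_left[OF \<phi>[of x y], of c]
        by (simp add: formsD(5)[OF \<psi> x y])
      show "\<phi> (x + x') y = \<phi> x y + \<phi> x' y" if x': "klinear x'"
        using LIMSEQ_unique[OF \<phi>[of "x + x'" y]] tendsto_add[OF \<phi>[of x y] \<phi>[of x' y]]
        by (simp add: formsD(2)[OF \<psi> x x' y])
      show "\<phi> x (y + y') = \<phi> x y + \<phi> x y'" if y': "klinear y'"
        using LIMSEQ_unique[OF \<phi>[of x "y + y'"]] tendsto_add[OF \<phi>[of x y] \<phi>[of x y']]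
        by (simp add: formsD(3)[OF \<psi> x y y'])
    qed
  qed
  moreover have "(\<lambda>n. form_norm (\<lambda>x y. \<psi> n x y - \<phi> x y)) \<longlonglongrightarrow> 0"
  proof (rule LIMSEQ_I)
    fix e :: real assume e: "e > 0"
    then obtain M where M: "\<forall>m\<ge>M. \<forall>n\<ge>M. form_norm (\<lambda>x y. \<psi> m x y - \<psi> n x y) < e / 2"
      using cauchy[of "e / 2"] by auto
    have "norm (form_norm (\<lambda>x y. \<psi> n x y - \<phi> x y) - 0) < e" if "n \<ge> M" for n
    proof -
      have "form_norm (\<lambda>x y. \<psi> n x y - \<phi> x y) \<le> e / 2"
        by (rule form_norm_le) (use e close[OF M that] in auto)
      then show ?thesis using e form_bounds(1)[OF forms_diff[OF \<psi> \<open>\<phi> \<in> forms\<close>], of n] by simp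
    qed
    then show "\<exists>M. \<forall>n\<ge>M. norm (form_norm (\<lambda>x y. \<psi> n x y - \<phi> x y) - 0) < e" by blast
  qed
  ultimately show ?thesis by blast
qed

section \<open>The module actions on forms\<close>

definition form_lact :: "'k::{real_normed_field, banach} op \<Rightarrow> ('k op \<Rightarrow> 'k op \<Rightarrow> 'k) \<Rightarrow> 'k op \<Rightarrow> 'k op \<Rightarrow> 'k" where
  "form_lact a \<psi> = (\<lambda>x y. if klinear x \<and> klinear y then \<psi> x (y o\<^sub>L a) else 0)"

text \<open>The right action turns \<open>F\<close> into \<open>\<xi> \<mapsto> F (a \<xi>)\<close>,
  and \<open>a x \<otimes> y - a \<otimes> x y = (a x \<otimes> y - 1 \<otimes> a x y) - (a
  \<otimes> x y - 1 \<otimes> a x y)\<close>; hence the second term. For the left action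
  \<open>x \<otimes> y a - 1 \<otimes> x y a\<close> already has the required shape.\<close>

definition form_ract :: "('k::{real_normed_field, banach} op \<Rightarrow> 'k op \<Rightarrow> 'k) \<Rightarrow> 'k op \<Rightarrow> 'k op \<Rightarrow> 'k op \<Rightarrow> 'k" where
  "form_ract \<psi> a = (\<lambda>x y. if klinear x \<and> klinear y then \<psi> (a o\<^sub>L x) y - \<psi> a (x o\<^sub>L y) else 0)"

lemma forms_lact:
  assumes \<psi>: "\<psi> \<in> forms" and a: "klinear a"
  shows "form_lact a \<psi> \<in> forms" and "form_norm (form_lact a \<psi>) \<le> 2 * norm a * form_norm \<psi>"
proof -
  have "norm (\<psi> x (y o\<^sub>L a)) \<le> (norm a * form_norm \<psi>) * (norm x * norm y)" for x y
  proof -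
    have "norm (\<psi> x (y o\<^sub>L a)) \<le> form_norm \<psi> * (norm x * norm (y o\<^sub>L a))" by (rule form_bounds(2)[OF \<psi>])
    also have "\<dots> \<le> form_norm \<psi> * (norm x * (norm y * norm a))"
      by (intro mult_left_mono norm_blinfun_compose form_bounds(1)[OF \<psi>]) auto
    finally show ?thesis by (simp only: mult_ac)
  qed
  moreover have nn: "0 \<le> norm a * form_norm \<psi>" using form_bounds(1)[OF \<psi>] by simp
  ultimately have le: "norm (form_lact a \<psi> x y) \<le> (norm a * form_norm \<psi>) * (norm x * norm y)" for x y
    by (simp add: form_lact_def)
  show "form_lact a \<psi> \<in> forms"
  proof (rule formsI[OF _ _ _ _ _ _ le])
    show "form_lact a \<psi> x y = 0" if "\<not> (klinear x \<and> klinear y)" for x y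
      using that by (auto simp: form_lact_def)
  qed (simp_all add: form_lact_def klinear_add klinear_smult klinear_compose a compose_add compose_smult formsD[OF \<psi>])
  show "form_norm (form_lact a \<psi>) \<le> 2 * norm a * form_norm \<psi>"
    using form_norm_le[OF nn le] nn by simp
qed

lemma forms_ract:
  assumes \<psi>: "\<psi> \<in> forms" and a: "klinear a"
  shows "form_ract \<psi> a \<in> forms" and "form_norm (form_ract \<psi> a) \<le> 2 * norm a * form_norm \<psi>"
proof -
  have nn: "0 \<le> 2 * norm a * form_norm \<psi>" using form_bounds(1)[OF \<psi>] by simp
  have "norm (\<psi> (a o\<^sub>L x) y - \<psi> a (x o\<^sub>L y)) \<le> (2 * norm a * form_norm \<psi>) * (norm x * norm y)" for x y
  proof -
    have "norm (\<psi> (a o\<^sub>L x) y) \<le> form_norm \<psi> * (norm (a o\<^sub>L x) * norm y)" by (rule form_bounds(2)[OF \<psi>])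
    also have "\<dots> \<le> form_norm \<psi> * ((norm a * norm x) * norm y)"
      by (intro mult_left_mono mult_right_mono norm_blinfun_compose form_bounds(1)[OF \<psi>]) auto
    finally have 1: "norm (\<psi> (a o\<^sub>L x) y) \<le> form_norm \<psi> * (norm a * norm x * norm y)" .
    have "norm (\<psi> a (x o\<^sub>L y)) \<le> form_norm \<psi> * (norm a * norm (x o\<^sub>L y))" by (rule form_bounds(2)[OF \<psi>])
    also have "\<dots> \<le> form_norm \<psi> * (norm a * (norm x * norm y))"
      by (intro mult_left_mono norm_blinfun_compose form_bounds(1)[OF \<psi>]) auto
    finally have 2: "norm (\<psi> a (x o\<^sub>L y)) \<le> form_norm \<psi> * (norm a * norm x * norm y)" by (simp only: mult.assoc)
    have "norm (\<psi> (a o\<^sub>L x) y - \<psi> a (x o\<^sub>L y)) \<le> norm (\<psi> (a o\<^sub>L x) y) + norm (\<psi> a (x o\<^sub>L y))"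
      by (rule norm_triangle_ineq4)
    also have "\<dots> \<le> 2 * (form_norm \<psi> * (norm a * norm x * norm y))" using 1 2 by linarith
    finally show ?thesis by (simp only: mult_ac)
  qed
  then have le: "norm (form_ract \<psi> a x y) \<le> (2 * norm a * form_norm \<psi>) * (norm x * norm y)" for x y
    using nn by (simp add: form_ract_def)
  show "form_ract \<psi> a \<in> forms"
  proof (rule formsI[OF _ _ _ _ _ _ le])
    show "form_ract \<psi> a x y = 0" if "\<not> (klinear x \<and> klinear y)" for x y
      using that by (auto simp: form_ract_def)
  qed (simp_all add: form_ract_def klinear_add klinear_smult klinear_compose klinear_id a compose_add compose_smult
          formsD[OF \<psi>] algebra_simps)
  show "form_norm (form_ract \<psi> a) \<le> 2 * norm a * form_norm \<psi>"
    by (rule form_norm_le[OF nn le])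
qed

text \<open>The forms are wrapped in singletons, as \<open>amenable\<close> requires this type of the carrier.\<close>

definition form_module ::
  "('k::{real_normed_field, banach}, 'k op, ('k op \<Rightarrow> 'k op \<Rightarrow> 'k) set) bimodule" where
  "form_module =
     \<lparr>carrier = (\<lambda>\<psi>. {\<psi>}) ` forms,
      mult = undefined, one = undefined,
      zero = {\<lambda>_ _. 0},
      add = (\<lambda>S R. {\<lambda>x y. the_elem S x y + the_elem R x y}),
      smult = (\<lambda>c S. {\<lambda>x y. c * the_elem S x y}),
      nrm = (\<lambda>S. form_norm (the_elem S)),
      lact = (\<lambda>a S. {form_lact a (the_elem S)}),
      ract = (\<lambda>S a. {form_ract (the_elem S) a})\<rparr>"

lemma abelian_group_form_module: "abelian_group form_module"
proof (rule abelian_groupI)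
  fix S :: "('a op \<Rightarrow> 'a op \<Rightarrow> 'a) set"
  assume "S \<in> carrier form_module"
  then obtain \<psi> where "S = {\<psi>}" "\<psi> \<in> forms" by (auto simp: form_module_def)
  then show "\<exists>R\<in>carrier form_module. R \<oplus>\<^bsub>form_module\<^esub> S = \<zero>\<^bsub>form_module\<^esub>"
    using forms_smult(1)[of \<psi> "- 1"] by (intro bexI[of _ "{\<lambda>x y. - 1 * \<psi> x y}"]) (auto simp: form_module_def)
qed (auto simp: form_module_def forms_zero forms_add add_ac)

lemma form_module_minus:
  assumes "\<psi> \<in> forms" "\<phi> \<in> forms"
  shows "{\<psi>} \<ominus>\<^bsub>form_module\<^esub> {\<phi>} = {\<lambda>x y. \<psi> x y - \<phi> x y}"
proof -
  have "\<ominus>\<^bsub>form_module\<^esub> {\<phi>} = {\<lambda>x y. - 1 * \<phi> x y}"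
    by (rule abelian_group.minus_equality[OF abelian_group_form_module])
       (use assms forms_smult(1)[of \<phi> "- 1"] in \<open>auto simp: form_module_def\<close>)
  then show ?thesis by (simp add: a_minus_def form_module_def)
qed

lemma banach_space_form_module: "banach_space form_module"
  unfolding banach_space_def
proof (intro conjI allI impI ballI)
  show "Module.module scalars (form_module :: ('a, 'a op, _) bimodule)"
    by (rule Module.moduleI[OF cring_scalars abelian_group_form_module])
       (auto simp: form_module_def scalars_def forms_smult algebra_simps)
next
  fix S :: "('a op \<Rightarrow> 'a op \<Rightarrow> 'a) set" assume "S \<in> carrier form_module"
  then show "(nrm form_module S = 0) = (S = \<zero>\<^bsub>form_module\<^esub>)"
    by (auto simp: form_module_def form_norm_eq_0)
next
  fix S R :: "('a op \<Rightarrow> 'a op \<Rightarrow> 'a) set" assume "S \<in> carrier form_module" "R \<in> carrier form_module"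
  then show "nrm form_module (S \<oplus>\<^bsub>form_module\<^esub> R) \<le> nrm form_module S + nrm form_module R"
    by (auto simp: form_module_def intro: forms_add)
next
  fix c and S :: "('a op \<Rightarrow> 'a op \<Rightarrow> 'a) set" assume "S \<in> carrier form_module"
  then show "nrm form_module (c \<odot>\<^bsub>form_module\<^esub> S) = norm c * nrm form_module S"
    by (auto simp: form_module_def forms_smult)
next
  fix X :: "nat \<Rightarrow> ('a op \<Rightarrow> 'a op \<Rightarrow> 'a) set"
  assume *: "range X \<subseteq> carrier form_module \<and>
    (\<forall>e>0. \<exists>M. \<forall>m\<ge>M. \<forall>n\<ge>M. nrm form_module (X m \<ominus>\<^bsub>form_module\<^esub> X n) < e)"
  define \<psi> where "\<psi> n = the_elem (X n)" for n
  have X: "X n = {\<psi> n} \<and> \<psi> n \<in> forms" for n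
  proof -
    have "X n \<in> carrier form_module" using * by blast
    then obtain \<phi> where "X n = {\<phi>}" "\<phi> \<in> forms" by (auto simp: form_module_def)
    then show ?thesis by (simp add: \<psi>_def)
  qed
  have nrm: "nrm form_module ({\<psi>'} \<ominus>\<^bsub>form_module\<^esub> {\<phi>}) = form_norm (\<lambda>x y. \<psi>' x y - \<phi> x y)"
    if "\<psi>' \<in> forms" "\<phi> \<in> forms" for \<psi>' \<phi> :: "'a op \<Rightarrow> 'a op \<Rightarrow> 'a"
    unfolding form_module_minus[OF that] by (simp add: form_module_def)
  have "\<exists>\<phi>\<in>forms. (\<lambda>n. form_norm (\<lambda>x y. \<psi> n x y - \<phi> x y)) \<longlonglongrightarrow> 0"
    by (rule forms_complete) (use * X nrm in auto)
  then obtain \<phi> where \<phi>: "\<phi> \<in> forms" "(\<lambda>n. form_norm (\<lambda>x y. \<psi> n x y - \<phi> x y)) \<longlonglongrightarrow> 0" by blast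
  show "\<exists>S\<in>carrier form_module. (\<lambda>n. nrm form_module (X n \<ominus>\<^bsub>form_module\<^esub> S)) \<longlonglongrightarrow> 0"
  proof (rule bexI[of _ "{\<phi>}"])
    show "(\<lambda>n. nrm form_module (X n \<ominus>\<^bsub>form_module\<^esub> {\<phi>})) \<longlonglongrightarrow> 0"
      using \<phi> X nrm by simp
    show "{\<phi>} \<in> carrier form_module" using \<phi> by (simp add: form_module_def)
  qed
qed

lemma linear_map_form_module:
  assumes "\<And>\<psi>. \<psi> \<in> forms \<Longrightarrow> F \<psi> \<in> forms" "\<And>\<psi>. \<psi> \<in> forms \<Longrightarrow> G {\<psi>} = {F \<psi>}"
    and "\<And>\<psi> \<phi>. \<psi> \<in> forms \<Longrightarrow> \<phi> \<in> forms \<Longrightarrow> F (\<lambda>x y. \<psi> x y + \<phi> x y) = (\<lambda>x y. F \<psi> x y + F \<phi> x y)"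
    and "\<And>c \<psi>. \<psi> \<in> forms \<Longrightarrow> F (\<lambda>x y. c * \<psi> x y) = (\<lambda>x y. c * F \<psi> x y)"
  shows "linear_map form_module form_module G"
  unfolding linear_map_def using assms
  by (auto simp: form_module_def forms_add(1) forms_smult(1))

lemma linear_map_to_form_module:
  assumes "\<And>a. klinear a \<Longrightarrow> F a \<in> forms" "\<And>a. klinear a \<Longrightarrow> G a = {F a}"
    and "\<And>a b. klinear a \<Longrightarrow> klinear b \<Longrightarrow> F (a + b) = (\<lambda>x y. F a x y + F b x y)"
    and "\<And>c a. klinear a \<Longrightarrow> F (scale_op scale_tsirelson c a) = (\<lambda>x y. c * F a x y)"
  shows "linear_map (approximable_algebra scale_tsirelson) form_module G"
proof -
  let ?A = "approximable_algebra scale_tsirelson :: ('a, 'a op) normed_space"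
  have "a \<oplus>\<^bsub>?A\<^esub> b = a + b" "c \<odot>\<^bsub>?A\<^esub> a = scale_op scale_tsirelson c a" for a b c
    by (simp_all add: approximable_algebra_def)
  then show ?thesis
    unfolding linear_map_def using assms
    by (auto simp: form_module_def klinear_AT klinear_add klinear_smult)
qed

lemma banach_bimodule_form_module:
  "banach_bimodule (approximable_algebra scale_tsirelson) form_module"
proof -
  let ?A = "approximable_algebra scale_tsirelson :: ('a, 'a op) normed_space"
  have ops: "a \<otimes>\<^bsub>?A\<^esub> b = a o\<^sub>L b" "a \<oplus>\<^bsub>?A\<^esub> b = a + b" "c \<odot>\<^bsub>?A\<^esub> a = scale_op scale_tsirelson c a"
    "nrm ?A a = norm a" for a b c
    by (simp_all add: approximable_algebra_def)
  have mod: "carrier form_module = (\<lambda>\<psi>. {\<psi>}) ` (forms :: ('a op \<Rightarrow> _) set)"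
    "{\<psi>} \<oplus>\<^bsub>form_module\<^esub> {\<phi>} = {\<lambda>x y. \<psi> x y + \<phi> x y}"
    "c \<odot>\<^bsub>form_module\<^esub> {\<psi>} = {\<lambda>x y. c * \<psi> x y}"
    "lact form_module a {\<psi>} = {form_lact a \<psi>}" "ract form_module {\<psi>} a = {form_ract \<psi> a}"
    "nrm form_module {\<psi>} = form_norm \<psi>" for \<psi> \<phi> :: "'a op \<Rightarrow> 'a op \<Rightarrow> 'a" and a c
    by (simp_all add: form_module_def)
  note kl = klinear_AT klinear_add klinear_smult klinear_compose
  show ?thesis
    unfolding banach_bimodule_def
  proof (intro conjI ballI banach_space_form_module)
    fix a assume "a \<in> carrier ?A"
    then have a: "klinear a" by (rule klinear_AT)
    show "linear_map form_module form_module (lact form_module a)"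
      by (rule linear_map_form_module[of "form_lact a"])
         (use a in \<open>simp_all add: forms_lact(1) mod, simp_all add: form_lact_def fun_eq_iff\<close>)
    show "linear_map form_module form_module (\<lambda>S. ract form_module S a)"
      by (rule linear_map_form_module[of "\<lambda>\<psi>. form_ract \<psi> a"])
         (use a in \<open>simp_all add: forms_ract(1) mod, simp_all add: form_ract_def fun_eq_iff algebra_simps\<close>)
  next
    fix S assume "S \<in> carrier (form_module :: ('a, 'a op, _) bimodule)"
    then obtain \<psi> where S: "S = {\<psi>}" and \<psi>: "\<psi> \<in> forms" by (auto simp: mod)
    show "linear_map ?A form_module (\<lambda>a. lact form_module a S)"
      by (rule linear_map_to_form_module[of "\<lambda>a. form_lact a \<psi>"])
         (use \<psi> in \<open>simp_all add: forms_lact(1) mod S\<close>,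
          simp_all add: form_lact_def fun_eq_iff compose_add compose_smult klinear_compose formsD[OF \<psi>])
    show "linear_map ?A form_module (ract form_module S)"
      by (rule linear_map_to_form_module[of "form_ract \<psi>"])
         (use \<psi> in \<open>simp_all add: forms_ract(1) mod S\<close>,
          simp_all add: form_ract_def fun_eq_iff compose_add compose_smult klinear_compose formsD[OF \<psi>] algebra_simps)
  next
    fix a b and S :: "('a op \<Rightarrow> 'a op \<Rightarrow> 'a) set"
    assume a: "a \<in> carrier ?A" and b: "b \<in> carrier ?A" and "S \<in> carrier form_module"
    then obtain \<psi> where S: "S = {\<psi>}" and \<psi>: "\<psi> \<in> forms" by (auto simp: mod)
    show "lact form_module (a \<otimes>\<^bsub>?A\<^esub> b) S = lact form_module a (lact form_module b S)"
      using klinear_AT[OF a] klinear_AT[OF b]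
      by (auto simp: S mod ops form_lact_def compose_assoc klinear_compose intro!: ext)
    show "ract form_module S (a \<otimes>\<^bsub>?A\<^esub> b) = ract form_module (ract form_module S a) b"
      using klinear_AT[OF a] klinear_AT[OF b]
      by (auto simp: S mod ops form_ract_def compose_assoc klinear_compose intro!: ext)
    show "ract form_module (lact form_module a S) b = lact form_module a (ract form_module S b)"
      using klinear_AT[OF a] klinear_AT[OF b]
      by (auto simp: S mod ops form_ract_def form_lact_def compose_assoc klinear_compose intro!: ext)
  next
    show "\<exists>C. \<forall>a\<in>carrier ?A. \<forall>S\<in>carrier form_module.
      nrm form_module (lact form_module a S) \<le> C * nrm ?A a * nrm form_module S \<and>
      nrm form_module (ract form_module S a) \<le> C * nrm ?A a * nrm form_module S"
      by (intro exI[of _ 2]) (auto simp: mod ops intro: forms_lact(2) forms_ract(2) klinear_AT)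
  qed
qed


section \<open>Non-amenability\<close>

lemma dual_form_moduleD:
  assumes "M \<in> carrier (dual_bimodule (form_module :: ('k::{real_normed_field, banach}, 'k op, _) bimodule))"
  shows "\<And>\<psi> \<phi>. \<psi> \<in> forms \<Longrightarrow> \<phi> \<in> forms \<Longrightarrow> M {\<lambda>x y. \<psi> x y + \<phi> x y} = M {\<psi>} + M {\<phi>}"
    and "\<And>c \<psi>. \<psi> \<in> forms \<Longrightarrow> M {\<lambda>x y. c * \<psi> x y} = c * M {\<psi>}"
    and "\<exists>K\<ge>0. \<forall>\<psi>\<in>forms. norm (M {\<psi>}) \<le> K * form_norm \<psi>"
proof -
  have M: "linear_map form_module scalar_space M" "bounded_map form_module scalar_space M"
    using assms by (auto simp: dual_bimodule_def)
  show "M {\<lambda>x y. \<psi> x y + \<phi> x y} = M {\<psi>} + M {\<phi>}" if "\<psi> \<in> forms" "\<phi> \<in> forms" for \<psi> \<phi>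
    using M(1) that by (force simp: linear_map_def form_module_def scalar_space_def)
  show "M {\<lambda>x y. c * \<psi> x y} = c * M {\<psi>}" if "\<psi> \<in> forms" for c \<psi>
    using M(1) that by (force simp: linear_map_def form_module_def scalar_space_def)
  obtain K where K: "\<And>\<psi>. \<psi> \<in> forms \<Longrightarrow> norm (M {\<psi>}) \<le> K * form_norm \<psi>"
    using M(2) by (auto simp: bounded_map_def form_module_def scalar_space_def)
  have "norm (M {\<psi>}) \<le> \<bar>K\<bar> * form_norm \<psi>" if "\<psi> \<in> forms" for \<psi>
    by (rule order_trans[OF K[OF that] mult_right_mono]) (auto simp: form_bounds(1)[OF that])
  then show "\<exists>K\<ge>0. \<forall>\<psi>\<in>forms. norm (M {\<psi>}) \<le> K * form_norm \<psi>" by (intro exI[of _ "\<bar>K\<bar>"]) auto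
qed

lemma dual_form_moduleI:
  assumes add: "\<And>\<psi> \<phi>. \<psi> \<in> forms \<Longrightarrow> \<phi> \<in> forms \<Longrightarrow> f (\<lambda>x y. \<psi> x y + \<phi> x y) = f \<psi> + f \<phi>"
    and hom: "\<And>c \<psi>. \<psi> \<in> forms \<Longrightarrow> f (\<lambda>x y. c * \<psi> x y) = c * f \<psi>"
    and bound: "\<And>\<psi>. \<psi> \<in> forms \<Longrightarrow> norm (f \<psi>) \<le> K * form_norm \<psi>"
  shows "(\<lambda>S\<in>carrier form_module. f (the_elem S)) \<in> carrier (dual_bimodule form_module)"
proof -
  have "linear_map form_module scalar_space (\<lambda>S\<in>carrier form_module. f (the_elem S))"
    unfolding linear_map_def using add hom
    by (auto simp: form_module_def scalar_space_def forms_add(1) forms_smult(1))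
  moreover have "bounded_map form_module scalar_space (\<lambda>S\<in>carrier form_module. f (the_elem S))"
    unfolding bounded_map_def using bound by (auto simp: form_module_def scalar_space_def)
  ultimately show ?thesis by (simp add: dual_bimodule_def)
qed

text \<open>Subtraction in the record goes through the abstract inverse of the group, so it is
  evaluated by adding \<open>g\<close> back.\<close>

lemma dual_form_module_minus:
  assumes f: "f \<in> carrier (dual_bimodule form_module)" and g: "g \<in> carrier (dual_bimodule form_module)"
    and \<psi>: "\<psi> \<in> forms"
  shows "(f \<ominus>\<^bsub>dual_bimodule form_module\<^esub> g) {\<psi>} = f {\<psi>} - g {\<psi>}"
proof -
  interpret abelian_group "dual_bimodule form_module"
    by (rule abelian_group_dual[OF banach_space_form_module])
  have S: "{\<psi>} \<in> carrier form_module" using \<psi> by (simp add: form_module_def)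
  let ?h = "f \<ominus>\<^bsub>dual_bimodule form_module\<^esub> g"
  have "?h \<oplus>\<^bsub>dual_bimodule form_module\<^esub> g = f"
    using f g by (simp add: a_minus_def a_assoc l_neg)
  then have "(?h \<oplus>\<^bsub>dual_bimodule form_module\<^esub> g) {\<psi>} = f {\<psi>}" by simp
  then show ?thesis using S by (simp add: dual_bimodule_def algebra_simps)
qed

text \<open>
  The derivation is \<open>a \<mapsto> a \<otimes> 1 - 1 \<otimes> a\<close>; its inner implementation \<open>\<mu>\<close> would be the difference
  of \<open>1 \<otimes> 1\<close> and a virtual diagonal.
\<close>

lemma amenable_imp_functional:
  assumes "amenable (approximable_algebra (scale_tsirelson :: 'k::{real_normed_field, banach} \<Rightarrow> _))"
  obtains \<mu> :: "('k::{real_normed_field, banach} op \<Rightarrow> 'k op \<Rightarrow> 'k) \<Rightarrow> 'k" and K :: real where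
    "\<And>\<psi> \<phi>. \<psi> \<in> forms \<Longrightarrow> \<phi> \<in> forms \<Longrightarrow> \<mu> (\<lambda>x y. \<psi> x y + \<phi> x y) = \<mu> \<psi> + \<mu> \<phi>"
    "\<And>c \<psi>. \<psi> \<in> forms \<Longrightarrow> \<mu> (\<lambda>x y. c * \<psi> x y) = c * \<mu> \<psi>"
    "K \<ge> 0" "\<And>\<psi>. \<psi> \<in> forms \<Longrightarrow> norm (\<mu> \<psi>) \<le> K * form_norm \<psi>"
    "\<And>a \<psi>. a \<in> carrier (approximable_algebra scale_tsirelson) \<Longrightarrow> \<psi> \<in> forms \<Longrightarrow>
       \<psi> a id_blinfun = \<mu> (form_ract \<psi> a) - \<mu> (form_lact a \<psi>)"
proof -
  let ?A = "approximable_algebra scale_tsirelson :: ('k, 'k op) normed_space"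
  let ?E = "form_module :: ('k, 'k op, _) bimodule"
  let ?X = "dual_bimodule ?E"
  have ops: "a \<otimes>\<^bsub>?A\<^esub> b = a o\<^sub>L b" "a \<oplus>\<^bsub>?A\<^esub> b = a + b" "c \<odot>\<^bsub>?A\<^esub> a = scale_op scale_tsirelson c a"
    "nrm ?A a = norm a" for a b c
    by (simp_all add: approximable_algebra_def)
  have carr: "S \<in> carrier ?E \<longleftrightarrow> (\<exists>\<psi>\<in>forms. S = {\<psi>})" for S
    by (auto simp: form_module_def)
  \<comment> \<open>\<open>\<psi> a id_blinfun\<close> is the value of the functional
    \<open>F\<close> at \<open>a \<otimes> 1 - 1 \<otimes> a\<close>.\<close>
  define D where "D a = (\<lambda>S\<in>carrier ?E. the_elem S a id_blinfun)" for a
  define L where "L = norm (id_blinfun :: 'k op)"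
  have bound: "norm (\<psi> a id_blinfun) \<le> (L * norm a) * form_norm \<psi>" if "\<psi> \<in> forms"
    for \<psi> :: "'k op \<Rightarrow> 'k op \<Rightarrow> 'k" and a
    using form_bounds(2)[OF that, of a id_blinfun] by (simp only: L_def mult_ac)
  have D_in: "D a \<in> carrier ?X" for a
    unfolding D_def
    by (rule dual_form_moduleI[where f = "\<lambda>\<psi>. \<psi> a id_blinfun" and K = "L * norm a"]) (simp_all add: bound)
  have D_apply: "D a {\<psi>} = \<psi> a id_blinfun" if "\<psi> \<in> forms" for a \<psi>
    using that by (auto simp: D_def carr)
  have act: "lact ?X a f = (\<lambda>S\<in>carrier ?E. f (ract ?E S a))"
    "ract ?X f a = (\<lambda>S\<in>carrier ?E. f (lact ?E a S))"
    "f \<oplus>\<^bsub>?X\<^esub> g = (\<lambda>S\<in>carrier ?E. f S + g S)"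
    "c \<odot>\<^bsub>?X\<^esub> f = (\<lambda>S\<in>carrier ?E. c * f S)" for a f g c
    by (simp_all add: dual_bimodule_def)
  have E_act: "lact ?E a {\<psi>} = {form_lact a \<psi>}" "ract ?E {\<psi>} a = {form_ract \<psi> a}" for a \<psi>
    by (simp_all add: form_module_def)
  have "derivation ?A ?X D"
    unfolding derivation_def linear_map_def
  proof (intro conjI ballI allI funcsetI D_in)
    fix a b assume a: "a \<in> carrier ?A" and b: "b \<in> carrier ?A"
    note kl = klinear_AT[OF a] klinear_AT[OF b] klinear_id
    show "D (a \<oplus>\<^bsub>?A\<^esub> b) = D a \<oplus>\<^bsub>?X\<^esub> D b"
      unfolding act ops D_def
      by (rule restrict_ext) (auto simp: carr formsD(2)[OF _ kl])
    show "D (a \<otimes>\<^bsub>?A\<^esub> b) = lact ?X a (D b) \<oplus>\<^bsub>?X\<^esub> ract ?X (D a) b"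
    proof
      fix S
      show "D (a \<otimes>\<^bsub>?A\<^esub> b) S = (lact ?X a (D b) \<oplus>\<^bsub>?X\<^esub> ract ?X (D a) b) S"
      proof (cases "S \<in> carrier ?E")
        case True
        then obtain \<psi> where S: "S = {\<psi>}" and \<psi>: "\<psi> \<in> forms" by (auto simp: carr)
        \<comment> \<open>Both summands contain \<open>\<psi> a b\<close>, with opposite signs; what
          remains is \<open>\<psi> (a o\<^sub>L b) id_blinfun\<close>.\<close>
        have "(lact ?X a (D b) \<oplus>\<^bsub>?X\<^esub> ract ?X (D a) b) S = form_ract \<psi> a b id_blinfun + form_lact b \<psi> a id_blinfun"
          using True unfolding act S
          by (simp add: E_act D_apply forms_lact(1)[OF \<psi> kl(2)] forms_ract(1)[OF \<psi> kl(1)])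
        then show ?thesis using \<psi> kl by (simp add: S ops D_apply form_ract_def form_lact_def klinear_id)
      next
        case False
        then show ?thesis by (simp add: act D_def)
      qed
    qed
  next
    fix c a assume a: "a \<in> carrier ?A"
    show "D (c \<odot>\<^bsub>?A\<^esub> a) = c \<odot>\<^bsub>?X\<^esub> D a"
      unfolding act ops D_def
      by (rule restrict_ext) (auto simp: carr formsD(4)[OF _ klinear_AT[OF a] klinear_id])
  qed
  moreover have "bounded_map ?A ?X D"
    unfolding bounded_map_def
  proof (intro exI[of _ L] ballI)
    fix a
    have "nrm ?X (D a) = (SUP S\<in>{S\<in>carrier ?E. nrm ?E S \<le> 1}. norm (D a S))"
      by (simp add: dual_bimodule_def)
    also have "\<dots> \<le> L * norm a"
    proof (rule cSUP_least)
      have "{\<lambda>_ _. 0} \<in> {S\<in>carrier ?E. nrm ?E S \<le> 1}"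
        by (auto simp: carr forms_zero) (simp add: form_module_def form_norm_eq_0[OF forms_zero, THEN iffD2])
      then show "{S\<in>carrier ?E. nrm ?E S \<le> 1} \<noteq> {}" by blast
      fix S assume "S \<in> {S\<in>carrier ?E. nrm ?E S \<le> 1}"
      then obtain \<psi> where \<psi>: "\<psi> \<in> forms" "S = {\<psi>}" "form_norm \<psi> \<le> 1"
        by (auto simp: carr) (simp add: form_module_def)
      have "norm (D a S) \<le> (L * norm a) * form_norm \<psi>" using bound[OF \<psi>(1)] by (simp add: D_apply \<psi>)
      also have "\<dots> \<le> (L * norm a) * 1" using \<psi>(3) by (intro mult_left_mono) (auto simp: L_def)
      finally show "norm (D a S) \<le> L * norm a" by simp
    qed
    finally show "nrm ?X (D a) \<le> L * nrm ?A a" by (simp add: ops)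
  qed
  ultimately have "inner_derivation ?A ?X D"
    using assms banach_bimodule_form_module unfolding amenable_def by blast
  then obtain M where M: "M \<in> carrier ?X" "\<And>a. a \<in> carrier ?A \<Longrightarrow> D a = lact ?X a M \<ominus>\<^bsub>?X\<^esub> ract ?X M a"
    unfolding inner_derivation_def by blast
  note MD = dual_form_moduleD[OF M(1)]
  obtain K where K: "K \<ge> 0" "\<And>\<psi>. \<psi> \<in> forms \<Longrightarrow> norm (M {\<psi>}) \<le> K * form_norm \<psi>" using MD(3) by blast
  show thesis
  proof (rule that[of "\<lambda>\<psi>. M {\<psi>}" K])
    fix a and \<psi> :: "'k op \<Rightarrow> 'k op \<Rightarrow> 'k"
    assume a: "a \<in> carrier ?A" and \<psi>: "\<psi> \<in> forms"
    note kl = klinear_AT[OF a]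
    have l: "lact ?X a M = (\<lambda>S\<in>carrier ?E. M {form_ract (the_elem S) a})"
      unfolding act by (rule restrict_ext) (auto simp: carr E_act)
    have r: "ract ?X M a = (\<lambda>S\<in>carrier ?E. M {form_lact a (the_elem S)})"
      unfolding act by (rule restrict_ext) (auto simp: carr E_act)
    \<comment> \<open>Both translates of \<open>M\<close> have to be shown to lie in the dual,
      because \<open>dual_form_module_minus\<close> evaluates differences only on its
      carrier.\<close>
    have "K * form_norm (form_ract \<psi> a) \<le> K * (2 * norm a * form_norm \<psi>)"
      "K * form_norm (form_lact a \<psi>) \<le> K * (2 * norm a * form_norm \<psi>)" if "\<psi> \<in> forms"
      for \<psi> :: "'k op \<Rightarrow> 'k op \<Rightarrow> 'k"
      using K(1) forms_ract(2)[OF that kl] forms_lact(2)[OF that kl] by (auto intro: mult_left_mono)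
    then have b: "norm (M {form_ract \<psi> a}) \<le> (K * 2 * norm a) * form_norm \<psi>"
      "norm (M {form_lact a \<psi>}) \<le> (K * 2 * norm a) * form_norm \<psi>" if "\<psi> \<in> forms"
      for \<psi> :: "'k op \<Rightarrow> 'k op \<Rightarrow> 'k"
      using K(2)[OF forms_ract(1)[OF that kl]] K(2)[OF forms_lact(1)[OF that kl]] that
      by (fastforce simp: mult.assoc)+
    have "lact ?X a M \<in> carrier ?X"
      unfolding l
    proof (rule dual_form_moduleI[OF _ _ b(1)])
      fix \<phi> \<psi> :: "'k op \<Rightarrow> 'k op \<Rightarrow> 'k" and c assume f: "\<phi> \<in> forms" "\<psi> \<in> forms"
      have "form_ract (\<lambda>x y. \<psi> x y + \<phi> x y) a = (\<lambda>x y. form_ract \<psi> a x y + form_ract \<phi> a x y)"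
        by (simp add: form_ract_def fun_eq_iff)
      then show "M {form_ract (\<lambda>x y. \<psi> x y + \<phi> x y) a} = M {form_ract \<psi> a} + M {form_ract \<phi> a}"
        using MD(1) f kl by (simp add: forms_ract(1))
    next
      fix \<psi> :: "'k op \<Rightarrow> 'k op \<Rightarrow> 'k" and c assume f: "\<psi> \<in> forms"
      have "form_ract (\<lambda>x y. c * \<psi> x y) a = (\<lambda>x y. c * form_ract \<psi> a x y)"
        by (simp add: form_ract_def fun_eq_iff algebra_simps)
      then show "M {form_ract (\<lambda>x y. c * \<psi> x y) a} = c * M {form_ract \<psi> a}"
        using MD(2) f kl by (simp add: forms_ract(1))
    qed
    moreover have "ract ?X M a \<in> carrier ?X"
      unfolding r
    proof (rule dual_form_moduleI[OF _ _ b(2)])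
      fix \<phi> \<psi> :: "'k op \<Rightarrow> 'k op \<Rightarrow> 'k" and c assume f: "\<phi> \<in> forms" "\<psi> \<in> forms"
      have "form_lact a (\<lambda>x y. \<psi> x y + \<phi> x y) = (\<lambda>x y. form_lact a \<psi> x y + form_lact a \<phi> x y)"
        by (simp add: form_lact_def fun_eq_iff)
      then show "M {form_lact a (\<lambda>x y. \<psi> x y + \<phi> x y)} = M {form_lact a \<psi>} + M {form_lact a \<phi>}"
        using MD(1) f kl by (simp add: forms_lact(1))
    next
      fix \<psi> :: "'k op \<Rightarrow> 'k op \<Rightarrow> 'k" and c assume f: "\<psi> \<in> forms"
      have "form_lact a (\<lambda>x y. c * \<psi> x y) = (\<lambda>x y. c * form_lact a \<psi> x y)"
        by (simp add: form_lact_def fun_eq_iff)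
      then show "M {form_lact a (\<lambda>x y. c * \<psi> x y)} = c * M {form_lact a \<psi>}"
        using MD(2) f kl by (simp add: forms_lact(1))
    qed
    ultimately have "D a {\<psi>} = lact ?X a M {\<psi>} - ract ?X M a {\<psi>}"
      unfolding M(2)[OF a] using \<psi> by (rule dual_form_module_minus)
    moreover have "{\<psi>} \<in> carrier ?E" using \<psi> by (auto simp: carr)
    ultimately show "\<psi> a id_blinfun = M {form_ract \<psi> a} - M {form_lact a \<psi>}"
      by (simp add: D_apply \<psi> l r)
  qed (use MD K in auto)
qed

section \<open>Matrix entries and matrix units\<close>

definition entry :: "'k::{real_normed_field, banach} op \<Rightarrow> nat \<Rightarrow> nat \<Rightarrow> 'k" where
  "entry x i k = tpair (x (biorth k)) (unit00 i)"

definition matrix_unit :: "nat \<Rightarrow> nat \<Rightarrow> 'k::{real_normed_field, banach} op" where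
  "matrix_unit i j = Blinfun (\<lambda>f. scale_tsirelson (tpair f (unit00 j)) (biorth i))"

lemma norm_biorth_le: "norm (biorth k) \<le> 1"
  by (rule norm_tsirelson_le) (simp add: norm_coord_le)

lemma matrix_unit_apply: "matrix_unit i j f = scale_tsirelson (tpair f (unit00 j)) (biorth i)"
proof -
  have "bounded_linear (\<lambda>f :: 'a tsirelson. scale_tsirelson (tpair f (unit00 j)) (biorth i))"
  proof (rule bounded_linear_intro[where K = "norm (biorth i :: 'a tsirelson)"])
    show "norm (scale_tsirelson (tpair x (unit00 j)) (biorth i)) \<le> norm x * norm (biorth i :: 'a tsirelson)"
      for x :: "'a tsirelson"
      using norm_tpair_le[of x "unit00 j"] by (simp add: norm_scale_tsirelson mult_right_mono)
  qed (simp_all add: tpair_add tsirelson.scale_left_distrib scaleR_tsirelson tpair_scale)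
  then show ?thesis unfolding matrix_unit_def by (simp add: bounded_linear_Blinfun_apply)
qed

lemma matrix_unit_in_AT: "matrix_unit i j \<in> carrier (approximable_algebra scale_tsirelson)"
proof -
  have "range (matrix_unit i j :: 'a op) \<subseteq> tsirelson.span {biorth i}"
  proof (rule image_subsetI)
    show "matrix_unit i j f \<in> tsirelson.span {biorth i}" for f :: "'a tsirelson"
      unfolding matrix_unit_apply by (intro tsirelson.span_scale tsirelson.span_base) simp
  qed
  then have "finite_rank scale_tsirelson (matrix_unit i j :: 'a op)"
    unfolding finite_rank_def
    by (intro conjI exI[of _ "{biorth i}"]) (auto simp: matrix_unit_apply tpair_scale)
  then have "matrix_unit i j \<in> closure {u :: 'a op. finite_rank scale_tsirelson u}"
    using closure_subset by blast
  then show ?thesis by (simp add: approximable_algebra_def)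
qed

lemma entry_matrix_unit_compose: "entry (matrix_unit p r o\<^sub>L x) i k = (if i = p then entry x r k else 0)"
  by (simp add: entry_def matrix_unit_apply tpair_scale)

lemma entry_compose_matrix_unit:
  "klinear x \<Longrightarrow> entry (x o\<^sub>L matrix_unit p r) i k = (if k = r then entry x i p else 0)"
  by (simp add: entry_def matrix_unit_apply klinear_def tpair_scale)

lemma entry_matrix_unit: "entry (matrix_unit p r) i k = (if i = p \<and> k = r then 1 else 0)"
  by (simp add: entry_def matrix_unit_apply tpair_scale)

lemma entry_id: "entry id_blinfun i k = (if i = k then 1 else 0)"
  by (simp add: entry_def)

lemma norm_entry_le: "norm (entry x i k) \<le> norm x"
proof -
  have "norm (entry x i k) \<le> norm (x (biorth k))"
    unfolding entry_def using norm_tpair_le[of "x (biorth k)" "unit00 i"] by simp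
  also have "\<dots> \<le> norm x * norm (biorth k :: 'a tsirelson)" by (rule norm_blinfun)
  also have "\<dots> \<le> norm x * 1" by (intro mult_left_mono norm_biorth_le) simp
  finally show ?thesis by simp
qed

lemma entry_linear:
  "entry (x + y) i k = entry x i k + entry y i k"
  "entry (scale_op scale_tsirelson c x) i k = c * entry x i k"
  by (simp_all add: entry_def blinfun.add_left tpair_add tpair_scale)

text \<open>The functional \<open>F\<close> with
  \<open>F (x \<otimes> y) = x\<^sub>i\<^sub>k y\<^sub>k\<^sub>j\<close>, turned into the form
  \<open>F (x \<otimes> y) - F (1 \<otimes> x y)\<close>; the correction occurs only for
  \<open>i = k\<close>, where the identity has a nonzero entry.\<close>

definition entry_form :: "nat \<Rightarrow> nat \<Rightarrow> nat \<Rightarrow> 'k::{real_normed_field, banach} op \<Rightarrow> 'k op \<Rightarrow> 'k" where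
  "entry_form k i j = (\<lambda>x y. if klinear x \<and> klinear y
     then entry x i k * entry y k j - (if i = k then entry (x o\<^sub>L y) k j else 0) else 0)"

lemma entry_form_in: "entry_form k i j \<in> forms"
proof -
  have "norm (entry_form k i j x y) \<le> 2 * (norm x * norm y)" for x y :: "'a op"
  proof -
    have "norm (entry x i k * entry y k j) \<le> norm x * norm y"
      unfolding norm_mult by (intro mult_mono norm_entry_le) auto
    moreover have "norm (if i = k then entry (x o\<^sub>L y) k j else 0) \<le> norm x * norm y"
      using norm_entry_le[of "x o\<^sub>L y" k j] norm_blinfun_compose[of x y] by auto
    ultimately show ?thesis
      using norm_triangle_ineq4[of "entry x i k * entry y k j" "if i = k then entry (x o\<^sub>L y) k j else 0"]
      unfolding entry_form_def by auto
  qed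
  note le = this
  show ?thesis
  proof (rule formsI[OF _ _ _ _ _ _ le])
    show "entry_form k i j x y = 0" if "\<not> (klinear x \<and> klinear y)" for x y :: "'a op"
      using that by (auto simp: entry_form_def)
    show "entry_form k i j id_blinfun y = 0" for y :: "'a op"
      by (simp add: entry_form_def entry_id)
  qed (simp_all add: entry_form_def klinear_add klinear_smult compose_add compose_smult entry_linear algebra_simps)
qed

text \<open>The sort of the scalar field supplies a compact unit sphere and an inner product, so the
  real and the complex case are treated at once.\<close>

theorem not_amenable_tsirelson:
  "\<not> amenable (approximable_algebra
      (scale_tsirelson :: 'k::{real_normed_field, euclidean_space} \<Rightarrow> 'k tsirelson \<Rightarrow> 'k tsirelson))"
proof
  assume "amenable (approximable_algebra (scale_tsirelson :: 'k \<Rightarrow> 'k tsirelson \<Rightarrow> 'k tsirelson))"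
  then obtain \<mu> :: "('k op \<Rightarrow> 'k op \<Rightarrow> 'k) \<Rightarrow> 'k" and K :: real where
    add: "\<And>\<psi> \<phi>. \<psi> \<in> forms \<Longrightarrow> \<phi> \<in> forms \<Longrightarrow> \<mu> (\<lambda>x y. \<psi> x y + \<phi> x y) = \<mu> \<psi> + \<mu> \<phi>"
    and hom: "\<And>c \<psi>. \<psi> \<in> forms \<Longrightarrow> \<mu> (\<lambda>x y. c * \<psi> x y) = c * \<mu> \<psi>"
    and K: "K \<ge> 0" "\<And>\<psi>. \<psi> \<in> forms \<Longrightarrow> norm (\<mu> \<psi>) \<le> K * form_norm \<psi>"
    and inner: "\<And>a \<psi>. a \<in> carrier (approximable_algebra scale_tsirelson) \<Longrightarrow> \<psi> \<in> forms \<Longrightarrow>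
       \<psi> a id_blinfun = \<mu> (form_ract \<psi> a) - \<mu> (form_lact a \<psi>)"
    by (rule amenable_imp_functional) blast
  have sum: "(\<lambda>x y. \<Sum>i\<in>I. c i * \<psi> i x y) \<in> forms \<and> \<mu> (\<lambda>x y. \<Sum>i\<in>I. c i * \<psi> i x y) = (\<Sum>i\<in>I. c i * \<mu> (\<psi> i))"
    if "finite I" "\<And>i. \<psi> i \<in> forms" for I :: "nat set" and c :: "nat \<Rightarrow> 'k" and \<psi> :: "nat \<Rightarrow> 'k op \<Rightarrow> 'k op \<Rightarrow> 'k"
    using that(1)
  proof (induction I)
    case empty
    show ?case using hom[OF forms_zero, of 0] forms_zero by simp
  next
    case (insert i I)
    have "\<mu> (\<lambda>x y. c i * \<psi> i x y + (\<Sum>i\<in>I. c i * \<psi> i x y))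
      = \<mu> (\<lambda>x y. c i * \<psi> i x y) + \<mu> (\<lambda>x y. \<Sum>i\<in>I. c i * \<psi> i x y)"
      by (rule add[OF forms_smult(1)[OF that(2)] conjunct1[OF insert.IH]])
    moreover have "(\<lambda>x y. c i * \<psi> i x y + (\<Sum>i\<in>I. c i * \<psi> i x y)) \<in> forms"
      by (rule forms_add(1)[OF forms_smult(1)[OF that(2)] conjunct1[OF insert.IH]])
    ultimately show ?case using insert hom[OF that(2)] by simp
  qed
  let ?\<psi> = "\<lambda>k i. entry_form k i i :: 'k op \<Rightarrow> 'k op \<Rightarrow> 'k"
  \<comment> \<open>The two actions of the matrix unit with indices \<open>i, j\<close> on
    \<open>entry_form k i j\<close> give the diagonal forms at \<open>j\<close> and at
    \<open>i\<close>. Hence \<open>\<mu>\<close> differs on them only by the contribution of the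
    identity.\<close>
  have \<mu>_diff: "\<mu> (?\<psi> k j) - \<mu> (?\<psi> k i) = (if j = k then 1 else 0) - (if i = k then 1 else 0)" for k i j
  proof -
    let ?a = "matrix_unit i j :: 'k op"
    have kl: "klinear ?a" by (rule klinear_AT[OF matrix_unit_in_AT])
    have "form_ract (entry_form k i j) ?a = ?\<psi> k j"
      by (intro ext) (auto simp: form_ract_def entry_form_def kl klinear_compose entry_matrix_unit_compose
          entry_matrix_unit compose_assoc)
    moreover have "form_lact ?a (entry_form k i j) = ?\<psi> k i"
      by (intro ext) (auto simp: form_lact_def entry_form_def kl klinear_compose entry_compose_matrix_unit
          compose_assoc[symmetric])
    moreover have "entry_form k i j ?a id_blinfun = (if j = k then 1 else 0) - (if i = k then 1 else 0)"
      by (auto simp: entry_form_def kl klinear_id entry_matrix_unit entry_id)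
    ultimately show ?thesis
      using inner[of ?a "entry_form k i j", OF matrix_unit_in_AT entry_form_in] by (simp only:)
  qed
  have \<mu>_entry: "\<mu> (?\<psi> k i) = (if i = k then 1 else 0)" for k i
  proof -
    \<comment> \<open>\<open>- c\<close> is the common value of the virtual diagonal on
      \<open>x\<^sub>i\<^sub>k y\<^sub>k\<^sub>i\<close>. It vanishes because the sum of these over
      \<open>i < n\<close> is the \<open>k\<close>-th diagonal entry of
      \<open>y P\<^sub>n x\<close>, bounded independently of \<open>n\<close>.\<close>
    define c where "c = \<mu> (?\<psi> k k) - 1"
    have \<mu>: "\<mu> (?\<psi> k i) = c + (if i = k then 1 else 0)" for i
      using \<mu>_diff[of k i k] by (simp add: c_def algebra_simps)
    have bound: "real n * norm c \<le> 2 * K + 1" if n: "n > k" for n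
    proof -
      let ?S = "\<lambda>x y. \<Sum>i\<in>{..<n}. 1 * ?\<psi> k i x y"
      have S: "?S \<in> forms" "\<mu> ?S = (\<Sum>i\<in>{..<n}. 1 * \<mu> (?\<psi> k i))"
        using sum[of "{..<n}" "?\<psi> k" "\<lambda>_. 1"] entry_form_in by blast+
      have "form_norm ?S \<le> 2"
      proof (rule form_norm_le)
        fix x y :: "'k op"
        show "norm (?S x y) \<le> 2 * (norm x * norm y)"
        proof (cases "klinear x \<and> klinear y")
          case True
          have "(\<Sum>i<n. entry x i k * entry y k i) = tpair (y (trunc n (x (biorth k)))) (unit00 k)"
            using True by (simp add: trunc_def blinfun_sum_scale tpair_sum tpair_scale entry_def)
          moreover have "norm (tpair (y (trunc n (x (biorth k)))) (unit00 k)) \<le> norm x * norm y"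
          proof -
            have "norm (trunc n f) \<le> norm f" for f :: "'k tsirelson"
            proof (rule norm_tsirelson_le)
              fix z
              have "norm (tpair f (proj {..<n} z)) \<le> norm f * norm (proj {..<n} z)" by (rule norm_tpair_le)
              also have "\<dots> \<le> norm f * norm z" by (intro mult_left_mono norm_proj_le) simp
              finally show "norm (tpair (trunc n f) z) \<le> norm f * norm z" by (simp add: tpair_trunc)
            qed
            then have "norm (trunc n (x (biorth k))) \<le> norm (x (biorth k))" .
            also have "\<dots> \<le> norm x * norm (biorth k :: 'k tsirelson)" by (rule norm_blinfun)
            also have "\<dots> \<le> norm x * 1" by (intro mult_left_mono norm_biorth_le) simp
            finally have "norm y * norm (trunc n (x (biorth k))) \<le> norm y * norm x"
              by (intro mult_left_mono) auto
            then have "norm (y (trunc n (x (biorth k)))) \<le> norm y * norm x"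
              using norm_blinfun order_trans by blast
            then show ?thesis
              using norm_tpair_le[of "y (trunc n (x (biorth k)))" "unit00 k"] by (simp add: mult.commute)
          qed
          moreover have "norm (entry (x o\<^sub>L y) k k) \<le> norm x * norm y"
            using norm_entry_le[of "x o\<^sub>L y" k k] norm_blinfun_compose[of x y] by linarith
          moreover have "?S x y = (\<Sum>i<n. entry x i k * entry y k i) - entry (x o\<^sub>L y) k k"
          proof -
            have "?S x y = (\<Sum>i<n. entry x i k * entry y k i - (if i = k then entry (x o\<^sub>L y) k k else 0))"
              using True by (intro sum.cong) (auto simp: entry_form_def)
            then show ?thesis using n by (simp add: sum_subtractf sum.delta)
          qed
          ultimately show ?thesis
            using norm_triangle_ineq4[of "\<Sum>i<n. entry x i k * entry y k i" "entry (x o\<^sub>L y) k k"] by simp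
        next
          case False
          then have "?S x y = 0" by (intro sum.neutral) (auto simp: entry_form_def)
          then show ?thesis by simp
        qed
      qed simp
      then have "norm (\<mu> ?S) \<le> K * 2"
        using K(2)[OF S(1)] mult_left_mono[OF _ K(1)] order_trans by blast
      moreover have "\<mu> ?S = of_nat n * c + 1"
        unfolding S(2) using n by (simp add: \<mu> sum.distrib sum.delta)
      ultimately have "norm (of_nat n * c + 1) \<le> K * 2" by simp
      then have "norm (of_nat n * c) \<le> K * 2 + 1"
        using norm_triangle_ineq4[of "of_nat n * c + 1" 1] by simp
      then show ?thesis by (simp add: norm_mult)
    qed
    have "norm c = 0"
    proof (rule ccontr)
      assume "norm c \<noteq> 0"
      then have pos: "norm c > 0" by simp
      obtain n where n: "real n * norm c > 2 * K + 1" using ex_less_of_nat_mult[OF pos] by blast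
      have "real n * norm c \<le> real (max n (Suc k)) * norm c" by (intro mult_right_mono) auto
      moreover have "k < max n (Suc k)" by (simp add: less_max_iff_disj)
      ultimately show False using bound[of "max n (Suc k)"] n by linarith
    qed
    then show ?thesis using \<mu> by simp
  qed
  \<comment> \<open>Then \<open>K * (768 * norm u)\<close> is at most \<open>K / (K + 1)\<close>,
    hence below 1.\<close>
  define e where "e = 1 / (768 * (K + 1))"
  have e: "e > 0" using K(1) by (simp add: e_def)
  obtain u :: "'k c00" and J where u: "(\<Sum>i<J. coord u i) = 1" "norm u < e"
    using ex_small_combination[OF e] by blast
  obtain m where m: "m \<ge> J" "\<And>x y. klinear x \<Longrightarrow> klinear y \<Longrightarrow>
    norm (\<Sum>i<J. coord u i * tpair (x (y (biorth i) - trunc m (y (biorth i)))) (unit00 i))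
      \<le> 768 * norm u * norm x * norm y"
    using trace_estimate[of J u] by blast
  define \<Psi> where "\<Psi> i = (\<lambda>x y. \<Sum>k\<in>{..<m}. 1 * ?\<psi> k i x y)" for i
  have \<Psi>: "\<Psi> i \<in> forms" "\<mu> (\<Psi> i) = (if i < m then 1 else 0)" for i
  proof -
    show "\<Psi> i \<in> forms" unfolding \<Psi>_def using sum[of "{..<m}" "\<lambda>k. ?\<psi> k i" "\<lambda>_. 1"] entry_form_in by blast
    have "\<mu> (\<Psi> i) = (\<Sum>k\<in>{..<m}. 1 * \<mu> (?\<psi> k i))"
      unfolding \<Psi>_def using sum[of "{..<m}" "\<lambda>k. ?\<psi> k i" "\<lambda>_. 1"] entry_form_in by blast
    then show "\<mu> (\<Psi> i) = (if i < m then 1 else 0)" by (simp add: \<mu>_entry)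
  qed
  \<comment> \<open>\<open>?T\<close> is \<open>- tr (D x Q y)\<close>: the sum over
    \<open>k < m\<close> leaves the truncated product minus the full one. As
    \<open>J \<le> m\<close>, every \<open>i < J\<close> meets \<open>k = i\<close> exactly once, so
    \<open>\<mu> ?T\<close> is the sum of \<open>u\<close>.\<close>
  let ?T = "\<lambda>x y. \<Sum>i\<in>{..<J}. coord u i * \<Psi> i x y"
  have T: "?T \<in> forms" "\<mu> ?T = (\<Sum>i\<in>{..<J}. coord u i * \<mu> (\<Psi> i))"
    using sum[of "{..<J}" \<Psi> "coord u"] \<Psi>(1) by blast+
  have "\<mu> ?T = (\<Sum>i<J. coord u i)"
    unfolding T(2) using m(1) by (intro sum.cong) (auto simp: \<Psi>(2))
  then have \<mu>T: "\<mu> ?T = 1" using u(1) by simp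
  have "form_norm ?T \<le> 768 * norm u"
  proof (rule form_norm_le)
    fix x y :: "'k op"
    show "norm (?T x y) \<le> 768 * norm u * (norm x * norm y)"
    proof (cases "klinear x \<and> klinear y")
      case True
      have "\<Psi> i x y = - tpair (x (y (biorth i) - trunc m (y (biorth i)))) (unit00 i)" if i: "i < J" for i
      proof -
        have "\<Psi> i x y = (\<Sum>k<m. entry x i k * entry y k i - (if i = k then entry (x o\<^sub>L y) k i else 0))"
          unfolding \<Psi>_def using True by (intro sum.cong) (auto simp: entry_form_def)
        also have "\<dots> = (\<Sum>k<m. entry x i k * entry y k i) - entry (x o\<^sub>L y) i i"
          using i m(1) by (simp add: sum_subtractf sum.delta')
        also have "(\<Sum>k<m. entry x i k * entry y k i) = tpair (x (trunc m (y (biorth i)))) (unit00 i)"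
          using True by (simp add: trunc_def blinfun_sum_scale tpair_sum tpair_scale entry_def mult.commute)
        finally show ?thesis by (simp add: blinfun.diff_right tpair_diff entry_def)
      qed
      then have "?T x y = - (\<Sum>i<J. coord u i * tpair (x (y (biorth i) - trunc m (y (biorth i)))) (unit00 i))"
        by (simp add: sum_negf)
      then show ?thesis using m(2)[of x y] True by (simp add: mult.assoc)
    next
      case False
      then have "\<Psi> i x y = 0" for i unfolding \<Psi>_def by (intro sum.neutral) (auto simp: entry_form_def)
      then have "?T x y = 0" by simp
      then show ?thesis by simp
    qed
  qed simp
  then have "K * form_norm ?T \<le> K * (768 * norm u)" using K(1) by (rule mult_left_mono)
  then have "1 \<le> K * (768 * norm u)" using K(2)[OF T(1)] \<mu>T by simp
  also have "\<dots> \<le> K * (768 * e)" using u(2) K(1) by (intro mult_left_mono) auto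
  also have "\<dots> < 1" using K(1) by (simp add: e_def field_simps)
  finally show False by simp
qed


theorem mainTheorem3:
  shows "\<not> amenable (approximable_algebra (scale_tsirelson :: real \<Rightarrow> real tsirelson \<Rightarrow> real tsirelson))
       \<and> \<not> amenable (approximable_algebra (scale_tsirelson :: complex \<Rightarrow> complex tsirelson \<Rightarrow> complex tsirelson))"
  using not_amenable_tsirelson not_amenable_tsirelson by (rule conjI)

end
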